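(* For each positive integer $n$, \[ \frac{1}{e \sqrt{n}} \le d_{TV}(\nu, \mathbb{E} \mu_n) \le \frac{e}{\sqrt{n}}, \] where $\mathbb{E}\mu_n$ is the mean empirical spectral measure of $\frac{1}{\sqrt n}G_n$, $G_n$ is an $n\times n$ complex Ginibre matrix, and $\nu$ is the uniform probability measure on the closed unit disc of $\mathbb{C}$.
   Context: $G_n$ is an $n\times n$ random matrix with i.i.d. standard complex Gaussian entries (each entry has density $\frac1\pi e^{-|z|^2}$ on $\mathbb{C}$; equivalently $G_n$ has density proportional to $e^{-\operatorname{tr}(GG^* )}$). The empirical spectral measure is $\mu_n = \frac1n\sum_{k=1}^n \delta_{\lambda_k}$, where $\lambda_1,\dots,\lambda_n$ are the eigenvalues of $\frac{1}{\sqrt n}G_n$ (with multiplicity), and $\mathbb{E}\mu_n$ is the probability measure $A\mapsto \mathbb{E}[\mu_n(A)]$ on $\mathbb{C}$. $\nu$ is the uniform probability measure on $D=\{z\in\mathbb{C} : |z|\le 1\}$. The total variation distance is $d_{TV}(\mu,\rho)=\sup_A|\mu(A)-\rho(A)|$, the supremum being over Borel sets $A\subseteq\mathbb{C}$. *)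

theory Defs
  imports "HOL-Probability.Probability" "Jordan_Normal_Form.Char_Poly"
begin

definition complex_ginibre :: "'w measure \<Rightarrow> nat \<Rightarrow> ('w \<Rightarrow> complex mat) \<Rightarrow> bool" where
  "complex_ginibre M n G \<longleftrightarrow>
     prob_space M \<and>
     (\<forall>\<omega>\<in>space M. G \<omega> \<in> carrier_mat n n) \<and>
     (\<forall>i<n. \<forall>j<n. distributed M lborel (\<lambda>\<omega>. G \<omega> $$ (i, j))
                   (\<lambda>z. ennreal (1 / pi * exp (- (cmod z)\<^sup>2)))) \<and>
     prob_space.indep_vars M (\<lambda>_. borel) (\<lambda>(i, j) \<omega>. G \<omega> $$ (i, j)) ({..<n} \<times> {..<n})"

text \<open>Eigenvalues are counted with algebraic multiplicity.\<close>

definition eigenvalues_mset :: "complex mat \<Rightarrow> complex multiset" where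
  "eigenvalues_mset A = proots (char_poly A)"

definition empirical_spectral_measure :: "complex mat \<Rightarrow> complex measure" where
  "empirical_spectral_measure A =
     measure_of UNIV (sets borel)
       (\<lambda>B. (\<Sum>z\<in>#eigenvalues_mset A. emeasure (return borel z) B) / of_nat (dim_row A))"

text \<open>
  The mean of a random measure \<open>\<mu>\<close>. As with every use of \<^const>\<open>measure_of\<close>, this
  has the stated values only if they form a measure, which holds as soon as
  \<open>\<omega> \<mapsto> \<mu> \<omega> B\<close> is measurable for every Borel set \<open>B\<close>; see
  \<open>emeasure_mean_measure\<close> below.
\<close>

definition mean_measure :: "'w measure \<Rightarrow> ('w \<Rightarrow> complex measure) \<Rightarrow> complex measure" where
  "mean_measure M \<mu> =
     measure_of UNIV (sets borel) (\<lambda>B. \<integral>\<^sup>+ \<omega>. emeasure (\<mu> \<omega>) B \<partial>M)"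

definition mean_spectral_measure ::
    "'w measure \<Rightarrow> nat \<Rightarrow> ('w \<Rightarrow> complex mat) \<Rightarrow> complex measure" where
  "mean_spectral_measure M n G =
     mean_measure M
       (\<lambda>\<omega>. empirical_spectral_measure (complex_of_real (1 / sqrt (real n)) \<cdot>\<^sub>m G \<omega>))"

definition uniform_disc :: "complex measure" where
  "uniform_disc = uniform_measure lborel (cball 0 1)"

text \<open>
  The supremum is real-valued; it is taken over a bounded set when both arguments are
  finite measures.
\<close>

definition dist_TV :: "complex measure \<Rightarrow> complex measure \<Rightarrow> real" where
  "dist_TV \<mu> \<rho> = (SUP A\<in>sets borel. \<bar>measure \<mu> A - measure \<rho> A\<bar>)"

lemma sets_empirical_spectral_measure [simp, measurable_cong]:
  "sets (empirical_spectral_measure A) = sets borel"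
  unfolding empirical_spectral_measure_def
  using sets.sigma_sets_eq[of borel] by (subst sets_measure_of) auto

lemma sets_mean_measure [simp, measurable_cong]: "sets (mean_measure M \<mu>) = sets borel"
  unfolding mean_measure_def
  using sets.sigma_sets_eq[of borel] by (subst sets_measure_of) auto

lemma emeasure_empirical_spectral_measure:
  assumes "B \<in> sets borel"
  shows "emeasure (empirical_spectral_measure A) B =
           (\<Sum>z\<in>#eigenvalues_mset A. emeasure (return borel z) B) / of_nat (dim_row A)"
proof (rule emeasure_measure_of[OF empirical_spectral_measure_def])
  show "sets borel \<subseteq> Pow (UNIV :: complex set)" by simp
  show "B \<in> sets (empirical_spectral_measure A)" using assms by simp
  let ?\<mu> = "\<lambda>E S B. (\<Sum>z\<in>#S. emeasure (return borel (z::complex)) B) / of_nat E :: ennreal"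
  show "positive (sets (empirical_spectral_measure A)) (?\<mu> (dim_row A) (eigenvalues_mset A))"
    by (auto simp: positive_def)
  have "(\<Sum>i. \<Sum>z\<in>#S. emeasure (return borel z) (F i)) =
        (\<Sum>z\<in>#S. emeasure (return borel z) (\<Union>i. F i))"
    if "range F \<subseteq> sets borel" "disjoint_family F" for F :: "nat \<Rightarrow> complex set" and S
  proof (induction S)
    case (add x S)
    have "(\<Sum>i. emeasure (return borel x) (F i)) = emeasure (return borel x) (\<Union>i. F i)"
      using that by (intro suminf_emeasure) auto
    with add show ?case by (simp add: suminf_add[symmetric])
  qed simp
  then show "countably_additive (sets (empirical_spectral_measure A))
               (?\<mu> (dim_row A) (eigenvalues_mset A))"
    by (auto simp: countably_additive_def divide_ennreal_def)
qed

lemma prob_space_empirical_spectral_measure: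
  assumes "A \<in> carrier_mat n n" "n > 0"
  shows "prob_space (empirical_spectral_measure A)"
proof
  have "(\<Sum>z\<in>#S. emeasure (return borel z) UNIV) = of_nat (size S)" for S :: "complex multiset"
    by (induction S) (auto simp: emeasure_return)
  moreover have "size (eigenvalues_mset A) = dim_row A"
    using degree_monic_char_poly[OF assms(1)] assms
    by (simp add: eigenvalues_mset_def size_proots_complex)
  moreover have "space (empirical_spectral_measure A) = UNIV"
    using sets_eq_imp_space_eq[OF sets_empirical_spectral_measure] by simp
  ultimately show "emeasure (empirical_spectral_measure A) (space (empirical_spectral_measure A)) = 1"
    using assms by (simp add: emeasure_empirical_spectral_measure ennreal_divide_self of_nat_less_top)
qed

lemma emeasure_mean_measure:
  assumes "B \<in> sets borel"
    and \<mu>: "\<And>\<omega>. \<omega> \<in> space M \<Longrightarrow> sets (\<mu> \<omega>) = sets borel"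
    and [measurable]: "\<And>B. B \<in> sets borel \<Longrightarrow> (\<lambda>\<omega>. emeasure (\<mu> \<omega>) B) \<in> borel_measurable M"
  shows "emeasure (mean_measure M \<mu>) B = (\<integral>\<^sup>+ \<omega>. emeasure (\<mu> \<omega>) B \<partial>M)"
proof (rule emeasure_measure_of[OF mean_measure_def])
  show "sets borel \<subseteq> Pow (UNIV :: complex set)" by simp
  show "B \<in> sets (mean_measure M \<mu>)" using assms by simp
  show "positive (sets (mean_measure M \<mu>)) (\<lambda>B. \<integral>\<^sup>+ \<omega>. emeasure (\<mu> \<omega>) B \<partial>M)"
    by (auto simp: positive_def)
  show "countably_additive (sets (mean_measure M \<mu>)) (\<lambda>B. \<integral>\<^sup>+ \<omega>. emeasure (\<mu> \<omega>) B \<partial>M)"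
  proof (rule countably_additiveI)
    fix F :: "nat \<Rightarrow> complex set"
    assume F: "range F \<subseteq> sets (mean_measure M \<mu>)" "disjoint_family F"
    then have "(\<Sum>i. \<integral>\<^sup>+ \<omega>. emeasure (\<mu> \<omega>) (F i) \<partial>M) = (\<integral>\<^sup>+ \<omega>. (\<Sum>i. emeasure (\<mu> \<omega>) (F i)) \<partial>M)"
      by (intro nn_integral_suminf[symmetric]) auto
    also have "\<dots> = (\<integral>\<^sup>+ \<omega>. emeasure (\<mu> \<omega>) (\<Union>i. F i) \<partial>M)"
      using F \<mu> by (intro nn_integral_cong suminf_emeasure) auto
    finally show "(\<Sum>i. \<integral>\<^sup>+ \<omega>. emeasure (\<mu> \<omega>) (F i) \<partial>M) = (\<integral>\<^sup>+ \<omega>. emeasure (\<mu> \<omega>) (\<Union>i. F i) \<partial>M)" .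
  qed
qed

end

theory Submission
  imports Defs "HOL-Real_Asymp.Real_Asymp"
begin

text \<open>
  The mean eigenvalue distribution of a Ginibre matrix is usually read off from the joint density of
  the eigenvalues, which needs the Schur decomposition and its Jacobian. The proof below computes
  the Cauchy transform of the mean measure instead, with linear algebra and Fubini's theorem only.

  Let \<open>T\<^sub>n x = exp (- x) * (\<Sum>k<n. (1 - k / n) * x ^ k / k!)\<close>, formally \<^term>\<open>ginibre_tail n x\<close>. The claim at the
  heart of the proof is that a diagonal entry of \<open>z (z - G)\<^sup>-\<^sup>1\<close> has mean \<open>1 - T\<^sub>n (\<bar>z\<bar>\<^sup>2)\<close>
  (\<open>resolvent_diagonal_mean\<close>). Expanding the determinant along one row, the entry becomes
  \<open>z c\<^sub>i / (z c\<^sub>i - \<Sum>j. g\<^sub>j c\<^sub>j)\<close>, where the row \<open>g\<close> is Gaussian and independent of the cofactors \<open>c\<close>. By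
  unitary invariance the linear form is a single complex Gaussian of variance \<open>\<parallel>c\<parallel>\<^sup>2\<close>, and by
  Newton's theorem for radial densities the mean over \<open>g\<close> is \<open>1 - exp (- \<bar>z\<bar>\<^sup>2 \<bar>c\<^sub>i\<bar>\<^sup>2 / \<parallel>c\<parallel>\<^sup>2)\<close>. The direction of
  \<open>c\<close> is that of \<open>(1, u)\<close> with \<open>u = (z - D)\<^sup>-\<^sup>1 b\<close>, where \<open>D\<close> is the complementary minor and \<open>b\<close> the rest of
  the column. Changing variables from \<open>b\<close> to \<open>u\<close> brings in the Jacobian \<open>\<bar>det (z - D)\<bar>\<^sup>2\<close>, and
  the average over \<open>D\<close> becomes a second moment of a determinant with independent entries, which
  is a sum over permutations weighted by fixed points (\<open>gauss_det_moment\<close>). The last integral,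
  over \<open>u\<close>, is rational and gives \<open>T\<^sub>n\<close>.

  Summing over the diagonal, the Cauchy transform of the mean measure of \<open>G / sqrt n\<close> is
  \<open>(1 - T\<^sub>n (n \<bar>z\<bar>\<^sup>2)) / z\<close>. Again by Newton's theorem, this is the Cauchy transform of the
  rotation-invariant law that gives mass \<open>T\<^sub>n (n r\<^sup>2)\<close> to the complement of the disc of radius \<open>r\<close>.
  The average of \<open>(z - c) / (z - l)\<close> over a disc around \<open>c\<close> is a bump function of \<open>l - c\<close>, so a finite
  measure is determined by its Cauchy transform (\<open>measure_eqI_bump\<close>, \<open>bump_integral_cauchy\<close>), and
  the two measures agree (\<open>mean_spectral_measure_ginibre\<close>).

  The density of this law is \<open>1 / pi\<close> times a partial sum of the exponential series of \<open>n \<bar>z\<bar>\<^sup>2\<close>, divided by its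
  full sum. Hence it stays below the uniform density on the unit disc, and the total variation
  distance is the mass outside the disc, \<open>T\<^sub>n n = exp (- n) * n ^ n / n!\<close>. An elementary form of
  Stirling's formula places this number between \<open>exp (-1) / sqrt n\<close> and \<open>exp (-3/4) / sqrt n\<close>, well
  within the asserted bounds.
\<close>

section \<open>Lebesgue measure on the complex plane\<close>

text \<open>
  Lebesgue measure is characterised by its values on boxes, and these are products. The
  presentation as a product measure opens the way to iterated integrals.
\<close>

lemma lborel_complex_eq_distr:
  "(lborel :: complex measure) = distr (lborel \<Otimes>\<^sub>M lborel) borel (\<lambda>(x, y). Complex x y)"
proof (rule lborel_eqI)
  have m[measurable]: "(\<lambda>(x, y). Complex x y) \<in> borel_measurable (lborel \<Otimes>\<^sub>M lborel :: (real \<times> real) measure)"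
    by (simp add: borel_measurable_complex_iff case_prod_unfold)
  fix l u :: complex assume le: "\<And>b. b \<in> Basis \<Longrightarrow> l \<bullet> b \<le> u \<bullet> b"
  have le': "Re l \<le> Re u" "Im l \<le> Im u" using le[of 1] le[of \<i>] by (auto simp: Basis_complex_def)
  have "(\<lambda>(x, y). Complex x y) -` box l u = {Re l <..< Re u} \<times> {Im l <..< Im u}"
    by (auto simp: box_def Basis_complex_def)
  then have "emeasure (distr (lborel \<Otimes>\<^sub>M lborel) borel (\<lambda>(x, y). Complex x y)) (box l u) =
     emeasure (lborel \<Otimes>\<^sub>M lborel) ({Re l <..< Re u} \<times> {Im l <..< Im u})"
    by (subst emeasure_distr) (auto simp: space_pair_measure)
  also have "\<dots> = ennreal ((Re u - Re l) * (Im u - Im l))"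
    using le' by (subst lborel.emeasure_pair_measure_Times) (auto simp: ennreal_mult)
  also have "\<dots> = ennreal (\<Prod>b\<in>Basis. (u - l) \<bullet> b)"
    by (simp add: Basis_complex_def)
  finally show "emeasure (distr (lborel \<Otimes>\<^sub>M lborel) borel (\<lambda>(x, y). Complex x y)) (box l u) =
    ennreal (\<Prod>b\<in>Basis. (u - l) \<bullet> b)" .
qed simp

lemma nn_integral_complex_iterated:
  assumes [measurable]: "f \<in> borel_measurable borel"
  shows "(\<integral>\<^sup>+z. f z \<partial>lborel) = (\<integral>\<^sup>+x. \<integral>\<^sup>+y. f (Complex x y) \<partial>lborel \<partial>lborel)"
proof -
  have [measurable]: "(\<lambda>(x, y). Complex x y) \<in> borel_measurable (borel \<Otimes>\<^sub>M borel)"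
    by (simp add: borel_measurable_complex_iff case_prod_unfold)
  show ?thesis
    by (subst lborel_complex_eq_distr, subst nn_integral_distr)
       (simp_all add: lborel.nn_integral_fst[symmetric] split_beta)
qed

lemma nn_integral_complex_translate:
  assumes [measurable]: "f \<in> borel_measurable borel"
  shows "(\<integral>\<^sup>+z. f (t + z) \<partial>lborel) = (\<integral>\<^sup>+z. f (z::complex) \<partial>lborel)"
proof -
  have "(\<integral>\<^sup>+z. f z \<partial>lborel) = (\<integral>\<^sup>+z. f z \<partial>(distr lborel borel ((+) t)))"
    by (simp add: lborel_distr_plus)
  also have "\<dots> = (\<integral>\<^sup>+z. f (t + z) \<partial>lborel)"
    by (subst nn_integral_distr) auto
  finally show ?thesis by simp
qed

text \<open>
  Multiplication by \<open>a = p + q \<i>\<close> is factored into one-dimensional substitutions: for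
  \<open>p \<noteq> 0\<close> the inner variable is sheared and scaled by \<open>(p\<^sup>2 + q\<^sup>2) / p\<close> and then the outer one by
  \<open>p\<close>; for \<open>p = 0\<close> the two coordinates are exchanged.
\<close>

lemma nn_integral_complex_mult:
  fixes a :: complex
  assumes [measurable]: "f \<in> borel_measurable borel" and a: "a \<noteq> 0"
  shows "ennreal ((cmod a)\<^sup>2) * (\<integral>\<^sup>+z. f (a * z) \<partial>lborel) = (\<integral>\<^sup>+z. f z \<partial>lborel)"
proof -
  define p q where "p = Re a" and "q = Im a"
  have [measurable]: "(\<lambda>(x, y). Complex x y) \<in> borel_measurable (borel \<Otimes>\<^sub>M borel)"
    by (simp add: borel_measurable_complex_iff case_prod_unfold)
  have aa: "(cmod a)\<^sup>2 = p\<^sup>2 + q\<^sup>2" by (simp add: p_def q_def cmod_power2)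
  have pos: "p\<^sup>2 + q\<^sup>2 > 0" using a aa by (metis zero_less_norm_iff zero_less_power)
  let ?F = "\<lambda>x y. f (Complex x y)"
  have meas[measurable]: "(\<lambda>x. f (Complex (g x) (h x))) \<in> borel_measurable N"
    if [measurable]: "g \<in> borel_measurable N" "h \<in> borel_measurable N" for g h and N :: "'b measure"
    by measurable
  have eq: "(\<integral>\<^sup>+z. f (a * z) \<partial>lborel) = (\<integral>\<^sup>+x. \<integral>\<^sup>+y. ?F (p * x - q * y) (q * x + p * y) \<partial>lborel \<partial>lborel)"
    by (subst nn_integral_complex_iterated)
       (auto intro!: nn_integral_cong arg_cong[where f=f] simp: complex_eq_iff p_def q_def algebra_simps)
  show ?thesis
  proof (cases "p = 0")
    case True
    with pos have q: "q \<noteq> 0" by auto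
    have "(\<integral>\<^sup>+z. f z \<partial>lborel) = (\<integral>\<^sup>+x. \<integral>\<^sup>+y. ?F x y \<partial>lborel \<partial>lborel)"
      by (rule nn_integral_complex_iterated) simp
    also have "\<dots> = ennreal \<bar>-q\<bar> * (\<integral>\<^sup>+x'. (\<integral>\<^sup>+y. ?F (- q * x') y \<partial>lborel) \<partial>lborel)"
      using q by (subst nn_integral_real_affine[where c="-q" and t=0]) auto
    also have "\<dots> = ennreal \<bar>-q\<bar> * (\<integral>\<^sup>+x'. ennreal \<bar>q\<bar> * (\<integral>\<^sup>+y'. ?F (- q * x') (q * y') \<partial>lborel) \<partial>lborel)"
      using q by (subst nn_integral_real_affine[where c="q" and t=0, of "\<lambda>y. ?F _ y"]) auto
    also have "\<dots> = ennreal (q\<^sup>2) * (\<integral>\<^sup>+x'. (\<integral>\<^sup>+y'. ?F (- q * x') (q * y') \<partial>lborel) \<partial>lborel)"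
      by (subst nn_integral_cmult) (auto simp: mult.assoc[symmetric] ennreal_mult[symmetric] power2_eq_square)
    also have "(\<integral>\<^sup>+x'. (\<integral>\<^sup>+y'. ?F (- q * x') (q * y') \<partial>lborel) \<partial>lborel) =
      (\<integral>\<^sup>+y'. (\<integral>\<^sup>+x'. ?F (- q * x') (q * y') \<partial>lborel) \<partial>lborel)"
      by (rule lborel_pair.Fubini') measurable
    finally show ?thesis unfolding eq aa by (simp add: True)
  next
    case False
    let ?d = "(p\<^sup>2 + q\<^sup>2) / p"
    have d: "?d \<noteq> 0" using pos False by auto
    have "(\<integral>\<^sup>+z. f z \<partial>lborel) = (\<integral>\<^sup>+x. \<integral>\<^sup>+y. ?F x y \<partial>lborel \<partial>lborel)"
      by (rule nn_integral_complex_iterated) simp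
    also have "\<dots> = (\<integral>\<^sup>+x. ennreal \<bar>?d\<bar> * (\<integral>\<^sup>+y'. ?F x (q * x / p + ?d * y') \<partial>lborel) \<partial>lborel)"
      using d by (intro nn_integral_cong nn_integral_real_affine) auto
    also have "\<dots> = ennreal \<bar>?d\<bar> * (\<integral>\<^sup>+x. (\<integral>\<^sup>+y'. ?F x (q * x / p + ?d * y') \<partial>lborel) \<partial>lborel)"
      by (subst nn_integral_cmult) auto
    also have "(\<integral>\<^sup>+x. (\<integral>\<^sup>+y'. ?F x (q * x / p + ?d * y') \<partial>lborel) \<partial>lborel) =
      (\<integral>\<^sup>+y'. (\<integral>\<^sup>+x. ?F x (q * x / p + ?d * y') \<partial>lborel) \<partial>lborel)"
      by (rule lborel_pair.Fubini') measurable
    also have "\<dots> = (\<integral>\<^sup>+y'. ennreal \<bar>p\<bar> * (\<integral>\<^sup>+x'. ?F (- q * y' + p * x') (q * (- q * y' + p * x') / p + ?d * y') \<partial>lborel) \<partial>lborel)"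
      using False by (intro nn_integral_cong nn_integral_real_affine[where c=p]) auto
    also have "\<dots> = ennreal \<bar>p\<bar> * (\<integral>\<^sup>+y'. (\<integral>\<^sup>+x'. ?F (p * x' - q * y') (q * x' + p * y') \<partial>lborel) \<partial>lborel)"
    proof -
      have *: "q * (- q * y' + p * x') / p + ?d * y' = q * x' + p * y'" for x' y'
        using False by (simp add: field_simps power2_eq_square)
      show ?thesis unfolding * by (subst nn_integral_cmult) (auto simp: algebra_simps)
    qed
    also have "(\<integral>\<^sup>+y'. (\<integral>\<^sup>+x'. ?F (p * x' - q * y') (q * x' + p * y') \<partial>lborel) \<partial>lborel) = 
      (\<integral>\<^sup>+x'. (\<integral>\<^sup>+y'. ?F (p * x' - q * y') (q * x' + p * y') \<partial>lborel) \<partial>lborel)"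
      by (rule lborel_pair.Fubini') measurable
    also have "ennreal \<bar>?d\<bar> * (ennreal \<bar>p\<bar> * X) = ennreal ((cmod a)\<^sup>2) * X" for X
      using False pos unfolding aa by (simp add: mult.assoc[symmetric] ennreal_mult[symmetric] abs_mult[symmetric])
    finally show ?thesis unfolding eq by simp
  qed
qed

lemma nn_integral_complex_affine:
  fixes a :: complex
  assumes [measurable]: "f \<in> borel_measurable borel" and a: "a \<noteq> 0"
  shows "ennreal ((cmod a)\<^sup>2) * (\<integral>\<^sup>+z. f (t + a * z) \<partial>lborel) = (\<integral>\<^sup>+z. f z \<partial>lborel)"
  using nn_integral_complex_mult[of "\<lambda>z. f (t + z)" a] nn_integral_complex_translate[of f t] a by simp

lemma distr_lborel_complex_rotate:
  fixes a :: complex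
  assumes "cmod a = 1"
  shows "distr lborel borel ((*) a) = lborel"
proof (rule measure_eqI)
  fix A assume "A \<in> sets (distr lborel borel ((*) a))"
  then have A[measurable]: "A \<in> sets borel" by simp
  have "emeasure (distr lborel borel ((*) a)) A = (\<integral>\<^sup>+z. indicator A z \<partial>distr lborel borel ((*) a))"
    by simp
  also have "\<dots> = (\<integral>\<^sup>+z. indicator A (a * z) \<partial>lborel)"
    by (subst nn_integral_distr) auto
  also have "\<dots> = (\<integral>\<^sup>+z. indicator A z \<partial>lborel)"
    using nn_integral_complex_mult[of "indicator A" a] assms by (cases "a = 0") auto
  finally show "emeasure (distr lborel borel ((*) a)) A = emeasure lborel A"
    by simp
qed simp

text \<open>
  Under Lebesgue measure the squared modulus has constant density \<open>pi\<close> on the half line,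
  because the disc of radius \<open>r\<close> has area \<open>pi * r\<^sup>2\<close>. Using \<open>(cmod z)\<^sup>2\<close> rather than \<open>cmod z\<close> as the
  variable removes every Jacobian from the later radial computations.
\<close>

lemma nn_integral_complex_radial:
  assumes [measurable]: "f \<in> borel_measurable borel"
  shows "(\<integral>\<^sup>+z. f ((cmod z)\<^sup>2) \<partial>lborel) = ennreal pi * (\<integral>\<^sup>+t\<in>{0..}. f t \<partial>lborel)"
proof -
  have "distr lborel borel (\<lambda>z::complex. (cmod z)\<^sup>2) = density lborel (\<lambda>t. ennreal pi * indicator {0..} t)"
    (is "?L = ?R")
  proof (rule measure_eqI_generator_eq[where E="range atMost" and \<Omega>=UNIV and A="\<lambda>n. {..real n}"])
    show "Int_stable (range atMost :: real set set)" 
      by (auto simp: Int_stable_def)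
    show "sets ?L = sigma_sets UNIV (range atMost)" "sets ?R = sigma_sets UNIV (range atMost)"
      by (simp_all add: borel_eq_atMost sets_measure_of_conv)
    fix X :: "real set" assume "X \<in> range atMost"
    then obtain r where X: "X = {..r}" by auto
    have "emeasure ?L X = emeasure lborel {z::complex. (cmod z)\<^sup>2 \<le> r}"
      unfolding X by (subst emeasure_distr) (auto intro!: arg_cong[where f="emeasure _"])
    also have "\<dots> = ennreal (pi * max 0 r)"
    proof (cases "r \<ge> 0")
      case True
      have "{z::complex. (cmod z)\<^sup>2 \<le> r} = cball 0 (sqrt r)"
        using True real_le_rsqrt real_sqrt_le_iff real_sqrt_abs by (auto simp: dist_norm sqrt_ge_absD)
      then show ?thesis using True by (simp add: emeasure_cball unit_ball_vol_2)
    next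
      case False
      have "{z::complex. (cmod z)\<^sup>2 \<le> r} = {}"
        using False by (auto simp: not_le intro: order_trans[of 0])
          (meson less_le_trans zero_le_power2 not_less)
      then show ?thesis using False by simp
    qed
    also have "\<dots> = emeasure ?R X"
    proof -
      have "emeasure ?R X = ennreal pi * emeasure lborel ({0..} \<inter> {..r})"
        unfolding X by (subst emeasure_density)
          (auto simp: mult.assoc indicator_inter_arith[symmetric] nn_integral_cmult_indicator)
      also have "{0..} \<inter> {..r} = {0..r}" by auto
      finally show ?thesis by (cases "r \<ge> 0") (auto simp: ennreal_mult)
    qed
    finally show "emeasure ?L X = emeasure ?R X" .
  next
    fix n
    have "emeasure ?L {..real n} = emeasure lborel {z::complex. (cmod z)\<^sup>2 \<le> real n}"
      by (subst emeasure_distr) (auto intro!: arg_cong[where f="emeasure _"])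
    also have "{z::complex. (cmod z)\<^sup>2 \<le> real n} = cball 0 (sqrt (real n))"
      by (auto simp: dist_norm real_le_rsqrt sqrt_ge_absD)
    also have "emeasure lborel \<dots> \<noteq> \<infinity>" by (simp add: emeasure_cball)
    finally show "emeasure ?L {..real n} \<noteq> \<infinity>" .
  qed (auto simp: real_arch_simple)
  then have "(\<integral>\<^sup>+t. f t \<partial>?L) = (\<integral>\<^sup>+t. f t \<partial>?R)" by simp
  then show ?thesis
    by (simp add: nn_integral_distr nn_integral_density nn_integral_cmult[symmetric] mult_ac)
qed

section \<open>The standard complex Gaussian distribution\<close>

definition cgauss :: "complex measure" where
  "cgauss = density lborel (\<lambda>z. ennreal (1 / pi * exp (- (cmod z)\<^sup>2)))"

lemma sets_cgauss [simp, measurable_cong]: "sets cgauss = sets borel"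
  by (simp add: cgauss_def)

lemma space_cgauss [simp]: "space cgauss = UNIV"
  by (simp add: cgauss_def)

lemma nn_integral_cgauss:
  "f \<in> borel_measurable borel \<Longrightarrow>
     (\<integral>\<^sup>+z. f z \<partial>cgauss) = (\<integral>\<^sup>+z. ennreal (1 / pi * exp (- (cmod z)\<^sup>2)) * f z \<partial>lborel)"
  unfolding cgauss_def by (rule nn_integral_density) auto

lemma nn_integral_exp_tail:
  "a \<ge> 0 \<Longrightarrow> (\<integral>\<^sup>+t. ennreal (exp (- t)) * indicator {a..} t \<partial>lborel) = ennreal (exp (- a))"
proof -
  have "(\<integral>\<^sup>+t. ennreal (exp (- t)) * indicator {a..} t \<partial>lborel) = ennreal (0 - (- exp (- a)))"
  proof (rule nn_integral_FTC_atLeast)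
    show "((\<lambda>t. - exp (- t) :: real) \<longlongrightarrow> 0) at_top"
      using tendsto_minus[OF filterlim_compose[OF exp_at_bot filterlim_uminus_at_bot_at_top]] by simp
  qed (auto intro!: derivative_eq_intros)
  then show ?thesis by simp
qed

lemma emeasure_cgauss_outside:
  assumes "r \<ge> 0"
  shows "emeasure cgauss {z. r \<le> cmod z} = ennreal (exp (- r\<^sup>2))"
proof -
  have "emeasure cgauss {z. r \<le> cmod z} = (\<integral>\<^sup>+z. indicator {z. r \<le> cmod z} z \<partial>cgauss)"
    by simp
  also have "\<dots> = (\<integral>\<^sup>+z. (\<lambda>t. ennreal (1 / pi * exp (- t)) * indicator {r\<^sup>2..} t) ((cmod z)\<^sup>2) \<partial>lborel)"
    using assms by (subst nn_integral_cgauss)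
      (auto intro!: nn_integral_cong simp: indicator_def abs_le_square_iff[symmetric])
  also have "\<dots> = ennreal pi * (\<integral>\<^sup>+t\<in>{0..}. ennreal (1 / pi * exp (- t)) * indicator {r\<^sup>2..} t \<partial>lborel)"
    by (rule nn_integral_complex_radial) simp
  also have "\<dots> = (\<integral>\<^sup>+t. ennreal (exp (- t)) * indicator {r\<^sup>2..} t \<partial>lborel)"
  proof (subst nn_integral_cmult[symmetric], simp, intro nn_integral_cong)
    fix t
    have "t \<ge> 0" if "t \<ge> r\<^sup>2" using that zero_le_power2[of r] by linarith
    then show "ennreal pi * (ennreal (1 / pi * exp (- t)) * indicator {r\<^sup>2..} t * indicator {0..} t) =
      ennreal (exp (- t)) * indicator {r\<^sup>2..} t"
      by (auto simp: indicator_def ennreal_mult[symmetric])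
  qed
  also have "\<dots> = ennreal (exp (- r\<^sup>2))"
    by (rule nn_integral_exp_tail) simp
  finally show ?thesis .
qed

lemma prob_space_cgauss: "prob_space cgauss"
  using emeasure_cgauss_outside[of 0] by (intro prob_spaceI) auto

interpretation cgauss: prob_space cgauss by (rule prob_space_cgauss)

section \<open>Newton's theorem for rotation-invariant weights\<close>

lemma integral_complex_rotate:
  fixes f :: "complex \<Rightarrow> complex"
  assumes [measurable]: "f \<in> borel_measurable borel" and a: "cmod a = 1"
  shows "(\<integral>z. f (a * z) \<partial>lborel) = (\<integral>z. f z \<partial>lborel)"
proof -
  have "(\<integral>z. f z \<partial>lborel) = (\<integral>z. f z \<partial>distr lborel borel ((*) a))"
    by (simp add: distr_lborel_complex_rotate[OF a])
  also have "\<dots> = (\<integral>z. f (a * z) \<partial>lborel)"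
    by (subst integral_distr) auto
  finally show ?thesis by simp
qed

text \<open>
  Such rotations kill the nonconstant terms of a geometric series in Newton's theorem, and the
  odd Gaussian moments.
\<close>

lemma integral_rotation_antisymmetric:
  fixes f :: "complex \<Rightarrow> complex"
  assumes [measurable]: "f \<in> borel_measurable borel" and a: "cmod a = 1"
    and anti: "\<And>z. f (a * z) = - f z"
  shows "(\<integral>z. f z \<partial>lborel) = 0"
  using integral_complex_rotate[of f a] a by (simp add: anti)

lemma AE_cmod_neq: "AE z::complex in lborel. cmod z \<noteq> r"
proof (rule AE_I)
  have "emeasure lborel {z::complex. cmod z = r} \<le> (\<integral>\<^sup>+z. (\<lambda>t. indicator {r\<^sup>2} t) ((cmod z)\<^sup>2) \<partial>(lborel :: complex measure))"
    by (subst nn_integral_indicator[symmetric]) (auto intro!: nn_integral_mono simp del: nn_integral_indicator simp: indicator_def)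
  also have "\<dots> = ennreal pi * (\<integral>\<^sup>+t\<in>{0..}. indicator {r\<^sup>2} t \<partial>lborel)"
    by (rule nn_integral_complex_radial) simp
  also have "(\<integral>\<^sup>+t\<in>{0..}. indicator {r\<^sup>2} t \<partial>lborel) = (\<integral>\<^sup>+t. indicator {r\<^sup>2} t \<partial>lborel)"
    by (intro nn_integral_cong) (auto simp: indicator_def)
  finally show "emeasure lborel {z::complex. cmod z = r} = 0" by simp
qed auto

text \<open>
  On \<open>cmod l < cmod z\<close> the kernel \<open>z / (z - l)\<close> is the geometric series in \<open>l / z\<close>, and inside it
  is minus the geometric series in \<open>z / l\<close> without its constant term. Against a rotation-invariant
  weight only the constant term \<open>1\<close> of the outer series survives. Cutting out an annulus around the
  circle of radius \<open>cmod l\<close> bounds the kernel, which gives dominated convergence of the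
  partial sums.
\<close>

lemma newton_cut:
  fixes w :: "real \<Rightarrow> real" and l :: complex
  assumes [measurable]: "w \<in> borel_measurable borel"
    and int: "integrable lborel (\<lambda>z::complex. w (cmod z))" and e: "e > 0"
  defines "A \<equiv> {z. e < \<bar>cmod z - cmod l\<bar>}"
  shows "(\<integral>z. complex_of_real (w (cmod z) * indicator A z) * (z / (z - l)) \<partial>lborel) =
         (\<integral>z. complex_of_real (w (cmod z) * indicator A z * indicator {z. cmod l < cmod z} z) \<partial>lborel)"
proof -
  define out where "out = {z. cmod l < cmod z}"
  \<comment> \<open>the ratio of whichever geometric series converges at \<open>z\<close>\<close>
  define q where "q z = (if cmod l < cmod z then l / z else z / l)" for z
  have [measurable]: "A \<in> sets borel" "out \<in> sets borel" unfolding A_def out_def by auto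
  have [measurable]: "q \<in> borel_measurable borel" unfolding q_def by measurable
  define W where "W z = complex_of_real (w (cmod z) * indicator A z)" for z
  have [measurable]: "W \<in> borel_measurable borel" unfolding W_def by measurable
  have rotW: "W (a * z) = W z" if "cmod a = 1" for a z
    using that by (auto simp: W_def A_def norm_mult indicator_def)
  have rotO: "a * z \<in> out \<longleftrightarrow> z \<in> out" if "cmod a = 1" for a z
    using that by (auto simp: out_def norm_mult)
  have qA: "cmod (q z) < 1" if "z \<in> A" for z
    using that e by (auto simp: A_def q_def norm_divide abs_real_def divide_simps split: if_splits)
  have q1: "cmod (q z) \<le> 1" for z
    by (auto simp: q_def norm_divide divide_simps)
  have far: "cmod (z / (z - l)) \<le> 1 + cmod l / e" if "z \<in> A" for z
  proof -
    have d: "cmod (z - l) > e" using that norm_triangle_ineq3[of z l] by (auto simp: A_def)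
    then have "z - l \<noteq> 0" using e by auto
    then have "z / (z - l) = 1 + l / (z - l)" by (simp add: divide_simps)
    then have "cmod (z / (z - l)) \<le> 1 + cmod l / cmod (z - l)"
      by (metis norm_divide norm_one norm_triangle_ineq)
    also have "\<dots> \<le> 1 + cmod l / e" using d e by (intro add_left_mono divide_left_mono mult_pos_pos) auto
    finally show ?thesis .
  qed
  \<comment> \<open>the rotation that changes the sign of the term of degree \<open>Suc j\<close>\<close>
  have cisj: "cis (pi / real (Suc j)) ^ Suc j = -1" for j
    using Complex.DeMoivre[of "pi / real (Suc j)" "Suc j"] by simp
  have intW: "integrable lborel W"
    unfolding W_def by (rule Bochner_Integration.integrable_bound[OF int]) (auto simp: indicator_def)
  \<comment> \<open>the \<open>N\<close>-th partial sum of the series, in closed form\<close>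
  define S where "S N z = W z * ((1 - q z ^ N) * (z / (z - l)))" for N z
  have lim: "(\<lambda>N. \<integral>z. S N z \<partial>lborel) \<longlonglongrightarrow> (\<integral>z. W z * (z / (z - l)) \<partial>lborel)"
  proof (rule integral_dominated_convergence[where w="\<lambda>z. 2 * (1 + cmod l / e) * cmod (W z)"])
    show "integrable lborel (\<lambda>z. 2 * (1 + cmod l / e) * cmod (W z))" using intW by auto
    show "AE z in lborel. (\<lambda>N. S N z) \<longlonglongrightarrow> W z * (z / (z - l))"
    proof (rule AE_I2)
      fix z
      show "(\<lambda>N. S N z) \<longlonglongrightarrow> W z * (z / (z - l))"
      proof (cases "z \<in> A")
        case True
        have "(\<lambda>N. W z * ((1 - q z ^ N) * (z / (z - l)))) \<longlonglongrightarrow> W z * ((1 - 0) * (z / (z - l)))"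
          by (intro tendsto_intros LIMSEQ_power_zero qA True)
        then show ?thesis by (simp add: S_def)
      qed (auto simp: S_def W_def)
    qed
    show "AE z in lborel. cmod (S N z) \<le> 2 * (1 + cmod l / e) * cmod (W z)" for N
    proof (rule AE_I2)
      fix z
      show "cmod (S N z) \<le> 2 * (1 + cmod l / e) * cmod (W z)"
      proof (cases "z \<in> A")
        case True
        have "cmod (1 - q z ^ N) \<le> 1 + cmod (q z) ^ N"
          by (metis norm_one norm_power norm_triangle_ineq4)
        also have "\<dots> \<le> 2" using q1[of z] by (simp add: power_le_one)
        finally have "cmod (1 - q z ^ N) * cmod (z / (z - l)) \<le> 2 * (1 + cmod l / e)"
          using far[OF True] by (intro mult_mono) auto
        then have "cmod (W z) * (cmod (1 - q z ^ N) * cmod (z / (z - l))) \<le> cmod (W z) * (2 * (1 + cmod l / e))"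
          by (rule mult_left_mono) auto
        then show ?thesis unfolding S_def norm_mult by (simp add: mult_ac)
      qed (auto simp: S_def W_def)
    qed
  qed (auto simp: S_def)
  have terms: "S N z = (\<Sum>j<N. W z * (if z \<in> out then (l / z) ^ j else - ((z / l) ^ Suc j)))" for N z
  proof (cases "z \<in> A")
    case True
    have q': "q z \<noteq> 1" using qA[OF True] by auto
    have "(1 - q z ^ N) * (z / (z - l)) = (\<Sum>j<N. if z \<in> out then (l / z) ^ j else - ((z / l) ^ Suc j))"
    proof (cases "z \<in> out")
      case True
      then have "z \<noteq> 0" by (auto simp: out_def)
      have "(\<Sum>j<N. q z ^ j) = (1 - q z ^ N) / (1 - q z)" using q' by (simp add: sum_gp_strict)
      also have "1 - q z = (z - l) / z" using True \<open>z \<noteq> 0\<close> by (auto simp: q_def out_def field_simps)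
      finally show ?thesis using True by (simp add: q_def out_def)
    next
      case False
      have "l \<noteq> 0" using False \<open>z \<in> A\<close> e norm_ge_zero[of z] by (auto simp: out_def A_def simp del: norm_ge_zero)
      then have zl: "z - l \<noteq> 0" using q' False by (auto simp: q_def out_def)
      have "(\<Sum>j<N. q z ^ j) = (1 - q z ^ N) / (1 - q z)" using q' by (simp add: sum_gp_strict)
      also have "1 - q z = (l - z) / l" using False \<open>l \<noteq> 0\<close> by (auto simp: q_def out_def field_simps)
      finally have "- (q z) * (\<Sum>j<N. q z ^ j) = - q z * ((1 - q z ^ N) / ((l - z) / l))" by simp
      also have "\<dots> = (1 - q z ^ N) * (z / (z - l))"
        using False \<open>l \<noteq> 0\<close> zl by (simp add: q_def out_def divide_simps) (simp add: algebra_simps)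
      finally show ?thesis using False by (simp add: q_def out_def sum_distrib_left sum_negf)
    qed
    then show ?thesis by (simp add: S_def sum_distrib_left)
  qed (auto simp: S_def W_def)
  have val: "(\<integral>z. S (Suc N) z \<partial>lborel) = (\<integral>z. W z * indicator out z \<partial>lborel)" for N
  proof -
    let ?t = "\<lambda>j z. W z * (if z \<in> out then (l / z) ^ j else - ((z / l) ^ Suc j))"
    have it: "integrable lborel (?t j)" for j
    proof (rule Bochner_Integration.integrable_bound[OF intW])
      have "cmod (?t j z) \<le> cmod (W z) * 1" for z
      proof -
        have "cmod (if z \<in> out then (l / z) ^ j else - ((z / l) ^ Suc j)) \<le> 1"
          using q1[of z] unfolding q_def out_def by (auto simp: norm_power simp del: power_Suc intro!: power_le_one)
        then show ?thesis unfolding norm_mult by (intro mult_left_mono) auto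
      qed
      then show "AE z in lborel. cmod (?t j z) \<le> cmod (W z)" by auto
    qed measurable
    have z1: "(\<integral>z. W z * (if z \<in> out then (l / z) ^ Suc j else 0) \<partial>lborel) = 0" for j
    proof (rule integral_rotation_antisymmetric[where a="cis (pi / real (Suc j))"])
      fix z
      have "(l / (cis (pi / real (Suc j)) * z)) ^ Suc j = - ((l / z) ^ Suc j)"
        by (simp only: power_divide power_mult_distrib cisj) simp
      then show "W (cis (pi / real (Suc j)) * z) * (if cis (pi / real (Suc j)) * z \<in> out then (l / (cis (pi / real (Suc j)) * z)) ^ Suc j else 0) =
         - (W z * (if z \<in> out then (l / z) ^ Suc j else 0))"
        by (subst rotW, simp, subst rotO, simp) (simp del: power_Suc)
    qed auto
    have z2: "(\<integral>z. W z * (if z \<in> out then 0 else - ((z / l) ^ Suc j)) \<partial>lborel) = 0" for j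
    proof (rule integral_rotation_antisymmetric[where a="cis (pi / real (Suc j))"])
      fix z
      have "(cis (pi / real (Suc j)) * z / l) ^ Suc j = - ((z / l) ^ Suc j)"
        by (simp only: power_divide power_mult_distrib cisj) simp
      then show "W (cis (pi / real (Suc j)) * z) * (if cis (pi / real (Suc j)) * z \<in> out then 0 else - ((cis (pi / real (Suc j)) * z / l) ^ Suc j)) =
         - (W z * (if z \<in> out then 0 else - ((z / l) ^ Suc j)))"
        by (subst rotW, simp, subst rotO, simp) (simp del: power_Suc)
    qed auto
    have i1: "integrable lborel (\<lambda>z. W z * (if z \<in> out then (l / z) ^ j else 0))"
      and i2: "integrable lborel (\<lambda>z. W z * (if z \<in> out then 0 else - ((z / l) ^ Suc j)))" for j
      by (rule Bochner_Integration.integrable_bound[OF it[of j]]; auto simp del: power_Suc)+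
    have "(\<integral>z. ?t j z \<partial>lborel) = (\<integral>z. W z * (if z \<in> out then (l / z) ^ j else 0) + W z * (if z \<in> out then 0 else - ((z / l) ^ Suc j)) \<partial>lborel)" for j
      by (intro Bochner_Integration.integral_cong) auto
    also have "\<dots> j = (\<integral>z. W z * (if z \<in> out then (l / z) ^ j else 0) \<partial>lborel)" for j
      by (subst Bochner_Integration.integral_add[OF i1 i2]) (simp only: z2 add_0_right)
    finally have tj: "(\<integral>z. ?t j z \<partial>lborel) = (\<integral>z. W z * (if z \<in> out then (l / z) ^ j else 0) \<partial>lborel)" for j .
    have "(\<integral>z. S (Suc N) z \<partial>lborel) = (\<Sum>j<Suc N. \<integral>z. ?t j z \<partial>lborel)"
      unfolding terms by (rule Bochner_Integration.integral_sum) (rule it)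
    also have "\<dots> = (\<Sum>j<Suc N. \<integral>z. W z * (if z \<in> out then (l / z) ^ j else 0) \<partial>lborel)"
      unfolding tj ..
    also have "\<dots> = (\<integral>z. W z * (if z \<in> out then (l / z) ^ 0 else 0) \<partial>lborel)"
      unfolding sum.lessThan_Suc_shift z1 by simp
    also have "\<dots> = (\<integral>z. W z * indicator out z \<partial>lborel)"
      by (intro Bochner_Integration.integral_cong) auto
    finally show ?thesis .
  qed
  have "(\<lambda>N. \<integral>z. S (Suc N) z \<partial>lborel) \<longlonglongrightarrow> (\<integral>z. W z * (z / (z - l)) \<partial>lborel)"
    using lim by (rule LIMSEQ_Suc)
  then have "(\<integral>z. W z * (z / (z - l)) \<partial>lborel) = (\<integral>z. W z * indicator out z \<partial>lborel)"
    unfolding val by (simp add: LIMSEQ_const_iff)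
  then show ?thesis by (simp add: W_def out_def of_real_indicator mult.assoc)
qed

text \<open>
  Newton's theorem: a radial mass distribution attracts as if the part inside the circle
  through the observer were concentrated at the centre and the part outside were absent. The
  annuli that were cut out shrink to a circle, which is a null set.
\<close>

lemma newton_radial:
  fixes w :: "real \<Rightarrow> real" and l :: complex
  assumes [measurable]: "w \<in> borel_measurable borel"
    and int: "integrable lborel (\<lambda>z::complex. w (cmod z))"
    and int2: "integrable lborel (\<lambda>z::complex. w (cmod z) * (cmod (z / (z - l))))"
  shows "(\<integral>z. complex_of_real (w (cmod z)) * (z / (z - l)) \<partial>lborel) =
         complex_of_real (\<integral>z. w (cmod z) * indicator {z. cmod l < cmod z} z \<partial>lborel)"
proof -
  define A where "A k = {z. inverse (real (Suc k)) < \<bar>cmod z - cmod l\<bar>}" for k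
  have [measurable]: "A k \<in> sets borel" for k unfolding A_def by auto
  have ev: "eventually (\<lambda>k. indicator (A k) z = (1::real)) sequentially" if "cmod z \<noteq> cmod l" for z
  proof -
    have "\<bar>cmod z - cmod l\<bar> > 0" using that by auto
    then obtain k0 where "inverse (real (Suc k0)) < \<bar>cmod z - cmod l\<bar>" using reals_Archimedean by blast
    then have "z \<in> A k" if "k \<ge> k0" for k
      using that unfolding A_def by (auto elim!: order.strict_trans1[rotated] intro!: le_imp_inverse_le)
    then show ?thesis unfolding eventually_sequentially by (intro exI[of _ k0]) (auto simp: indicator_def)
  qed
  have AEA: "AE z in lborel. (\<lambda>k. indicator (A k) z) \<longlonglongrightarrow> (1::real)"
    using AE_cmod_neq[of "cmod l"]
    by eventually_elim (rule tendsto_eventually, rule ev)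
  let ?f = "\<lambda>k z. complex_of_real (w (cmod z) * indicator (A k) z) * (z / (z - l))"
  let ?g = "\<lambda>k z. complex_of_real (w (cmod z) * indicator (A k) z * indicator {z. cmod l < cmod z} z)"
  have "(\<lambda>k. \<integral>z. ?f k z \<partial>lborel) \<longlonglongrightarrow> (\<integral>z. complex_of_real (w (cmod z)) * (z / (z - l)) \<partial>lborel)"
  proof (rule integral_dominated_convergence[where w="\<lambda>z. norm (w (cmod z) * cmod (z / (z - l)))"])
    show "AE z in lborel. (\<lambda>k. ?f k z) \<longlonglongrightarrow> complex_of_real (w (cmod z)) * (z / (z - l))"
      using AEA
    proof eventually_elim
      case (elim z)
      have "(\<lambda>k. ?f k z) \<longlonglongrightarrow> complex_of_real (w (cmod z) * 1) * (z / (z - l))"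
        by (intro tendsto_intros elim)
      then show ?case by simp
    qed
    show "integrable lborel (\<lambda>z. norm (w (cmod z) * cmod (z / (z - l))))"
      by (rule integrable_norm[OF int2])
    show "AE z in lborel. cmod (?f k z) \<le> norm (w (cmod z) * cmod (z / (z - l)))" for k
      by (rule AE_I2) (auto simp: norm_mult norm_divide abs_mult indicator_def)
  qed auto
  moreover have "(\<lambda>k. \<integral>z. ?g k z \<partial>lborel) \<longlonglongrightarrow> (\<integral>z. complex_of_real (w (cmod z) * indicator {z. cmod l < cmod z} z) \<partial>lborel)"
  proof (rule integral_dominated_convergence[where w="\<lambda>z. norm (w (cmod z))"])
    show "AE z in lborel. (\<lambda>k. ?g k z) \<longlonglongrightarrow> complex_of_real (w (cmod z) * indicator {z. cmod l < cmod z} z)"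
      using AEA
    proof eventually_elim
      case (elim z)
      have "(\<lambda>k. ?g k z) \<longlonglongrightarrow> complex_of_real (w (cmod z) * 1 * indicator {z. cmod l < cmod z} z)"
        by (intro tendsto_intros elim)
      then show ?case by simp
    qed
    show "integrable lborel (\<lambda>z::complex. norm (w (cmod z)))"
      by (rule integrable_norm[OF int])
    show "AE z in lborel. cmod (?g k z) \<le> norm (w (cmod z))" for k
      by (rule AE_I2) (auto simp: norm_mult abs_mult indicator_def)
  qed auto
  moreover have "(\<integral>z. ?f k z \<partial>lborel) = (\<integral>z. ?g k z \<partial>lborel)" for k
    unfolding A_def by (rule newton_cut[OF assms(1) int]) auto
  ultimately have "(\<integral>z. complex_of_real (w (cmod z)) * (z / (z - l)) \<partial>lborel) = 
     (\<integral>z. complex_of_real (w (cmod z) * indicator {z. cmod l < cmod z} z) \<partial>lborel)"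
    using LIMSEQ_unique by auto
  also have "\<dots> = complex_of_real (\<integral>z. w (cmod z) * indicator {z. cmod l < cmod z} z \<partial>lborel)"
    by (rule integral_complex_of_real)
  finally show ?thesis .
qed

section \<open>Linear changes of variables in complex vectors\<close>

abbreviation CL :: "nat \<Rightarrow> (nat \<Rightarrow> complex) measure" where
  "CL m \<equiv> \<Pi>\<^sub>M i\<in>{..<m}. lborel"

interpretation CL: product_sigma_finite "\<lambda>_::nat. lborel :: complex measure"
  by standard

text \<open>
  The result is restricted to \<open>{..<m}\<close> since points of a product measure are functions that
  take the default value \<^const>\<open>undefined\<close> outside the index set.
\<close>

definition affine_map :: "nat \<Rightarrow> (nat \<Rightarrow> nat \<Rightarrow> complex) \<Rightarrow> (nat \<Rightarrow> complex) \<Rightarrow> (nat \<Rightarrow> complex) \<Rightarrow> nat \<Rightarrow> complex" where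
  "affine_map m x c b = (\<lambda>i\<in>{..<m}. (\<Sum>j<m. x i j * b j) + c i)"

lemma lambda_CL_measurable [measurable (raw)]:
  assumes "\<And>i. i < m \<Longrightarrow> (\<lambda>x. f x i) \<in> borel_measurable N"
  shows "(\<lambda>x. \<lambda>i\<in>{..<m}. f x i) \<in> N \<rightarrow>\<^sub>M CL m"
  using assms by (intro measurable_restrict) auto

lemma CL_component_measurable: "i < m \<Longrightarrow> (\<lambda>b. b i) \<in> borel_measurable (CL m)"
  using measurable_component_singleton[of i "{..<m}" "\<lambda>_. lborel :: complex measure"] by simp

lemma affine_map_measurable [measurable]: "affine_map m x c \<in> CL m \<rightarrow>\<^sub>M CL m"
  unfolding affine_map_def by measurable

lemma det_schur_complement:
  fixes x :: "nat \<Rightarrow> nat \<Rightarrow> 'a :: field"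
  assumes nz: "x m m \<noteq> 0"
  shows "det (mat (Suc m) (Suc m) (\<lambda>(i, j). x i j)) =
         x m m * det (mat m m (\<lambda>(i, j). x i j - x i m * x m j / x m m))"
proof -
  define Y where "Y = mat m m (\<lambda>(i, j). x i j - x i m * x m j / x m m)"
  define B where "B = mat m 1 (\<lambda>(i, j). x i m)"
  define C where "C = mat 1 m (\<lambda>(i, j). x m j / x m m)"
  define D where "D = mat 1 1 (\<lambda>_. x m m)"
  have c[simp]: "Y \<in> carrier_mat m m" "B \<in> carrier_mat m 1" "C \<in> carrier_mat 1 m" "D \<in> carrier_mat 1 1"
    by (auto simp: Y_def B_def C_def D_def)
  have "mat (Suc m) (Suc m) (\<lambda>(i, j). x i j) =
     four_block_mat (Y * 1\<^sub>m m + B * C) (Y * 0\<^sub>m m 1 + B * 1\<^sub>m 1) (0\<^sub>m 1 m * 1\<^sub>m m + D * C) (0\<^sub>m 1 m * 0\<^sub>m m 1 + D * 1\<^sub>m 1)"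
    using nz by (intro eq_matI) (auto simp: Y_def B_def C_def D_def scalar_prod_def less_Suc_eq)
  also have "\<dots> = four_block_mat Y B (0\<^sub>m 1 m) D * four_block_mat (1\<^sub>m m) (0\<^sub>m m 1) C (1\<^sub>m 1)"
    by (rule mult_four_block_mat[symmetric, where ?nr1.0=m and ?n1.0=m and ?nc1.0=m and ?nc2.0=1 and ?n2.0=1 and ?nr2.0=1]) (rule c | simp only: one_carrier_mat zero_carrier_mat)+
  also have "det \<dots> = det (four_block_mat Y B (0\<^sub>m 1 m) D) * det (four_block_mat (1\<^sub>m m) (0\<^sub>m m 1) C (1\<^sub>m 1))"
    by (rule det_mult[of _ "m + 1"]) (intro four_block_carrier_mat c one_carrier_mat)+
  also have "det (four_block_mat Y B (0\<^sub>m 1 m) D) = det Y * det D"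
    by (rule det_four_block_mat_lower_left_zero) (rule c refl)+
  also have "det (four_block_mat (1\<^sub>m m) (0\<^sub>m m 1) C (1\<^sub>m 1)) = 1"
    by (subst det_four_block_mat_upper_right_zero[OF one_carrier_mat refl c(3) one_carrier_mat]) simp
  also have "det D = x m m"
    by (subst det_single) (auto simp: D_def)
  finally show ?thesis by (simp add: Y_def)
qed

lemma CL_insert:
  assumes f: "f \<in> borel_measurable (CL (Suc m))"
  shows "(\<integral>\<^sup>+b. f b \<partial>CL (Suc m)) = (\<integral>\<^sup>+b. \<integral>\<^sup>+t. f (b(m := t)) \<partial>lborel \<partial>CL m)"
    "(\<integral>\<^sup>+b. f b \<partial>CL (Suc m)) = (\<integral>\<^sup>+t. \<integral>\<^sup>+b. f (b(m := t)) \<partial>CL m \<partial>lborel)"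
  using CL.product_nn_integral_insert[of "{..<m}" m f] CL.product_nn_integral_insert_rev[of "{..<m}" m f] f
  by (simp_all add: lessThan_Suc)

lemma fun_upd_CL_measurable [measurable (raw)]:
  assumes "g \<in> N \<rightarrow>\<^sub>M CL m" "h \<in> N \<rightarrow>\<^sub>M lborel"
  shows "(\<lambda>x. (g x)(m := h x)) \<in> N \<rightarrow>\<^sub>M CL (Suc m)"
  using measurable_fun_upd[of "{..<Suc m}" "{..<m}" m g N "\<lambda>_. lborel" h] assms by (auto simp: lessThan_Suc)

interpretation CL_sf: sigma_finite_measure "CL m" for m
  by (rule CL.sigma_finite) simp

text \<open>
  Induction on the dimension. If the last diagonal entry is nonzero, the last coordinate is
  substituted first and the remaining matrix is the Schur complement, whose determinant is that of
  the whole matrix divided by the pivot. If it vanishes, another entry of the last row does not;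
  adding its column to the last column amounts to precomposing with a shear of the coordinates,
  which preserves the integral by translation invariance.
\<close>

proposition nn_integral_affine_map:
  assumes "f \<in> borel_measurable (CL m)" and "det (mat m m (\<lambda>(i, j). x i j)) \<noteq> 0"
  shows "ennreal ((cmod (det (mat m m (\<lambda>(i, j). x i j))))\<^sup>2) * (\<integral>\<^sup>+b. f (affine_map m x c b) \<partial>CL m) = (\<integral>\<^sup>+b. f b \<partial>CL m)"
  using assms
proof (induction m arbitrary: f x c)
  case 0
  have "affine_map 0 x c b = b" if "b \<in> space (CL 0)" for b
    using that by (auto simp: affine_map_def space_PiM)
  then have "(\<integral>\<^sup>+b. f (affine_map 0 x c b) \<partial>CL 0) = (\<integral>\<^sup>+b. f b \<partial>CL 0)"
    by (intro nn_integral_cong) (simp only:)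
  then show ?case by simp
next
  case (Suc m)
  note [measurable] = Suc.prems(1)
  have pivot: "ennreal ((cmod (det (mat (Suc m) (Suc m) (\<lambda>(i, j). x i j))))\<^sup>2) * (\<integral>\<^sup>+b. f (affine_map (Suc m) x c b) \<partial>CL (Suc m)) = (\<integral>\<^sup>+b. f b \<partial>CL (Suc m))"
    if nz: "x m m \<noteq> 0" and det: "det (mat (Suc m) (Suc m) (\<lambda>(i, j). x i j)) \<noteq> 0" for x c
  proof -
    define y where "y i j = x i j - x i m * x m j / x m m" for i j
    define Dt where "Dt = ennreal ((cmod (det (mat m m (\<lambda>(i, j). y i j))))\<^sup>2)"
    have dety: "det (mat m m (\<lambda>(i, j). y i j)) \<noteq> 0"
      using det nz by (simp add: det_schur_complement y_def)
    \<comment> \<open>the integrand after the new last coordinate \<open>t\<close> has replaced the old one\<close>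
    let ?F = "\<lambda>b t. f ((affine_map m y (\<lambda>i. x i m * (t - c m) / x m m + c i) b)(m := t))"
    have Fm: "(\<lambda>(b, t). ?F b t) \<in> borel_measurable (CL m \<Otimes>\<^sub>M lborel)"
      unfolding affine_map_def by measurable
    have "(\<integral>\<^sup>+b. f (affine_map (Suc m) x c b) \<partial>CL (Suc m)) = (\<integral>\<^sup>+b. \<integral>\<^sup>+t. f (affine_map (Suc m) x c (b(m := t))) \<partial>lborel \<partial>CL m)"
      by (rule CL_insert) simp
    also have "\<dots> = (\<integral>\<^sup>+b. \<integral>\<^sup>+t. ?F b (((\<Sum>j<m. x m j * b j) + c m) + x m m * t) \<partial>lborel \<partial>CL m)"
    proof (intro nn_integral_cong arg_cong[where f=f] ext)
      fix b :: "nat \<Rightarrow> complex" and t i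
      have "(\<Sum>j<m. x i j * b j) = (\<Sum>j<m. y i j * b j) + x i m * (\<Sum>j<m. x m j * b j) / x m m"
        unfolding sum_distrib_left sum_divide_distrib sum.distrib[symmetric]
        by (intro sum.cong) (simp_all add: y_def algebra_simps)
      then show "affine_map (Suc m) x c (b(m := t)) i =
         ((affine_map m y (\<lambda>i. x i m * (((\<Sum>j<m. x m j * b j) + c m) + x m m * t - c m) / x m m + c i) b)
           (m := ((\<Sum>j<m. x m j * b j) + c m) + x m m * t)) i"
        using nz by (auto simp: affine_map_def less_Suc_eq field_simps)
    qed
    finally have 1: "(\<integral>\<^sup>+b. f (affine_map (Suc m) x c b) \<partial>CL (Suc m)) = 
       (\<integral>\<^sup>+b. \<integral>\<^sup>+t. ?F b (((\<Sum>j<m. x m j * b j) + c m) + x m m * t) \<partial>lborel \<partial>CL m)" .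
    have "ennreal ((cmod (x m m))\<^sup>2) * (\<integral>\<^sup>+b. f (affine_map (Suc m) x c b) \<partial>CL (Suc m)) = 
       (\<integral>\<^sup>+b. ennreal ((cmod (x m m))\<^sup>2) * (\<integral>\<^sup>+t. ?F b (((\<Sum>j<m. x m j * b j) + c m) + x m m * t) \<partial>lborel) \<partial>CL m)"
      unfolding 1 by (rule nn_integral_cmult[symmetric]) (unfold affine_map_def, measurable)
    also have "\<dots> = (\<integral>\<^sup>+b. (\<integral>\<^sup>+t. ?F b t \<partial>lborel) \<partial>CL m)"
    proof (intro nn_integral_cong nn_integral_complex_affine nz)
      fix b assume "b \<in> space (CL m)"
      with Fm show "?F b \<in> borel_measurable borel" 
        using measurable_Pair2[OF Fm, of b] by simp
    qed
    also have "\<dots> = (\<integral>\<^sup>+t. (\<integral>\<^sup>+b. ?F b t \<partial>CL m) \<partial>lborel)"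
      by (rule pair_sigma_finite.Fubini'[OF _ Fm, symmetric]) (simp add: pair_sigma_finite_def CL_sf.sigma_finite_measure_axioms lborel.sigma_finite_measure_axioms)
    finally have 2: "ennreal ((cmod (x m m))\<^sup>2) * (\<integral>\<^sup>+b. f (affine_map (Suc m) x c b) \<partial>CL (Suc m)) = 
       (\<integral>\<^sup>+t. (\<integral>\<^sup>+b. ?F b t \<partial>CL m) \<partial>lborel)" .
    have "Dt * (ennreal ((cmod (x m m))\<^sup>2) * (\<integral>\<^sup>+b. f (affine_map (Suc m) x c b) \<partial>CL (Suc m))) = 
       (\<integral>\<^sup>+t. Dt * (\<integral>\<^sup>+b. ?F b t \<partial>CL m) \<partial>lborel)"
      unfolding 2 by (rule nn_integral_cmult[symmetric]) (unfold affine_map_def, measurable)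
    also have "\<dots> = (\<integral>\<^sup>+t. (\<integral>\<^sup>+b. f (b(m := t)) \<partial>CL m) \<partial>lborel)"
      unfolding Dt_def
      by (intro nn_integral_cong Suc.IH[of "\<lambda>b. f (b(m := _))"] dety) measurable
    also have "\<dots> = (\<integral>\<^sup>+b. f b \<partial>CL (Suc m))"
      by (rule CL_insert[symmetric]) simp
    finally show ?thesis
      using nz by (simp add: det_schur_complement Dt_def y_def norm_mult power_mult_distrib ennreal_mult mult_ac)
  qed
  show ?case
  proof (cases "x m m = 0")
    case False
    then show ?thesis using pivot Suc.prems by blast
  next
    case True
    let ?A = "mat (Suc m) (Suc m) (\<lambda>(i, j). x i j)"
    have "\<exists>k<m. x m k \<noteq> 0"
    proof (rule ccontr)
      assume "\<not> ?thesis"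
      then have "det ?A = 0"
        using True by (subst laplace_expansion_row[of _ "Suc m" m]) (auto simp: less_Suc_eq)
      then show False using Suc.prems by simp
    qed
    then obtain k where k: "k < m" "x m k \<noteq> 0" by auto
    define x' where "x' i j = (if j = m then x i m + x i k else x i j)" for i j
    have "mat (Suc m) (Suc m) (\<lambda>(i, j). x' i j) = addcol 1 m k ?A"
      using k by (intro eq_matI) (auto simp: x'_def mat_addcol_def)
    then have det': "det (mat (Suc m) (Suc m) (\<lambda>(i, j). x' i j)) = det ?A"
      using k by (simp add: det_addcol[of k "Suc m" m])
    have nz': "x' m m \<noteq> 0"
      using k True by (simp add: x'_def)
    have shear: "(\<integral>\<^sup>+b. g (b(k := b k + b m)) \<partial>CL (Suc m)) = (\<integral>\<^sup>+b. g b \<partial>CL (Suc m))"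
      if [measurable]: "g \<in> borel_measurable (CL (Suc m))" for g
    proof -
      define d where "d t i = (if i = k then t else 0 :: complex)" for t and i :: nat
      have aff: "affine_map m (\<lambda>i j. if i = j then 1 else 0) (d t) b = (\<lambda>i\<in>{..<m}. b i + d t i)" for t b
        by (auto simp: affine_map_def fun_eq_iff sum.delta' if_distrib[of "\<lambda>a. a * _"] cong: if_cong)
      have id: "mat m m (\<lambda>(i, j). if i = j then 1 else 0 :: complex) = 1\<^sub>m m" by (intro eq_matI) auto
      have m1: "(\<lambda>b. g (b(k := b k + b m))) \<in> borel_measurable (CL (Suc m))"
      proof -
        have "(\<lambda>b. \<lambda>i\<in>{..<Suc m}. if i = k then b k + b m else b i) \<in> CL (Suc m) \<rightarrow>\<^sub>M CL (Suc m)"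
        proof (rule lambda_CL_measurable)
          fix i assume "i < Suc m"
          then show "(\<lambda>b. if i = k then b k + b m else b i) \<in> borel_measurable (CL (Suc m))"
            using k by (cases "i = k") (auto intro!: borel_measurable_add CL_component_measurable)
        qed
        then have "(\<lambda>b. g (\<lambda>i\<in>{..<Suc m}. if i = k then b k + b m else b i)) \<in> borel_measurable (CL (Suc m))"
          by measurable
        moreover have "(\<lambda>i\<in>{..<Suc m}. if i = k then b k + b m else b i) = b(k := b k + b m)"
          if "b \<in> space (CL (Suc m))" for b
          using that k by (auto simp: space_PiM fun_eq_iff PiE_def extensional_def)
        ultimately show ?thesis by (subst (asm) measurable_cong) auto
      qed
      have "(\<integral>\<^sup>+b. g (b(k := b k + b m)) \<partial>CL (Suc m)) =
        (\<integral>\<^sup>+t. \<integral>\<^sup>+b. g ((b(m := t))(k := (b(m := t)) k + (b(m := t)) m)) \<partial>CL m \<partial>lborel)"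
        by (rule CL_insert(2)[OF m1])
      also have "\<dots> = (\<integral>\<^sup>+t. \<integral>\<^sup>+b. g ((affine_map m (\<lambda>i j. if i = j then 1 else 0) (d t) b)(m := t)) \<partial>CL m \<partial>lborel)"
        unfolding aff using k
        by (intro nn_integral_cong arg_cong[where f=g])
           (auto simp: d_def space_PiM fun_eq_iff PiE_def extensional_def)
      also have "\<dots> = (\<integral>\<^sup>+t. \<integral>\<^sup>+b. g (b(m := t)) \<partial>CL m \<partial>lborel)"
        using Suc.IH[of "\<lambda>b. g (b(m := _))" "\<lambda>i j. if i = j then 1 else 0"] unfolding id by simp
      also have "\<dots> = (\<integral>\<^sup>+b. g b \<partial>CL (Suc m))"
        by (rule CL_insert(2)[symmetric]) simp
      finally show ?thesis .
    qed
    have "(\<integral>\<^sup>+b. f (affine_map (Suc m) x' c b) \<partial>CL (Suc m)) = (\<integral>\<^sup>+b. f (affine_map (Suc m) x c (b(k := b k + b m))) \<partial>CL (Suc m))"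
    proof (intro nn_integral_cong arg_cong[where f=f] ext)
      fix b :: "nat \<Rightarrow> complex" and i
      have "(\<Sum>j<m. x i j * (b(k := b k + b m)) j) = (\<Sum>j<m. x i j * b j + (if j = k then x i k * b m else 0))"
        by (intro sum.cong) (auto simp: algebra_simps)
      also have "\<dots> = (\<Sum>j<m. x i j * b j) + x i k * b m"
        using k by (simp add: sum.distrib)
      finally show "affine_map (Suc m) x' c b i = affine_map (Suc m) x c (b(k := b k + b m)) i"
        using k by (auto simp: affine_map_def x'_def algebra_simps)
    qed
    also have "\<dots> = (\<integral>\<^sup>+b. f (affine_map (Suc m) x c b) \<partial>CL (Suc m))"
      by (rule shear[of "\<lambda>b. f (affine_map (Suc m) x c b)"]) simp
    finally have same: "(\<integral>\<^sup>+b. f (affine_map (Suc m) x' c b) \<partial>CL (Suc m)) = (\<integral>\<^sup>+b. f (affine_map (Suc m) x c b) \<partial>CL (Suc m))" .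
    have "det (mat (Suc m) (Suc m) (\<lambda>(i, j). x' i j)) \<noteq> 0"
      unfolding det' by (rule Suc.prems(2))
    from pivot[OF nz' this, of c] show ?thesis
      unfolding det' same .
  qed
qed

section \<open>Integrability of the Cauchy kernel\<close>

lemma nn_integral_inverse_cmod_ball:
  "(\<integral>\<^sup>+z. ennreal (inverse (cmod (z - l))) * indicator (ball l 1) z \<partial>lborel) = ennreal (2 * pi)"
proof -
  have [measurable]: "ball l 1 \<in> sets borel" by simp
  let ?f = "\<lambda>t. ennreal (inverse (sqrt t)) * indicator {..<1} t"
  have "(\<integral>\<^sup>+z. ennreal (inverse (cmod (z - l))) * indicator (ball l 1) z \<partial>lborel) =
     (\<integral>\<^sup>+z. ennreal (inverse (cmod (l + z - l))) * indicator (ball l 1) (l + z) \<partial>lborel)"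
    by (rule nn_integral_complex_translate[symmetric]) measurable
  also have "\<dots> = (\<integral>\<^sup>+z. ?f ((cmod z)\<^sup>2) \<partial>lborel)"
    by (intro nn_integral_cong) (auto simp: indicator_def dist_norm abs_square_less_1)
  also have "\<dots> = ennreal pi * (\<integral>\<^sup>+t\<in>{0..}. ?f t \<partial>lborel)"
    by (rule nn_integral_complex_radial) simp
  also have "(\<integral>\<^sup>+t\<in>{0..}. ?f t \<partial>lborel) = (\<integral>\<^sup>+t. ennreal (t powr (-1/2)) * indicator {0..1} t \<partial>lborel)"
  proof (intro nn_integral_cong_AE)
    have "AE t::real in lborel. t \<noteq> 1" by (rule AE_lborel_singleton)
    then show "AE t in lborel. ?f t * indicator {0..} t = ennreal (t powr (-1/2)) * indicator {0..1} t"
      by eventually_elim (auto simp: indicator_def powr_minus powr_half_sqrt)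
  qed
  also have "\<dots> = ennreal 2"
    using has_integral_powr_from_0[of "-1/2" 1]
    by (intro nn_integral_has_integral_lebesgue') auto
  also have "ennreal pi * ennreal 2 = ennreal (2 * pi)" by (simp add: ennreal_mult mult.commute)
  finally show ?thesis .
qed

text \<open>
  Near the pole the weight is replaced by its bound, away from it the kernel by \<open>1\<close>. The
  estimate is uniform in the pole, which is what makes the later interchanges of integrals
  possible.
\<close>

lemma nn_integral_cauchy_kernel_le:
  fixes h :: "complex \<Rightarrow> real"
  assumes [measurable]: "h \<in> borel_measurable borel" and h: "\<And>z. 0 \<le> h z" "\<And>z. h z \<le> B"
  shows "(\<integral>\<^sup>+z. ennreal (h z * inverse (cmod (z - l))) \<partial>lborel) \<le> ennreal (2 * pi * B) + (\<integral>\<^sup>+z. ennreal (h z) \<partial>lborel)"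
proof -
  have [measurable]: "ball l 1 \<in> sets borel" by simp
  have B: "B \<ge> 0" using h[of 0] by linarith
  have "(\<integral>\<^sup>+z. ennreal (h z * inverse (cmod (z - l))) \<partial>lborel) \<le>
    (\<integral>\<^sup>+z. ennreal B * (ennreal (inverse (cmod (z - l))) * indicator (ball l 1) z) + ennreal (h z) \<partial>lborel)"
  proof (intro nn_integral_mono)
    fix z
    show "ennreal (h z * inverse (cmod (z - l))) \<le> ennreal B * (ennreal (inverse (cmod (z - l))) * indicator (ball l 1) z) + ennreal (h z)"
    proof (cases "z \<in> ball l 1")
      case True
      have "h z * inverse (cmod (z - l)) \<le> B * inverse (cmod (z - l))"
        using h by (intro mult_right_mono) auto
      then have "ennreal (h z * inverse (cmod (z - l))) \<le> ennreal B * ennreal (inverse (cmod (z - l)))"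
        using B by (subst ennreal_mult[symmetric]) (auto intro!: ennreal_leI)
      then show ?thesis using True by (simp add: add_increasing2)
    next
      case False
      then have "inverse (cmod (z - l)) \<le> 1" by (auto simp: dist_norm norm_minus_commute intro!: inverse_le_1_iff[THEN iffD2])
      then have "h z * inverse (cmod (z - l)) \<le> h z * 1" using h by (intro mult_left_mono) auto
      then show ?thesis using False by (simp add: ennreal_leI)
    qed
  qed
  also have "\<dots> = ennreal B * ennreal (2 * pi) + (\<integral>\<^sup>+z. ennreal (h z) \<partial>lborel)"
    by (subst nn_integral_add, measurable, subst nn_integral_cmult, measurable)
       (simp only: nn_integral_inverse_cmod_ball)
  also have "ennreal B * ennreal (2 * pi) = ennreal (2 * pi * B)"
    using B by (simp add: ennreal_mult[symmetric] mult_ac)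
  finally show ?thesis .
qed

lemma cauchy_kernel_eq: "z \<noteq> l \<Longrightarrow> z / (z - l) = 1 + l / (z - l :: complex)"
  by (simp add: divide_simps)

text \<open>
  Newton's theorem for a bounded integrable weight, where the singularity of the kernel is
  harmless.
\<close>

lemma newton_bounded:
  fixes w :: "real \<Rightarrow> real" and l :: complex
  assumes [measurable]: "w \<in> borel_measurable borel"
    and w: "\<And>r. 0 \<le> w r" "\<And>r. w r \<le> B"
    and int: "integrable lborel (\<lambda>z::complex. w (cmod z))"
  shows "integrable lborel (\<lambda>z. complex_of_real (w (cmod z)) * (z / (z - l)))" (is ?int)
    and "integrable lborel (\<lambda>z. complex_of_real (w (cmod z)) / (z - l))" (is ?int')
    and "(\<integral>z. complex_of_real (w (cmod z)) * (z / (z - l)) \<partial>lborel) =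
         complex_of_real (\<integral>z. w (cmod z) * indicator {z. cmod l < cmod z} z \<partial>lborel)" (is ?eq)
proof -
  have "(\<integral>\<^sup>+z. ennreal (w (cmod z) * inverse (cmod (z - l))) \<partial>lborel) \<le> ennreal (2 * pi * B) + (\<integral>\<^sup>+z. ennreal (w (cmod (z::complex))) \<partial>lborel)"
    using w by (intro nn_integral_cauchy_kernel_le) auto
  also have "\<dots> < \<infinity>"
    using int w by (simp add: integrable_iff_bounded)
  finally show i1: ?int'
    by (intro integrableI_bounded) (auto simp: norm_divide divide_inverse norm_mult norm_inverse w)
  have "integrable lborel (\<lambda>z. complex_of_real (w (cmod z)) + l * (complex_of_real (w (cmod z)) / (z - l)))"
    using int i1 by (intro Bochner_Integration.integrable_add integrable_mult_right) auto
  moreover have ae: "AE z in lborel. complex_of_real (w (cmod z)) * (z / (z - l)) = complex_of_real (w (cmod z)) + l * (complex_of_real (w (cmod z)) / (z - l))"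
    using AE_lborel_singleton[of l] by eventually_elim (simp add: cauchy_kernel_eq distrib_left mult.commute)
  ultimately show i2: ?int
    by (subst integrable_cong_AE[OF _ _ ae]) auto
  show ?eq
  proof (rule newton_radial[OF assms(1) int])
    show "integrable lborel (\<lambda>z. w (cmod z) * cmod (z / (z - l)))"
      using integrable_norm[OF i2] w by (simp add: norm_mult norm_divide)
  qed
qed

lemma integrable_cgauss_density: "integrable lborel (\<lambda>z::complex. 1 / pi * exp (- (cmod z)\<^sup>2))"
proof (rule integrableI_nonneg)
  have "(\<integral>\<^sup>+z. 1 \<partial>cgauss) = (\<integral>\<^sup>+z. ennreal (1 / pi * exp (- (cmod z)\<^sup>2)) \<partial>lborel)"
    by (subst nn_integral_cgauss) auto
  then show "(\<integral>\<^sup>+z. ennreal (1 / pi * exp (- (cmod z)\<^sup>2)) \<partial>lborel) < \<infinity>"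
    using cgauss.emeasure_space_1 by (simp)
qed auto

lemma integral_cgauss:
  fixes f :: "complex \<Rightarrow> complex"
  assumes [measurable]: "f \<in> borel_measurable borel"
  shows "(\<integral>z. f z \<partial>cgauss) = (\<integral>z. complex_of_real (1 / pi * exp (- (cmod z)\<^sup>2)) * f z \<partial>lborel)"
    "integrable cgauss f \<longleftrightarrow> integrable lborel (\<lambda>z. complex_of_real (1 / pi * exp (- (cmod z)\<^sup>2)) * f z)"
  unfolding cgauss_def
  by (subst integral_density; simp add: scaleR_conv_of_real) (subst integrable_density; simp add: scaleR_conv_of_real)

text \<open>
  By Newton's theorem the mean of \<open>w / (w - \<xi>)\<close> is the Gaussian mass of the disc of radius
  \<open>cmod w\<close>. Diagonal entries of the resolvent of a Gaussian matrix reduce to this integral.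
\<close>

lemma cgauss_cauchy:
  fixes w :: complex
  shows "integrable cgauss (\<lambda>\<xi>. w / (w - \<xi>))" (is ?int)
    and "(\<integral>\<xi>. w / (w - \<xi>) \<partial>cgauss) = of_real (1 - exp (- (cmod w)\<^sup>2))" (is ?eq)
    and "(\<integral>\<^sup>+\<xi>. cmod (w / (w - \<xi>)) \<partial>cgauss) \<le> ennreal (3 * cmod w)" (is ?le)
proof -
  define g where "g r = 1 / pi * exp (- r\<^sup>2)" for r :: real
  have gp: "0 \<le> g r" "g r \<le> 1 / pi" for r unfolding g_def by (auto simp: divide_simps)
  have [measurable]: "g \<in> borel_measurable borel" unfolding g_def by measurable
  have gint: "integrable lborel (\<lambda>z::complex. g (cmod z))" using integrable_cgauss_density by (simp add: g_def)
  note N = newton_bounded[of g "1/pi" w, OF _ gp gint]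
  have i1: "integrable cgauss (\<lambda>\<xi>. \<xi> / (\<xi> - w))"
    using N(1) by (subst integral_cgauss(2)) (auto simp: g_def)
  have gtot: "(\<integral>\<^sup>+z. ennreal (g (cmod (z::complex))) \<partial>lborel) = 1"
    using cgauss.emeasure_space_1 nn_integral_cgauss[of "\<lambda>_. 1"] by (simp add: g_def)
  have AEw: "AE \<xi> in cgauss. \<xi> \<noteq> w"
    unfolding cgauss_def by (subst AE_density) (use AE_lborel_singleton[of w] in auto)
  have ae: "AE \<xi> in cgauss. w / (w - \<xi>) = 1 - \<xi> / (\<xi> - w)"
    using AEw
  proof eventually_elim
    case (elim \<xi>)
    have "w / (w - \<xi>) = - (w / (\<xi> - w))" by (metis minus_diff_eq divide_minus_right)
    then show ?case using elim by (simp add: cauchy_kernel_eq)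
  qed
  have ip: "integrable cgauss (\<lambda>\<xi>. 1 - \<xi> / (\<xi> - w))"
    using i1 by (intro Bochner_Integration.integrable_diff) auto
  show ?int
    by (subst integrable_cong_AE[OF _ _ ae]) (use ip in auto)
  have tail: "(\<integral>z. g (cmod z) * indicator {z. cmod w < cmod z} z \<partial>lborel) = exp (- (cmod w)\<^sup>2)"
  proof -
    have "(\<integral>\<^sup>+z. ennreal (g (cmod z) * indicator {z. cmod w < cmod z} z) \<partial>lborel) = (\<integral>\<^sup>+z. ennreal (g (cmod z)) * indicator {z. cmod w \<le> cmod z} z \<partial>lborel)"
      using AE_cmod_neq[of "cmod w"]
      by (intro nn_integral_cong_AE) (auto elim!: eventually_mono simp: indicator_def)
    also have "\<dots> = emeasure cgauss {z. cmod w \<le> cmod z}"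
      unfolding cgauss_def g_def by (subst emeasure_density) auto
    also have "\<dots> = ennreal (exp (- (cmod w)\<^sup>2))"
      by (rule emeasure_cgauss_outside) simp
    finally show ?thesis
      using gp by (subst integral_eq_nn_integral) auto
  qed
  have "(\<integral>\<xi>. w / (w - \<xi>) \<partial>cgauss) = (\<integral>\<xi>. 1 - \<xi> / (\<xi> - w) \<partial>cgauss)"
    by (rule integral_cong_AE[OF _ _ ae]) auto
  also have "\<dots> = 1 - (\<integral>\<xi>. \<xi> / (\<xi> - w) \<partial>cgauss)"
    using i1 cgauss.prob_space by (subst Bochner_Integration.integral_diff) auto
  also have "(\<integral>\<xi>. \<xi> / (\<xi> - w) \<partial>cgauss) = of_real (exp (- (cmod w)\<^sup>2))"
    using N(3) unfolding tail by (subst integral_cgauss(1)) (simp_all only: g_def, auto)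
  finally show ?eq by simp
  have "(\<integral>\<^sup>+\<xi>. cmod (w / (w - \<xi>)) \<partial>cgauss) = (\<integral>\<^sup>+\<xi>. ennreal (g (cmod \<xi>)) * cmod (w / (w - \<xi>)) \<partial>lborel)"
    by (subst nn_integral_cgauss) (auto simp: g_def)
  also have "\<dots> = (\<integral>\<^sup>+\<xi>. ennreal (cmod w) * ennreal (g (cmod \<xi>) * inverse (cmod (\<xi> - w))) \<partial>lborel)"
    using gp by (intro nn_integral_cong) (simp add: ennreal_mult[symmetric] norm_divide divide_inverse norm_mult norm_inverse norm_minus_commute[of w] mult_ac)
  also have "\<dots> = ennreal (cmod w) * (\<integral>\<^sup>+\<xi>. ennreal (g (cmod \<xi>) * inverse (cmod (\<xi> - w))) \<partial>lborel)"
    by (rule nn_integral_cmult) auto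
  also have "\<dots> \<le> ennreal (cmod w) * (ennreal (2 * pi * (1 / pi)) + 1)"
    using gp by (intro mult_left_mono order_trans[OF nn_integral_cauchy_kernel_le]) (auto simp: gtot)
  also have "\<dots> = ennreal (3 * cmod w)"
  proof -
    have "ennreal (2 * pi * (1 / pi)) + 1 = (3 :: ennreal)" by simp
    then show ?thesis by (simp only:) (simp add: ennreal_mult mult.commute)
  qed
  finally show ?le .
qed

section \<open>Gaussian vectors and unitary maps\<close>

abbreviation gauss_vec :: "'i set \<Rightarrow> ('i \<Rightarrow> complex) measure" where
  "gauss_vec I \<equiv> \<Pi>\<^sub>M i\<in>I. cgauss"

lemma prob_space_gauss_vec: "prob_space (gauss_vec I)"
  by (intro prob_space_PiM prob_space_cgauss)

interpretation gauss_vec: product_prob_space "\<lambda>_. cgauss" UNIV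
  by standard

lemma lambda_gauss_measurable:
  assumes "\<And>i. i \<in> I \<Longrightarrow> (\<lambda>x. f x i) \<in> borel_measurable N"
  shows "(\<lambda>x. \<lambda>i\<in>I. f x i) \<in> N \<rightarrow>\<^sub>M gauss_vec I"
  using assms by (intro measurable_restrict) (auto simp: measurable_cong_sets[OF refl sets_cgauss])

lemma gauss_component_measurable: "i \<in> I \<Longrightarrow> (\<lambda>x. x i) \<in> borel_measurable (gauss_vec I)"
  using measurable_component_singleton[of i I "\<lambda>_. cgauss"] by (simp add: measurable_cong_sets[OF refl sets_cgauss])

lemma sets_gauss_vec_CL: "sets (gauss_vec {..<m}) = sets (CL m)"
  by (intro sets_PiM_cong) auto

definition sq_norm :: "nat \<Rightarrow> (nat \<Rightarrow> complex) \<Rightarrow> real" where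
  "sq_norm m b = (\<Sum>i<m. (cmod (b i))\<^sup>2)"

lemma sq_norm_nonneg [simp]: "0 \<le> sq_norm m b"
  by (simp add: sq_norm_def sum_nonneg)

lemma sq_norm_measurable [measurable]: "sq_norm m \<in> borel_measurable (CL m)"
  unfolding sq_norm_def[abs_def]
  by (rule borel_measurable_sum, rule borel_measurable_power, rule measurable_compose[OF _ borel_measurable_norm],
      rule CL_component_measurable) simp

lemma gauss_vec_density:
  "gauss_vec {..<m} = density (CL m) (\<lambda>b. ennreal ((1 / pi) ^ m * exp (- sq_norm m b)))"
proof (rule gauss_vec.PiM_eqI[symmetric])
  have eq: "ennreal ((1 / pi) ^ m * exp (- sq_norm m b)) = (\<Prod>i<m. ennreal (1 / pi * exp (- (cmod (b i))\<^sup>2)))" for b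
    unfolding sq_norm_def by (subst prod_ennreal) (auto simp: exp_sum sum_negf[symmetric] prod_dividef power_one_over)
  fix A :: "nat \<Rightarrow> complex set" assume A: "\<And>i. i \<in> {..<m} \<Longrightarrow> A i \<in> sets cgauss"
  then have [measurable]: "\<And>i. i < m \<Longrightarrow> A i \<in> sets borel" by auto
  have "Pi\<^sub>E {..<m} A \<in> sets (CL m)" using A by (intro sets_PiM_I_finite) auto
  then have "emeasure (density (CL m) (\<lambda>b. ennreal ((1 / pi) ^ m * exp (- sq_norm m b)))) (Pi\<^sub>E {..<m} A) =
    (\<integral>\<^sup>+b. ennreal ((1 / pi) ^ m * exp (- sq_norm m b)) * indicator (Pi\<^sub>E {..<m} A) b \<partial>CL m)"
    by (subst emeasure_density) auto
  also have "\<dots> = (\<integral>\<^sup>+b. (\<Prod>i<m. ennreal (1 / pi * exp (- (cmod (b i))\<^sup>2)) * indicator (A i) (b i)) \<partial>CL m)"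
    unfolding eq by (intro nn_integral_cong)
      (auto simp: prod.distrib indicator_def PiE_def Pi_def space_PiM extensional_def prod_zero_iff)
  also have "\<dots> = (\<Prod>i<m. \<integral>\<^sup>+b. ennreal (1 / pi * exp (- (cmod b)\<^sup>2)) * indicator (A i) b \<partial>lborel)"
    by (rule CL.product_nn_integral_prod) auto
  also have "\<dots> = (\<Prod>i<m. emeasure cgauss (A i))"
    unfolding cgauss_def by (intro prod.cong refl emeasure_density[symmetric]) auto
  finally show "emeasure (density (CL m) (\<lambda>b. ennreal ((1 / pi) ^ m * exp (- sq_norm m b)))) (Pi\<^sub>E {..<m} A) = (\<Prod>i\<in>{..<m}. emeasure cgauss (A i))" .
qed (auto simp: sets_gauss_vec_CL)

lemma nn_integral_gauss_vec:
  assumes [measurable]: "f \<in> borel_measurable (CL m)"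
  shows "(\<integral>\<^sup>+b. f b \<partial>gauss_vec {..<m}) = (\<integral>\<^sup>+b. ennreal ((1 / pi) ^ m * exp (- sq_norm m b)) * f b \<partial>CL m)"
  unfolding gauss_vec_density by (rule nn_integral_density) auto

text \<open>
  The rows of the leading \<open>m\<close> by \<open>m\<close> block are orthonormal. Matrices are index functions here so
  that they can serve directly as coefficients of \<^const>\<open>affine_map\<close>.
\<close>

definition is_unitary :: "nat \<Rightarrow> (nat \<Rightarrow> nat \<Rightarrow> complex) \<Rightarrow> bool" where
  "is_unitary m q \<longleftrightarrow> (\<forall>i<m. \<forall>j<m. (\<Sum>k<m. q i k * cnj (q j k)) = (if i = j then 1 else 0))"

lemma is_unitary_cnj: "is_unitary m q \<Longrightarrow> is_unitary m (\<lambda>i j. cnj (q i j))"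
  unfolding is_unitary_def
proof safe
  fix i j assume *: "\<forall>i<m. \<forall>j<m. (\<Sum>k<m. q i k * cnj (q j k)) = (if i = j then 1 else 0)" "i < m" "j < m"
  then have "(\<Sum>k<m. q j k * cnj (q i k)) = (if i = j then 1 else 0)" by auto
  then show "(\<Sum>k<m. cnj (q i k) * cnj (cnj (q j k))) = (if i = j then 1 else 0)"
    by (simp add: mult.commute)
qed

lemma unitary_mat_mult:
  assumes "is_unitary m q"
  shows "mat m m (\<lambda>(i, j). q i j) * mat m m (\<lambda>(i, j). cnj (q j i)) = 1\<^sub>m m"
    and "mat m m (\<lambda>(i, j). cnj (q j i)) * mat m m (\<lambda>(i, j). q i j) = 1\<^sub>m m"
proof -
  show *: "mat m m (\<lambda>(i, j). q i j) * mat m m (\<lambda>(i, j). cnj (q j i)) = 1\<^sub>m m"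
    using assms by (intro eq_matI) (auto simp: is_unitary_def scalar_prod_def atLeast0LessThan)
  show "mat m m (\<lambda>(i, j). cnj (q j i)) * mat m m (\<lambda>(i, j). q i j) = 1\<^sub>m m"
    by (rule mat_mult_left_right_inverse[OF _ _ *]) auto
qed

lemma unitary_columns:
  assumes "is_unitary m q" "i < m" "j < m"
  shows "(\<Sum>k<m. cnj (q k i) * q k j) = (if i = j then 1 else 0)"
proof -
  have "(mat m m (\<lambda>(i, j). cnj (q j i)) * mat m m (\<lambda>(i, j). q i j)) $$ (i, j) = (1\<^sub>m m :: complex mat) $$ (i, j)"
    by (simp only: unitary_mat_mult(2)[OF assms(1)])
  then show ?thesis using assms by (simp add: scalar_prod_def atLeast0LessThan)
qed

lemma unitary_det:
  assumes "is_unitary m q"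
  shows "cmod (det (mat m m (\<lambda>(i, j). q i j))) = 1"
proof -
  let ?Q = "mat m m (\<lambda>(i, j). q i j)" and ?R = "mat m m (\<lambda>(i, j). cnj (q j i))"
  have "det ?Q * det ?R = 1"
    using unitary_mat_mult(1)[OF assms] by (subst det_mult[symmetric, of _ m]) auto
  moreover have "det ?R = cnj (det ?Q)"
  proof -
    have "?R = (map_mat cnj ?Q)\<^sup>T" by (intro eq_matI) auto
    then have "det ?R = det (map_mat cnj ?Q)" by (simp add: det_transpose[of _ m])
    also have "\<dots> = cnj (det ?Q)"
      by (auto simp: det_def'[of _ m] sign_def intro!: sum.cong)
    finally show ?thesis .
  qed
  ultimately have "complex_of_real ((cmod (det ?Q))\<^sup>2) = 1"
    by (simp only: complex_norm_square)
  then show ?thesis by (metis of_real_eq_1_iff norm_ge_zero power2_eq_1_iff abs_of_nonneg abs_1 zero_le_one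
      less_eq_real_def not_one_le_zero power2_eq_imp_eq one_power2)
qed

lemma unitary_inverse:
  assumes "is_unitary m q" "\<And>i. i < m \<Longrightarrow> c i = (\<Sum>j<m. q i j * b j)" "j < m"
  shows "(\<Sum>i<m. cnj (q i j) * c i) = b j"
proof -
  have "(\<Sum>i<m. cnj (q i j) * c i) = (\<Sum>i<m. \<Sum>l<m. cnj (q i j) * q i l * b l)"
    using assms(2) by (simp add: sum_distrib_left mult_ac)
  also have "\<dots> = (\<Sum>l<m. (\<Sum>i<m. cnj (q i j) * q i l) * b l)"
    by (subst sum.swap) (simp add: sum_distrib_right)
  also have "\<dots> = (\<Sum>l<m. (if j = l then 1 else 0) * b l)"
    using assms by (intro sum.cong refl arg_cong2[where f="(*)"] unitary_columns) auto
  also have "\<dots> = b j" using assms(3) by (simp add: if_distrib[of "\<lambda>a. a * _"] cong: if_cong)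
  finally show ?thesis .
qed

lemma sq_norm_complex: "complex_of_real (sq_norm m b) = (\<Sum>i<m. cnj (b i) * b i)"
  unfolding sq_norm_def of_real_sum complex_norm_square by (simp add: mult.commute)

lemma unitary_sq_norm:
  assumes "is_unitary m q" "\<And>i. i < m \<Longrightarrow> c i = (\<Sum>j<m. q i j * b j)"
  shows "sq_norm m c = sq_norm m b"
proof -
  have "complex_of_real (sq_norm m c) = (\<Sum>i<m. cnj (c i) * c i)" by (rule sq_norm_complex)
  also have "\<dots> = (\<Sum>i<m. (\<Sum>j<m. cnj (b j) * (cnj (q i j) * c i)))"
  proof (intro sum.cong refl)
    fix i assume "i \<in> {..<m}"
    then have "cnj (c i) = (\<Sum>j<m. cnj (q i j) * cnj (b j))" using assms(2) by simp
    then have "cnj (c i) * c i = (\<Sum>j<m. cnj (q i j) * cnj (b j) * c i)"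
      by (simp only: sum_distrib_right)
    then show "cnj (c i) * c i = (\<Sum>j<m. cnj (b j) * (cnj (q i j) * c i))"
      by (simp only: mult_ac)
  qed
  also have "\<dots> = (\<Sum>j<m. cnj (b j) * (\<Sum>i<m. cnj (q i j) * c i))"
    by (subst sum.swap) (simp add: sum_distrib_left)
  also have "\<dots> = (\<Sum>j<m. cnj (b j) * b j)"
    using unitary_inverse[OF assms] by simp
  also have "\<dots> = complex_of_real (sq_norm m b)" by (rule sq_norm_complex[symmetric])
  finally show ?thesis by (simp only: of_real_eq_iff)
qed

text \<open>
  A unitary matrix that maps \<open>v\<close> to a multiple of the zeroth unit vector: the reflection along
  \<open>w = v + \<beta> e\<^sub>0\<close>, where \<open>\<beta>\<close> has the length of \<open>v\<close> and the phase of \<open>v 0\<close>, so that \<open>w\<close> cannot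
  vanish.
\<close>

lemma householder:
  fixes v :: "nat \<Rightarrow> complex"
  assumes m: "m > 0"
  obtains q where "is_unitary m q" "\<And>i. 0 < i \<Longrightarrow> i < m \<Longrightarrow> (\<Sum>j<m. q i j * v j) = 0"
proof (cases "sq_norm m v = 0")
  case True
  then have "v j = 0" if "j < m" for j
    using that unfolding sq_norm_def by (subst (asm) sum_nonneg_eq_0_iff) auto
  moreover have "is_unitary m (\<lambda>i j. if i = j then 1 else 0)"
    by (auto simp: is_unitary_def if_distrib[of "\<lambda>a. a * _"] cong: if_cong)
  ultimately show ?thesis using that by auto
next
  case False
  define s where "s = sqrt (sq_norm m v)"
  have s: "s > 0" "s\<^sup>2 = sq_norm m v"
    using False sq_norm_nonneg[of m v] by (auto simp: s_def less_le)
  \<comment> \<open>with this phase the two summands of \<open>w 0\<close> reinforce each other, so that \<open>N > 0\<close>\<close>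
  define ph where "ph = (if v 0 = 0 then 1 else sgn (v 0))"
  have ph: "cmod ph = 1" "cnj ph * v 0 = of_real (cmod (v 0))"
    by (auto simp: ph_def norm_sgn norm_divide sgn_eq complex_norm_square[symmetric] power2_eq_square mult.commute[of "cnj _"])
  define \<beta> where "\<beta> = of_real s * ph"
  define w where "w i = v i + (if i = 0 then \<beta> else 0)" for i
  define N where "N = 2 * (s\<^sup>2 + s * cmod (v 0))"
  have N: "N > 0" unfolding N_def using s(1) by (intro mult_pos_pos add_pos_nonneg) auto
  have split0: "(\<Sum>i<m. g i + (if i = 0 then h i else 0)) = (\<Sum>i<m. g i) + h 0" for g h :: "nat \<Rightarrow> complex"
    using m by (simp add: sum.distrib)
  have cb: "cnj \<beta> * v 0 = of_real (s * cmod (v 0))"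
    using ph(2) by (simp add: \<beta>_def mult.assoc)
  have cb': "\<beta> * cnj (v 0) = of_real (s * cmod (v 0))"
    using arg_cong[OF cb, of cnj] by (simp add: mult.commute)
  have bb: "cnj \<beta> * \<beta> = of_real (s\<^sup>2)"
    using ph(1) unfolding \<beta>_def
    by (simp add: power2_eq_square mult_ac) (metis complex_norm_square mult.left_commute mult.right_neutral of_real_1 one_power2)
  have wv: "(\<Sum>j<m. cnj (w j) * v j) = of_real (N / 2)"
  proof -
    have "(\<Sum>j<m. cnj (w j) * v j) = (\<Sum>j<m. cnj (v j) * v j + (if j = 0 then cnj \<beta> * v 0 else 0))"
      by (intro sum.cong) (auto simp: w_def algebra_simps)
    also have "\<dots> = of_real (s\<^sup>2) + of_real (s * cmod (v 0))"
      by (subst split0) (simp only: cb sq_norm_complex[symmetric] s(2))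
    finally show ?thesis by (simp add: N_def)
  qed
  have ww: "(\<Sum>j<m. cnj (w j) * w j) = of_real N"
  proof -
    have "(\<Sum>j<m. cnj (w j) * w j) = (\<Sum>j<m. cnj (w j) * v j + (if j = 0 then cnj (w 0) * \<beta> else 0))"
      by (intro sum.cong) (auto simp: w_def algebra_simps)
    also have "\<dots> = of_real (N / 2) + cnj (w 0) * \<beta>" by (subst split0) (simp only: wv)
    also have "cnj (w 0) * \<beta> = of_real (N / 2)"
      using cb' bb by (simp add: w_def N_def algebra_simps)
    finally show ?thesis by simp
  qed
  define q where "q i j = (if i = j then 1 else 0) - 2 * w i * cnj (w j) / of_real N" for i j
  show ?thesis
  proof (rule that[of q])
    have Nc: "complex_of_real N \<noteq> 0" using N by simp
    have "(\<Sum>k<m. q i k * cnj (q j k)) = (if i = j then 1 else 0)" if ij: "i < m" "j < m" for i j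
    proof -
      have "q i k * cnj (q j k) = (if k = i then (if i = j then 1 else 0) else 0) - (if k = i then 2 * cnj (w j) * w i / of_real N else 0)
         - (if k = j then 2 * w i * cnj (w j) / of_real N else 0) + 4 * w i * cnj (w j) / (of_real N * of_real N) * (cnj (w k) * w k)" for k
        using Nc by (auto simp: q_def algebra_simps)
      then have "(\<Sum>k<m. q i k * cnj (q j k)) = (if i = j then 1 else 0) - 2 * cnj (w j) * w i / of_real N - 2 * w i * cnj (w j) / of_real N
         + 4 * w i * cnj (w j) / (of_real N * of_real N) * (\<Sum>k<m. cnj (w k) * w k)"
        using ij by (simp add: sum.distrib sum_subtractf sum_distrib_left)
      also have "\<dots> = (if i = j then 1 else 0)"
        unfolding ww using Nc by (simp add: field_simps)
      finally show ?thesis .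
    qed
    then show "is_unitary m q" by (auto simp: is_unitary_def)
    fix i :: nat assume i: "0 < i" "i < m"
    have "(\<Sum>j<m. q i j * v j) = (\<Sum>j<m. (if j = i then v i else 0) - 2 * w i / of_real N * (cnj (w j) * v j))"
      by (intro sum.cong) (auto simp: q_def algebra_simps)
    also have "\<dots> = v i - 2 * w i / of_real N * (\<Sum>j<m. cnj (w j) * v j)"
      using i by (simp add: sum_subtractf sum_distrib_left)
    also have "\<dots> = 0" unfolding wv using Nc i by (simp add: w_def)
    finally show "(\<Sum>j<m. q i j * v j) = 0" .
  qed
qed

text \<open>
  The density depends on the vector only through its norm, and a unitary map has a
  determinant of modulus \<open>1\<close>.
\<close>

lemma gauss_vec_unitary:
  assumes q: "is_unitary m q"
  shows "distr (gauss_vec {..<m}) (gauss_vec {..<m}) (affine_map m q (\<lambda>_. 0)) = gauss_vec {..<m}"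
proof (rule measure_eqI)
  let ?T = "affine_map m q (\<lambda>_. 0)"
  have T: "?T \<in> gauss_vec {..<m} \<rightarrow>\<^sub>M gauss_vec {..<m}"
    using affine_map_measurable[of m q "\<lambda>_. 0"] by (simp only: measurable_cong_sets[OF sets_gauss_vec_CL sets_gauss_vec_CL])
  fix A assume "A \<in> sets (distr (gauss_vec {..<m}) (gauss_vec {..<m}) ?T)"
  then have A: "A \<in> sets (gauss_vec {..<m})" by simp
  then have [measurable]: "A \<in> sets (CL m)" by (simp only: sets_gauss_vec_CL)
  have norm: "sq_norm m (?T b) = sq_norm m b" for b
    by (rule unitary_sq_norm[OF q]) (simp add: affine_map_def)
  let ?g = "\<lambda>b. ennreal ((1 / pi) ^ m * exp (- sq_norm m b)) * indicator A b"
  have d: "cmod (det (mat m m (\<lambda>(i, j). q i j))) = 1" by (rule unitary_det[OF q])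
  then have d0: "det (mat m m (\<lambda>(i, j). q i j)) \<noteq> 0" by auto
  have "emeasure (distr (gauss_vec {..<m}) (gauss_vec {..<m}) ?T) A = (\<integral>\<^sup>+b. indicator A (?T b) \<partial>gauss_vec {..<m})"
    using A T by (subst nn_integral_indicator[symmetric], simp, subst nn_integral_distr) auto
  also have "\<dots> = (\<integral>\<^sup>+b. ?g (?T b) \<partial>CL m)"
    unfolding norm by (rule nn_integral_gauss_vec) measurable
  also have "\<dots> = (\<integral>\<^sup>+b. ?g b \<partial>CL m)"
    using nn_integral_affine_map[of ?g m q "\<lambda>_. 0", OF _ d0] unfolding d by simp
  also have "\<dots> = (\<integral>\<^sup>+b. indicator A b \<partial>gauss_vec {..<m})"
    by (rule nn_integral_gauss_vec[symmetric]) measurable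
  also have "\<dots> = emeasure (gauss_vec {..<m}) A" using A by simp
  finally show "emeasure (distr (gauss_vec {..<m}) (gauss_vec {..<m}) ?T) A = emeasure (gauss_vec {..<m}) A" .
qed simp

text \<open>
  A unitary map with zeroth row proportional to \<open>c\<close> exists, and it turns the linear form into a
  multiple of a single coordinate. So it is a centred complex Gaussian of variance \<open>sq_norm n c\<close>.
\<close>

lemma gauss_linear_form:
  assumes c: "sq_norm n c > 0"
  obtains \<kappa> where "(cmod \<kappa>)\<^sup>2 = sq_norm n c"
    "distr (gauss_vec {..<n}) borel (\<lambda>g. \<Sum>j<n. g j * c j) = distr cgauss borel (\<lambda>\<xi>. \<kappa> * \<xi>)"
proof -
  have n: "n > 0" using c by (cases n) (auto simp: sq_norm_def)
  obtain q where q: "is_unitary n q" and q0: "\<And>i. 0 < i \<Longrightarrow> i < n \<Longrightarrow> (\<Sum>j<n. q i j * cnj (c j)) = 0"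
    using householder[OF n, of "\<lambda>j. cnj (c j)"] by blast
  define k where "k = (\<Sum>j<n. q 0 j * cnj (c j))"
  define e where "e i = (if i = 0 then k else 0)" for i :: nat
  have e: "e i = (\<Sum>j<n. q i j * cnj (c j))" if "i < n" for i
    using q0[of i] that by (auto simp: e_def k_def)
  have "sq_norm n e = sq_norm n (\<lambda>j. cnj (c j))"
    by (rule unitary_sq_norm[OF q e])
  moreover have "sq_norm n e = (cmod k)\<^sup>2"
    using n by (simp add: sq_norm_def e_def if_distrib[of "\<lambda>a. (cmod a)\<^sup>2"] cong: if_cong)
  moreover have "sq_norm n (\<lambda>j. cnj (c j)) = sq_norm n c" by (simp add: sq_norm_def)
  ultimately have kn: "(cmod (cnj k))\<^sup>2 = sq_norm n c" by simp
  have cj: "c j = cnj k * q 0 j" if "j < n" for j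
  proof -
    have "(\<Sum>i<n. cnj (q i j) * e i) = cnj (c j)" by (rule unitary_inverse[OF q e that])
    moreover have "(\<Sum>i<n. cnj (q i j) * e i) = cnj (q 0 j) * k"
      using n by (simp add: e_def if_distrib[of "\<lambda>a. _ * a"] cong: if_cong)
    ultimately have "cnj (c j) = cnj (q 0 j) * k" by simp
    then have "cnj (cnj (c j)) = cnj (cnj (q 0 j) * k)" by (rule arg_cong)
    then show ?thesis by (simp add: mult.commute)
  qed
  let ?G = "gauss_vec {..<n}" and ?T = "affine_map n q (\<lambda>_. 0)"
  have T: "?T \<in> ?G \<rightarrow>\<^sub>M ?G"
    using affine_map_measurable[of n q "\<lambda>_. 0"] by (simp only: measurable_cong_sets[OF sets_gauss_vec_CL sets_gauss_vec_CL])
  have c0: "(\<lambda>g. g 0) \<in> ?G \<rightarrow>\<^sub>M cgauss" using n by (intro measurable_component_singleton) auto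
  have c0': "(\<lambda>g. cnj k * g 0) \<in> ?G \<rightarrow>\<^sub>M borel"
    using n by (intro borel_measurable_times borel_measurable_const gauss_component_measurable) auto
  have m2: "(\<lambda>\<xi>. cnj k * \<xi>) \<in> cgauss \<rightarrow>\<^sub>M borel" by measurable
  have "distr ?G borel (\<lambda>g. \<Sum>j<n. g j * c j) = distr ?G borel (\<lambda>g. cnj k * (?T g) 0)"
    using n by (intro distr_cong) (simp_all add: affine_map_def sum_distrib_left cj mult_ac)
  also have "\<dots> = distr (distr ?G ?G ?T) borel (\<lambda>g. cnj k * g 0)"
    by (subst distr_distr[OF c0' T]) (simp add: comp_def)
  also have "\<dots> = distr ?G borel (\<lambda>g. cnj k * g 0)"
    unfolding gauss_vec_unitary[OF q] ..
  also have "\<dots> = distr (distr ?G cgauss (\<lambda>g. g 0)) borel (\<lambda>\<xi>. cnj k * \<xi>)"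
    by (subst distr_distr[OF m2 c0]) (simp only: comp_def)
  also have "\<dots> = distr cgauss borel (\<lambda>\<xi>. cnj k * \<xi>)"
    using n by (subst distr_PiM_component) (auto intro: prob_space_cgauss)
  finally show ?thesis using that kn by blast
qed

text \<open>
  This will be applied with \<open>g\<close> the \<open>i\<close>-th row of a random matrix and \<open>c\<close> the cofactors along that
  row: \<open>F\<close> is then \<open>z\<close> times a diagonal entry of the resolvent, conditionally on the other rows.
  The last bound is uniform in \<open>c\<close> and yields integrability over those rows.
\<close>

lemma gauss_row_integral:
  fixes z :: complex and c :: "nat \<Rightarrow> complex" and i n :: nat
  assumes i: "i < n"
  defines "F \<equiv> \<lambda>g. z * c i / (z * c i - (\<Sum>j<n. g j * c j))"
  shows "integrable (gauss_vec {..<n}) F"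
    and "(\<integral>g. F g \<partial>gauss_vec {..<n}) = of_real (1 - exp (- ((cmod z)\<^sup>2 * (cmod (c i))\<^sup>2 / sq_norm n c)))"
    and "(\<integral>\<^sup>+g. cmod (F g) \<partial>gauss_vec {..<n}) \<le> ennreal (3 * cmod z)"
proof -
  have "integrable (gauss_vec {..<n}) F \<and>
    (\<integral>g. F g \<partial>gauss_vec {..<n}) = of_real (1 - exp (- ((cmod z)\<^sup>2 * (cmod (c i))\<^sup>2 / sq_norm n c))) \<and>
    (\<integral>\<^sup>+g. cmod (F g) \<partial>gauss_vec {..<n}) \<le> ennreal (3 * cmod z)"
  proof (cases "c i = 0")
    case True
    then have "F = (\<lambda>g. 0)" by (auto simp: F_def)
    then show ?thesis using True by simp
  next
    case False
    have le: "(cmod (c i))\<^sup>2 \<le> sq_norm n c"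
      unfolding sq_norm_def using i by (intro member_le_sum) auto
    have pos: "sq_norm n c > 0" using False by (intro less_le_trans[OF _ le]) simp
    obtain \<kappa> where k: "(cmod \<kappa>)\<^sup>2 = sq_norm n c"
      and law: "distr (gauss_vec {..<n}) borel (\<lambda>g. \<Sum>j<n. g j * c j) = distr cgauss borel (\<lambda>\<xi>. \<kappa> * \<xi>)"
      using gauss_linear_form[OF pos] by blast
    have k0: "\<kappa> \<noteq> 0" using k pos by auto
    define w where "w = z * c i / \<kappa>"
    have w2: "(cmod w)\<^sup>2 = (cmod z)\<^sup>2 * (cmod (c i))\<^sup>2 / sq_norm n c"
      by (simp add: w_def norm_mult norm_divide power_mult_distrib power_divide k)
    have "cmod (c i) \<le> cmod \<kappa>" using le k by (metis norm_ge_zero power2_le_imp_le)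
    then have wz: "cmod w \<le> cmod z"
      using k0 by (simp add: w_def norm_mult norm_divide divide_simps mult_left_mono)
    have H: "z * c i / (z * c i - \<kappa> * \<xi>) = w / (w - \<xi>)" for \<xi>
    proof -
      have "w / (w - \<xi>) = (\<kappa> * w) / (\<kappa> * (w - \<xi>))" using k0 by simp
      also have "\<kappa> * w = z * c i" using k0 by (simp add: w_def)
      then have "(\<kappa> * w) / (\<kappa> * (w - \<xi>)) = z * c i / (z * c i - \<kappa> * \<xi>)"
        by (simp add: right_diff_distrib)
      finally show ?thesis by simp
    qed
    let ?h = "\<lambda>s. z * c i / (z * c i - s)"
    have m1: "(\<lambda>g. \<Sum>j<n. g j * c j) \<in> borel_measurable (gauss_vec {..<n})"
      by (rule borel_measurable_sum, rule borel_measurable_times, rule gauss_component_measurable) auto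
    have m2: "(\<lambda>\<xi>. \<kappa> * \<xi>) \<in> borel_measurable cgauss" by simp
    have hm: "?h \<in> borel_measurable borel" by simp
    have "integrable (gauss_vec {..<n}) F \<longleftrightarrow> integrable (distr (gauss_vec {..<n}) borel (\<lambda>g. \<Sum>j<n. g j * c j)) ?h"
      unfolding F_def by (subst integrable_distr_eq[OF m1 hm]) simp
    also have "\<dots> \<longleftrightarrow> integrable cgauss (\<lambda>\<xi>. w / (w - \<xi>))"
      unfolding law by (subst integrable_distr_eq[OF m2 hm]) (simp add: H)
    finally have 1: "integrable (gauss_vec {..<n}) F" using cgauss_cauchy(1) by simp
    have "(\<integral>g. F g \<partial>gauss_vec {..<n}) = (\<integral>s. ?h s \<partial>distr (gauss_vec {..<n}) borel (\<lambda>g. \<Sum>j<n. g j * c j))"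
      unfolding F_def by (subst integral_distr[OF m1 hm]) simp
    also have "\<dots> = (\<integral>\<xi>. w / (w - \<xi>) \<partial>cgauss)"
      unfolding law by (subst integral_distr[OF m2 hm]) (simp add: H)
    finally have 2: "(\<integral>g. F g \<partial>gauss_vec {..<n}) = of_real (1 - exp (- (cmod w)\<^sup>2))"
      using cgauss_cauchy(2) by simp
    have hm': "(\<lambda>s. ennreal (cmod (?h s))) \<in> borel_measurable borel" by measurable
    have "(\<integral>\<^sup>+g. cmod (F g) \<partial>gauss_vec {..<n}) = (\<integral>\<^sup>+s. cmod (?h s) \<partial>distr (gauss_vec {..<n}) borel (\<lambda>g. \<Sum>j<n. g j * c j))"
      unfolding F_def by (subst nn_integral_distr[OF m1]) (use hm' in auto)
    also have "\<dots> = (\<integral>\<^sup>+\<xi>. cmod (w / (w - \<xi>)) \<partial>cgauss)"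
      unfolding law by (subst nn_integral_distr[OF m2]) (use hm' in \<open>auto simp: H\<close>)
    also have "\<dots> \<le> ennreal (3 * cmod w)" by (rule cgauss_cauchy(3))
    also have "\<dots> \<le> ennreal (3 * cmod z)" using wz by (intro ennreal_leI) auto
    finally show ?thesis using 1 2 w2 by simp
  qed
  then show "integrable (gauss_vec {..<n}) F"
    and "(\<integral>g. F g \<partial>gauss_vec {..<n}) = of_real (1 - exp (- ((cmod z)\<^sup>2 * (cmod (c i))\<^sup>2 / sq_norm n c)))"
    and "(\<integral>\<^sup>+g. cmod (F g) \<partial>gauss_vec {..<n}) \<le> ennreal (3 * cmod z)" by blast+
qed

section \<open>Gaussian matrices and unitary conjugation\<close>

abbreviation sqr :: "nat \<Rightarrow> (nat \<times> nat) set" where "sqr m \<equiv> {..<m} \<times> {..<m}"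

abbreviation gauss_mat :: "nat \<Rightarrow> (nat \<times> nat \<Rightarrow> complex) measure" where
  "gauss_mat m \<equiv> gauss_vec (sqr m)"

text \<open>
  A random matrix is a family indexed by pairs. Reading it as a family of rows allows the
  invariance of Gaussian vectors to be applied to all rows at once.
\<close>

definition rows_to_mat :: "nat \<Rightarrow> (nat \<Rightarrow> nat \<Rightarrow> complex) \<Rightarrow> nat \<times> nat \<Rightarrow> complex" where
  "rows_to_mat m f = (\<lambda>p\<in>sqr m. f (fst p) (snd p))"

lemma rows_to_mat_measurable: "rows_to_mat m \<in> (\<Pi>\<^sub>M i\<in>{..<m}. gauss_vec {..<m}) \<rightarrow>\<^sub>M gauss_mat m"
  unfolding rows_to_mat_def
proof (rule measurable_restrict)
  fix p assume "p \<in> sqr m"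
  then show "(\<lambda>f. f (fst p) (snd p)) \<in> (\<Pi>\<^sub>M i\<in>{..<m}. gauss_vec {..<m}) \<rightarrow>\<^sub>M cgauss"
    using measurable_compose[OF measurable_component_singleton[of "fst p" "{..<m}" "\<lambda>_. gauss_vec {..<m}"]
      measurable_component_singleton[of "snd p" "{..<m}" "\<lambda>_. cgauss"]] by auto
qed

lemma distr_rows_to_mat:
  "distr (\<Pi>\<^sub>M i\<in>{..<m}. gauss_vec {..<m}) (gauss_mat m) (rows_to_mat m) = gauss_mat m"
proof (rule gauss_vec.PiM_eqI)
  interpret nest: product_prob_space "\<lambda>_::nat. gauss_vec {..<m}" UNIV
    by (intro product_prob_spaceI prob_space_gauss_vec)
  fix A assume A: "\<And>p. p \<in> sqr m \<Longrightarrow> A p \<in> sets cgauss"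
  have AS: "Pi\<^sub>E (sqr m) A \<in> sets (gauss_mat m)" using A by (intro sets_PiM_I_finite) auto
  have row: "Pi\<^sub>E {..<m} (\<lambda>j. A (i, j)) \<in> sets (gauss_vec {..<m})" if "i < m" for i
    using A that by (intro sets_PiM_I_finite) auto
  have "rows_to_mat m -` Pi\<^sub>E (sqr m) A \<inter> space (\<Pi>\<^sub>M i\<in>{..<m}. gauss_vec {..<m}) =
    Pi\<^sub>E {..<m} (\<lambda>i. Pi\<^sub>E {..<m} (\<lambda>j. A (i, j)))"
    by (auto simp: rows_to_mat_def space_PiM PiE_def Pi_def extensional_def)
  then have "emeasure (distr (\<Pi>\<^sub>M i\<in>{..<m}. gauss_vec {..<m}) (gauss_mat m) (rows_to_mat m)) (Pi\<^sub>E (sqr m) A) =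
     emeasure (\<Pi>\<^sub>M i\<in>{..<m}. gauss_vec {..<m}) (Pi\<^sub>E {..<m} (\<lambda>i. Pi\<^sub>E {..<m} (\<lambda>j. A (i, j))))"
    by (subst emeasure_distr[OF rows_to_mat_measurable AS]) simp
  also have "\<dots> = (\<Prod>i<m. emeasure (gauss_vec {..<m}) (Pi\<^sub>E {..<m} (\<lambda>j. A (i, j))))"
    by (rule nest.emeasure_PiM) (auto intro: row)
  also have "\<dots> = (\<Prod>i<m. \<Prod>j<m. emeasure cgauss (A (i, j)))"
    using A by (intro prod.cong refl gauss_vec.emeasure_PiM) auto
  also have "\<dots> = (\<Prod>p\<in>sqr m. emeasure cgauss (A p))"
    by (simp add: prod.cartesian_product)
  finally show "emeasure (distr (\<Pi>\<^sub>M i\<in>{..<m}. gauss_vec {..<m}) (gauss_mat m) (rows_to_mat m)) (Pi\<^sub>E (sqr m) A) =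
     (\<Prod>p\<in>sqr m. emeasure cgauss (A p))" .
qed auto

text \<open>
  Multiplication by the transpose of \<open>q\<close> from the right, that is, application of \<open>q\<close> to each
  row.
\<close>

definition right_act :: "nat \<Rightarrow> (nat \<Rightarrow> nat \<Rightarrow> complex) \<Rightarrow> (nat \<times> nat \<Rightarrow> complex) \<Rightarrow> nat \<times> nat \<Rightarrow> complex" where
  "right_act m q D = (\<lambda>p\<in>sqr m. \<Sum>k<m. q (snd p) k * D (fst p, k))"

definition transp_act :: "nat \<Rightarrow> (nat \<times> nat \<Rightarrow> complex) \<Rightarrow> nat \<times> nat \<Rightarrow> complex" where
  "transp_act m D = (\<lambda>p\<in>sqr m. D (snd p, fst p))"

lemma right_act_measurable: "right_act m q \<in> gauss_mat m \<rightarrow>\<^sub>M gauss_mat m"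
  unfolding right_act_def
proof (rule lambda_gauss_measurable)
  fix p assume "p \<in> sqr m"
  then show "(\<lambda>D. \<Sum>k<m. q (snd p) k * D (fst p, k)) \<in> borel_measurable (gauss_mat m)"
    by (intro borel_measurable_sum borel_measurable_times borel_measurable_const gauss_component_measurable) auto
qed

lemma transp_act_measurable: "transp_act m \<in> gauss_mat m \<rightarrow>\<^sub>M gauss_mat m"
  unfolding transp_act_def by (rule lambda_gauss_measurable, rule gauss_component_measurable) auto

lemma distr_right_act:
  assumes q: "is_unitary m q"
  shows "distr (gauss_mat m) (gauss_mat m) (right_act m q) = gauss_mat m"
proof -
  let ?N = "\<Pi>\<^sub>M i\<in>{..<m}. gauss_vec {..<m}" and ?T = "affine_map m q (\<lambda>_. 0)"
  have T: "?T \<in> gauss_vec {..<m} \<rightarrow>\<^sub>M gauss_vec {..<m}"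
    using affine_map_measurable[of m q "\<lambda>_. 0"] by (simp only: measurable_cong_sets[OF sets_gauss_vec_CL sets_gauss_vec_CL])
  have cm: "compose {..<m} ?T \<in> ?N \<rightarrow>\<^sub>M ?N"
    unfolding compose_def
  proof (rule measurable_restrict)
    fix i assume "i \<in> {..<m}"
    then show "(\<lambda>x. ?T (x i)) \<in> ?N \<rightarrow>\<^sub>M gauss_vec {..<m}"
      using measurable_compose[OF measurable_component_singleton[of i "{..<m}" "\<lambda>_. gauss_vec {..<m}"] T] by simp
  qed
  have N: "distr ?N ?N (compose {..<m} ?T) = ?N"
    using T by (subst distr_PiM_finite_prob_space') (auto simp: gauss_vec_unitary[OF q] intro: prob_space_gauss_vec)
  have "distr (gauss_mat m) (gauss_mat m) (right_act m q) = distr (distr ?N (gauss_mat m) (rows_to_mat m)) (gauss_mat m) (right_act m q)"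
    unfolding distr_rows_to_mat ..
  also have "\<dots> = distr ?N (gauss_mat m) (right_act m q \<circ> rows_to_mat m)"
    by (rule distr_distr[OF right_act_measurable rows_to_mat_measurable])
  also have "\<dots> = distr ?N (gauss_mat m) (rows_to_mat m \<circ> compose {..<m} ?T)"
    by (intro distr_cong refl)
       (auto simp: right_act_def rows_to_mat_def compose_def affine_map_def fun_eq_iff intro!: sum.cong)
  also have "\<dots> = distr (distr ?N ?N (compose {..<m} ?T)) (gauss_mat m) (rows_to_mat m)"
    by (rule distr_distr[OF rows_to_mat_measurable cm, symmetric])
  also have "\<dots> = gauss_mat m"
    unfolding N by (rule distr_rows_to_mat)
  finally show ?thesis .
qed

lemma distr_transp_act: "distr (gauss_mat m) (gauss_mat m) (transp_act m) = gauss_mat m"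
  using distr_PiM_reindex[of "sqr m" "\<lambda>_. cgauss" "\<lambda>p. (snd p, fst p)" "sqr m"] prob_space_cgauss
  by (auto simp: transp_act_def[abs_def] inj_on_def Pi_def)

text \<open>
  This is \<open>q * D * q\<^sup>*\<close>, written as row operations and transpositions, each of which visibly
  preserves the law of the matrix.
\<close>

definition conj_act :: "nat \<Rightarrow> (nat \<Rightarrow> nat \<Rightarrow> complex) \<Rightarrow> (nat \<times> nat \<Rightarrow> complex) \<Rightarrow> nat \<times> nat \<Rightarrow> complex" where
  "conj_act m q = right_act m (\<lambda>i j. cnj (q i j)) \<circ> (transp_act m \<circ> (right_act m q \<circ> transp_act m))"

lemma conj_act_measurable: "conj_act m q \<in> gauss_mat m \<rightarrow>\<^sub>M gauss_mat m"
  unfolding conj_act_def by (intro measurable_comp[OF _ right_act_measurable] measurable_comp[OF _ transp_act_measurable] transp_act_measurable)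

lemma conj_act_apply:
  "i < m \<Longrightarrow> j < m \<Longrightarrow> conj_act m q D (i, j) = (\<Sum>l<m. (\<Sum>k<m. q i k * D (k, l)) * cnj (q j l))"
  by (simp add: conj_act_def right_act_def transp_act_def mult.commute)

lemma distr_conj_act:
  assumes q: "is_unitary m q"
  shows "distr (gauss_mat m) (gauss_mat m) (conj_act m q) = gauss_mat m"
proof -
  note m = right_act_measurable transp_act_measurable
  have "distr (gauss_mat m) (gauss_mat m) (conj_act m q) =
    distr (distr (distr (distr (gauss_mat m) (gauss_mat m) (transp_act m)) (gauss_mat m) (right_act m q)) (gauss_mat m) (transp_act m))
      (gauss_mat m) (right_act m (\<lambda>i j. cnj (q i j)))"
    unfolding conj_act_def by (simp add: distr_distr m measurable_comp[OF measurable_comp[OF transp_act_measurable right_act_measurable] transp_act_measurable]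
      measurable_comp[OF transp_act_measurable right_act_measurable] comp_assoc)
  also have "\<dots> = gauss_mat m"
    by (simp only: distr_transp_act distr_right_act[OF q] distr_right_act[OF is_unitary_cnj[OF q]])
  finally show ?thesis .
qed

section \<open>Second moments of determinants with independent entries\<close>

text \<open>
  A product along the graph of a permutation, extended by \<open>1\<close> to all entries. In this form the
  expectation factors over independent entries.
\<close>

lemma prod_permutation_entries:
  fixes g :: "nat \<Rightarrow> nat \<Rightarrow> 'a :: comm_monoid_mult"
  assumes "\<sigma> permutes {..<m}"
  shows "(\<Prod>i<m. g i (\<sigma> i)) = (\<Prod>p\<in>sqr m. if \<sigma> (fst p) = snd p then g (fst p) (snd p) else 1)"
proof -
  have "(\<Prod>p\<in>sqr m. if \<sigma> (fst p) = snd p then g (fst p) (snd p) else 1) = (\<Prod>i<m. \<Prod>j<m. if \<sigma> i = j then g i j else 1)"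
    unfolding prod.cartesian_product split_beta ..
  also have "\<dots> = (\<Prod>i<m. g i (\<sigma> i))"
    using permutes_in_image[OF assms] by (intro prod.cong refl) simp
  finally show ?thesis by simp
qed

text \<open>
  Expand both determinants by the Leibniz formula. Where two permutations differ, some
  off-diagonal entry occurs in one factor only, and its weighted mean vanishes; so only the diagonal
  of the double sum survives, and its signs cancel. The weights \<open>w\<close> leave the entries
  independent, though no longer identically distributed.
\<close>

proposition integral_det_squared:
  fixes w h :: "nat \<times> nat \<Rightarrow> complex \<Rightarrow> complex"
  assumes iw: "\<And>p. p \<in> sqr m \<Longrightarrow> integrable cgauss (w p)"
    and iwh: "\<And>p. p \<in> sqr m \<Longrightarrow> integrable cgauss (\<lambda>d. w p d * h p d)"
    and iwc: "\<And>p. p \<in> sqr m \<Longrightarrow> integrable cgauss (\<lambda>d. w p d * cnj (h p d))"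
    and iwhc: "\<And>p. p \<in> sqr m \<Longrightarrow> integrable cgauss (\<lambda>d. w p d * h p d * cnj (h p d))"
    and zero: "\<And>p. p \<in> sqr m \<Longrightarrow> fst p \<noteq> snd p \<Longrightarrow> (\<integral>d. w p d * h p d \<partial>cgauss) = 0"
      "\<And>p. p \<in> sqr m \<Longrightarrow> fst p \<noteq> snd p \<Longrightarrow> (\<integral>d. w p d * cnj (h p d) \<partial>cgauss) = 0"
  defines "F \<equiv> \<lambda>D. (\<Prod>p\<in>sqr m. w p (D p)) * (det (mat m m (\<lambda>p. h p (D p))) * cnj (det (mat m m (\<lambda>p. h p (D p)))))"
  shows "integrable (gauss_mat m) F"
    and "(\<integral>D. F D \<partial>gauss_mat m) = (\<Sum>\<sigma> | \<sigma> permutes {..<m}. \<Prod>p\<in>sqr m.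
           if \<sigma> (fst p) = snd p then (\<integral>d. w p d * h p d * cnj (h p d) \<partial>cgauss) else (\<integral>d. w p d \<partial>cgauss))"
proof -
  let ?P = "{\<sigma>. \<sigma> permutes {..<m}}"
  have fin: "finite ?P" by (rule finite_permutations) simp
  define \<phi> where "\<phi> \<sigma> \<tau> p d = w p d * (if \<sigma> (fst p) = snd p then h p d else 1) * (if \<tau> (fst p) = snd p then cnj (h p d) else 1)"
    for \<sigma> \<tau> :: "nat \<Rightarrow> nat" and p d
  have sgn2: "signof \<sigma> * cnj (signof \<sigma>) = (1 :: complex)" for \<sigma> :: "nat \<Rightarrow> nat"
    by (simp add: sign_def)
  have Feq: "F D = (\<Sum>\<sigma>\<in>?P. \<Sum>\<tau>\<in>?P. (signof \<sigma> * cnj (signof \<tau>)) * (\<Prod>p\<in>sqr m. \<phi> \<sigma> \<tau> p (D p)))" for D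
  proof -
    have d: "det (mat m m (\<lambda>p. h p (D p))) = (\<Sum>\<sigma>\<in>?P. signof \<sigma> * (\<Prod>i<m. h (i, \<sigma> i) (D (i, \<sigma> i))))"
      by (subst det_def'[of _ m]) (auto simp: atLeast0LessThan intro!: sum.cong prod.cong dest: permutes_in_image)
    have pr: "(\<Prod>p\<in>sqr m. w p (D p)) * ((\<Prod>i<m. h (i, \<sigma> i) (D (i, \<sigma> i))) * cnj (\<Prod>i<m. h (i, \<tau> i) (D (i, \<tau> i)))) =
       (\<Prod>p\<in>sqr m. \<phi> \<sigma> \<tau> p (D p))" if "\<sigma> \<in> ?P" "\<tau> \<in> ?P" for \<sigma> \<tau>
    proof -
      have 1: "(\<Prod>i<m. h (i, \<sigma> i) (D (i, \<sigma> i))) = (\<Prod>p\<in>sqr m. if \<sigma> (fst p) = snd p then h p (D p) else 1)"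
        using that prod_permutation_entries[of \<sigma> m "\<lambda>i j. h (i, j) (D (i, j))"] by (simp only: mem_Collect_eq prod.collapse)
      have 2: "cnj (\<Prod>i<m. h (i, \<tau> i) (D (i, \<tau> i))) = (\<Prod>p\<in>sqr m. if \<tau> (fst p) = snd p then cnj (h p (D p)) else 1)"
        using that prod_permutation_entries[of \<tau> m "\<lambda>i j. cnj (h (i, j) (D (i, j)))"] by (simp only: mem_Collect_eq prod.collapse cnj_prod)
      show ?thesis
        unfolding 1 2 prod.distrib[symmetric] by (intro prod.cong refl) (simp only: \<phi>_def mult.assoc)
    qed
    have "F D = (\<Sum>\<sigma>\<in>?P. \<Sum>\<tau>\<in>?P. (signof \<sigma> * cnj (signof \<tau>)) * ((\<Prod>p\<in>sqr m. w p (D p)) * ((\<Prod>i<m. h (i, \<sigma> i) (D (i, \<sigma> i))) * cnj (\<Prod>i<m. h (i, \<tau> i) (D (i, \<tau> i))))))"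
    proof -
      define a where "a \<sigma> = signof \<sigma> * (\<Prod>i<m. h (i, \<sigma> i) (D (i, \<sigma> i)))" for \<sigma>
      have "F D = (\<Prod>p\<in>sqr m. w p (D p)) * ((\<Sum>\<sigma>\<in>?P. a \<sigma>) * cnj (\<Sum>\<sigma>\<in>?P. a \<sigma>))"
        unfolding F_def d a_def ..
      also have "\<dots> = (\<Sum>\<sigma>\<in>?P. \<Sum>\<tau>\<in>?P. (\<Prod>p\<in>sqr m. w p (D p)) * (a \<sigma> * cnj (a \<tau>)))"
        unfolding cnj_sum sum_product unfolding sum_distrib_left ..
      finally show ?thesis unfolding a_def complex_cnj_mult by (simp only: mult_ac)
    qed
    also have "\<dots> = (\<Sum>\<sigma>\<in>?P. \<Sum>\<tau>\<in>?P. (signof \<sigma> * cnj (signof \<tau>)) * (\<Prod>p\<in>sqr m. \<phi> \<sigma> \<tau> p (D p)))"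
      by (intro sum.cong refl arg_cong2[where f="(*)"] pr)
    finally show ?thesis .
  qed
  have i\<phi>: "integrable cgauss (\<phi> \<sigma> \<tau> p)" if "p \<in> sqr m" for \<sigma> \<tau> p
    unfolding \<phi>_def[abs_def] using iw[OF that] iwh[OF that] iwc[OF that] iwhc[OF that]
    by (cases "\<sigma> (fst p) = snd p"; cases "\<tau> (fst p) = snd p") simp_all
  have iprod: "integrable (gauss_mat m) (\<lambda>D. \<Prod>p\<in>sqr m. \<phi> \<sigma> \<tau> p (D p))" for \<sigma> \<tau>
    by (rule gauss_vec.product_integrable_prod) (auto intro: i\<phi>)
  show "integrable (gauss_mat m) F"
    unfolding Feq by (intro Bochner_Integration.integrable_sum integrable_mult_right iprod)
  have val: "(\<integral>D. (\<Prod>p\<in>sqr m. \<phi> \<sigma> \<tau> p (D p)) \<partial>gauss_mat m) = (\<Prod>p\<in>sqr m. \<integral>d. \<phi> \<sigma> \<tau> p d \<partial>cgauss)" for \<sigma> \<tau>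
    by (rule gauss_vec.product_integral_prod) (auto intro: i\<phi>)
  have off: "(\<Prod>p\<in>sqr m. \<integral>d. \<phi> \<sigma> \<tau> p d \<partial>cgauss) = 0" if st: "\<sigma> \<in> ?P" "\<tau> \<in> ?P" "\<tau> \<noteq> \<sigma>" for \<sigma> \<tau>
  proof -
    obtain i where ne: "\<sigma> i \<noteq> \<tau> i" using st(3) by (metis ext)
    have im: "i < m"
    proof (rule ccontr)
      assume "\<not> i < m"
      then have "\<sigma> i = i" "\<tau> i = i" using st by (auto simp: permutes_def)
      then show False using ne by simp
    qed
    have "\<exists>p\<in>sqr m. (\<integral>d. \<phi> \<sigma> \<tau> p d \<partial>cgauss) = 0"
    proof (cases "\<sigma> i = i")
      case False
      have p: "(i, \<sigma> i) \<in> sqr m" using st im permutes_in_image[of \<sigma> "{..<m}" i] by auto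
      have "(\<integral>d. \<phi> \<sigma> \<tau> (i, \<sigma> i) d \<partial>cgauss) = 0"
        using zero(1)[OF p] False ne by (simp add: \<phi>_def)
      then show ?thesis using p by blast
    next
      case True
      have p: "(i, \<tau> i) \<in> sqr m" using st im permutes_in_image[of \<tau> "{..<m}" i] by auto
      have "(\<integral>d. \<phi> \<sigma> \<tau> (i, \<tau> i) d \<partial>cgauss) = 0"
        using zero(2)[OF p] True ne by (simp add: \<phi>_def)
      then show ?thesis using p by blast
    qed
    then show ?thesis by (intro prod_zero) auto
  qed
  have "(\<integral>D. F D \<partial>gauss_mat m) = (\<Sum>\<sigma>\<in>?P. \<Sum>\<tau>\<in>?P. (signof \<sigma> * cnj (signof \<tau>)) * (\<Prod>p\<in>sqr m. \<integral>d. \<phi> \<sigma> \<tau> p d \<partial>cgauss))"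
    unfolding Feq val[symmetric]
    by (subst Bochner_Integration.integral_sum, intro Bochner_Integration.integrable_sum integrable_mult_right iprod,
        intro sum.cong refl, subst Bochner_Integration.integral_sum, intro integrable_mult_right iprod,
        intro sum.cong refl integral_mult_right_zero)
  also have "\<dots> = (\<Sum>\<sigma>\<in>?P. (signof \<sigma> * cnj (signof \<sigma>)) * (\<Prod>p\<in>sqr m. \<integral>d. \<phi> \<sigma> \<sigma> p d \<partial>cgauss))"
  proof (rule sum.cong[OF refl])
    fix \<sigma> assume s: "\<sigma> \<in> ?P"
    show "(\<Sum>\<tau>\<in>?P. (signof \<sigma> * cnj (signof \<tau>)) * (\<Prod>p\<in>sqr m. \<integral>d. \<phi> \<sigma> \<tau> p d \<partial>cgauss)) =
       (signof \<sigma> * cnj (signof \<sigma>)) * (\<Prod>p\<in>sqr m. \<integral>d. \<phi> \<sigma> \<sigma> p d \<partial>cgauss)"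
    proof -
      have "(\<Sum>\<tau>\<in>?P - {\<sigma>}. (signof \<sigma> * cnj (signof \<tau>)) * (\<Prod>p\<in>sqr m. \<integral>d. \<phi> \<sigma> \<tau> p d \<partial>cgauss)) = 0"
      proof (rule sum.neutral, rule ballI)
        fix \<tau> assume "\<tau> \<in> ?P - {\<sigma>}"
        then have "(\<Prod>p\<in>sqr m. \<integral>d. \<phi> \<sigma> \<tau> p d \<partial>cgauss) = 0" by (intro off[OF s]) blast+
        then show "(signof \<sigma> * cnj (signof \<tau>)) * (\<Prod>p\<in>sqr m. \<integral>d. \<phi> \<sigma> \<tau> p d \<partial>cgauss) = 0"
          by (simp only: mult_zero_right)
      qed
      then show ?thesis by (subst sum.remove[OF fin s]) (simp only: add_0_right)
    qed
  qed
  also have "\<dots> = (\<Sum>\<sigma>\<in>?P. \<Prod>p\<in>sqr m.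
           if \<sigma> (fst p) = snd p then (\<integral>d. w p d * h p d * cnj (h p d) \<partial>cgauss) else (\<integral>d. w p d \<partial>cgauss))"
    unfolding sgn2 by (intro sum.cong refl) (simp add: \<phi>_def, intro prod.cong, auto)
  finally show "(\<integral>D. F D \<partial>gauss_mat m) = \<dots>" .
qed

section \<open>Gaussian weights centred elsewhere\<close>

text \<open>
  Completing the square: the product of the Gaussian density and the weight
  \<open>exp (- s * (cmod (z - d))\<^sup>2)\<close> is a multiple of a Gaussian density with mean \<open>s / (1 + s) * z\<close> and
  variance \<open>1 / (1 + s)\<close>. Stating this as an equality of measures transfers all moments at once.
\<close>

lemma cgauss_tilt:
  fixes s :: real and z :: complex
  assumes s: "s \<ge> 0"
  defines "T \<equiv> \<lambda>x. of_real (s / (1 + s)) * z + of_real (1 / sqrt (1 + s)) * x"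
  defines "C \<equiv> 1 / (1 + s) * exp (- (s * (cmod z)\<^sup>2 / (1 + s)))"
  shows "density cgauss (\<lambda>d. ennreal (exp (- s * (cmod (z - d))\<^sup>2))) = density (distr cgauss borel T) (\<lambda>_. ennreal C)"
proof (rule measure_eqI)
  have [measurable]: "T \<in> borel_measurable borel" unfolding T_def by measurable
  have C: "C \<ge> 0" using s by (simp add: C_def)
  fix A assume "A \<in> sets (density cgauss (\<lambda>d. ennreal (exp (- s * (cmod (z - d))\<^sup>2))))"
  then have [measurable]: "A \<in> sets borel" by simp
  let ?f = "\<lambda>d. ennreal (1 / pi * exp (- (cmod d)\<^sup>2)) * (ennreal (exp (- s * (cmod (z - d))\<^sup>2)) * indicator A d)"
  have key: "(cmod (T x))\<^sup>2 + s * (cmod (z - T x))\<^sup>2 = s * (cmod z)\<^sup>2 / (1 + s) + (cmod x)\<^sup>2" for x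
  proof -
    have zT: "z - T x = of_real (1 / (1 + s)) * z - of_real (1 / sqrt (1 + s)) * x"
    proof -
      define a b where "a = of_real (s / (1 + s)) * z" and "b = of_real (1 / (1 + s)) * z"
      have "s / (1 + s) + 1 / (1 + s) = 1" using s by (simp add: field_simps)
      then have "z = of_real (s / (1 + s) + 1 / (1 + s)) * z" by simp
      then have "z = a + b"
        unfolding of_real_add distrib_right a_def b_def .
      then have "z - (a + c) = b - c" for c by simp
      then show ?thesis unfolding T_def a_def b_def .
    qed
    define \<alpha> \<rho> where "\<alpha> = 1 / (1 + s)" and "\<rho> = 1 / sqrt (1 + s)"
    have \<alpha>: "(1 + s) * \<alpha> = 1" "s / (1 + s) = s * \<alpha>" using s by (simp_all add: \<alpha>_def)
    have \<rho>: "\<rho>\<^sup>2 = \<alpha>" using s by (simp add: \<alpha>_def \<rho>_def power_divide)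
    note sel = minus_complex.sel plus_complex.sel times_complex.sel Re_complex_of_real Im_complex_of_real
      mult_zero_left diff_0_right add_0_right
    have *: "Re (z - T x) = \<alpha> * Re z - \<rho> * Re x" "Im (z - T x) = \<alpha> * Im z - \<rho> * Im x"
      "Re (T x) = s * \<alpha> * Re z + \<rho> * Re x" "Im (T x) = s * \<alpha> * Im z + \<rho> * Im x"
      unfolding zT unfolding T_def \<alpha>(2) \<alpha>_def[symmetric] \<rho>_def[symmetric] by (simp_all only: sel)
    have gen: "(s * \<alpha> * a + \<rho> * b)\<^sup>2 + s * (\<alpha> * a - \<rho> * b)\<^sup>2 = s * \<alpha> * a\<^sup>2 + b\<^sup>2" for a b
    proof -
      have "(s * \<alpha> * a + \<rho> * b)\<^sup>2 + s * (\<alpha> * a - \<rho> * b)\<^sup>2 = s * \<alpha> * ((1 + s) * \<alpha>) * a\<^sup>2 + (1 + s) * \<rho>\<^sup>2 * b\<^sup>2"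
        by (simp add: power2_eq_square algebra_simps)
      then show ?thesis unfolding \<rho> \<alpha>(1) by simp
    qed
    have "s * (cmod z)\<^sup>2 / (1 + s) = s * \<alpha> * (Re z)\<^sup>2 + s * \<alpha> * (Im z)\<^sup>2"
      using \<alpha>(2) by (simp add: cmod_power2 distrib_left add_divide_distrib) (simp add: \<alpha>_def)
    then show ?thesis
      unfolding cmod_power2[of "T x"] cmod_power2[of "z - T x"] cmod_power2[of x] *
      using gen[of "Re z" "Re x"] gen[of "Im z" "Im x"] by (simp add: distrib_left)
  qed
  have "emeasure (density cgauss (\<lambda>d. ennreal (exp (- s * (cmod (z - d))\<^sup>2)))) A = (\<integral>\<^sup>+d. ?f d \<partial>lborel)"
    by (subst emeasure_density) (auto simp: nn_integral_cgauss)
  also have "\<dots> = ennreal ((cmod (of_real (1 / sqrt (1 + s)) :: complex))\<^sup>2) * (\<integral>\<^sup>+x. ?f (T x) \<partial>lborel)"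
    unfolding T_def using s by (intro nn_integral_complex_affine[symmetric]) auto
  also have "(cmod (of_real (1 / sqrt (1 + s)) :: complex))\<^sup>2 = 1 / (1 + s)"
    using s by (simp add: norm_divide power_divide)
  also have "(\<integral>\<^sup>+x. ?f (T x) \<partial>lborel) =
    (\<integral>\<^sup>+x. ennreal (exp (- (s * (cmod z)\<^sup>2 / (1 + s)))) * (ennreal (1 / pi * exp (- (cmod x)\<^sup>2)) * indicator A (T x)) \<partial>lborel)"
  proof (intro nn_integral_cong)
    fix x
    have "exp (- (cmod (T x))\<^sup>2) * exp (- s * (cmod (z - T x))\<^sup>2) = exp (- (s * (cmod z)\<^sup>2 / (1 + s))) * exp (- (cmod x)\<^sup>2)"
      unfolding exp_add[symmetric] using key[of x] by simp
    then have "1 / pi * exp (- (cmod (T x))\<^sup>2) * exp (- s * (cmod (z - T x))\<^sup>2) = exp (- (s * (cmod z)\<^sup>2 / (1 + s))) * (1 / pi * exp (- (cmod x)\<^sup>2))"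
      by simp
    then show "?f (T x) = ennreal (exp (- (s * (cmod z)\<^sup>2 / (1 + s)))) * (ennreal (1 / pi * exp (- (cmod x)\<^sup>2)) * indicator A (T x))"
      by (simp only: mult.assoc[symmetric] ennreal_mult[symmetric] zero_le_mult_iff exp_ge_zero divide_nonneg_nonneg zero_le_one pi_ge_zero simp_thms)
  qed
  also have "\<dots> = ennreal (exp (- (s * (cmod z)\<^sup>2 / (1 + s)))) * (\<integral>\<^sup>+x. indicator A (T x) \<partial>cgauss)"
    by (subst nn_integral_cmult) (auto simp: nn_integral_cgauss)
  also have "ennreal (1 / (1 + s)) * (ennreal (exp (- (s * (cmod z)\<^sup>2 / (1 + s)))) * X) = ennreal C * X" for X
    using s by (simp add: C_def mult.assoc[symmetric] ennreal_mult[symmetric])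
  also have "ennreal C * (\<integral>\<^sup>+x. indicator A (T x) \<partial>cgauss) = (\<integral>\<^sup>+x. ennreal C * indicator A x \<partial>distr cgauss borel T)"
    by (subst nn_integral_distr) (auto simp: nn_integral_cmult)
  also have "\<dots> = emeasure (density (distr cgauss borel T) (\<lambda>_. ennreal C)) A"
    by (subst emeasure_density) auto
  finally show "emeasure (density cgauss (\<lambda>d. ennreal (exp (- s * (cmod (z - d))\<^sup>2)))) A = emeasure (density (distr cgauss borel T) (\<lambda>_. ennreal C)) A" .
qed simp

lemma borel_measurable_cnj [measurable]: "cnj \<in> borel_measurable borel"
  by (intro borel_measurable_continuous_onI continuous_intros)

lemma cgauss_moments:
  shows "integrable cgauss (\<lambda>x. x)" "(\<integral>x. x \<partial>cgauss) = 0"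
    and "integrable cgauss (\<lambda>x. cnj x)" "(\<integral>x. cnj x \<partial>cgauss) = 0"
    and "integrable cgauss (\<lambda>x. x * cnj x)" "(\<integral>x. x * cnj x \<partial>cgauss) = 1"
proof -
  have sq: "(\<integral>\<^sup>+x. ennreal ((cmod x)\<^sup>2) \<partial>cgauss) = 1"
  proof -
    have "(\<integral>\<^sup>+x. ennreal ((cmod x)\<^sup>2) \<partial>cgauss) = (\<integral>\<^sup>+x. (\<lambda>t. ennreal (1 / pi * exp (- t)) * ennreal t) ((cmod x)\<^sup>2) \<partial>lborel)"
      by (subst nn_integral_cgauss) auto
    also have "\<dots> = ennreal pi * (\<integral>\<^sup>+t\<in>{0..}. ennreal (1 / pi * exp (- t)) * ennreal t \<partial>lborel)"
      by (rule nn_integral_complex_radial) simp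
    also have "\<dots> = (\<integral>\<^sup>+t. ennreal pi * (ennreal (1 / pi * exp (- t)) * ennreal t * indicator {0..} t) \<partial>lborel)"
      by (rule nn_integral_cmult[symmetric]) simp
    also have "\<dots> = (\<integral>\<^sup>+t. ennreal (t * exp (- t)) * indicator {0..} t \<partial>lborel)"
      by (intro nn_integral_cong) (auto simp: ennreal_mult[symmetric] indicator_def mult_ac)
    also have "\<dots> = ennreal (0 - (- (0 + 1) * exp (- 0)))"
    proof (rule nn_integral_FTC_atLeast[where F="\<lambda>t. - (t + 1) * exp (- t)"])
      show "((\<lambda>t::real. - (t + 1) * exp (- t)) \<longlongrightarrow> 0) at_top" by real_asymp
      show "((\<lambda>t. - (t + 1) * exp (- t)) has_real_derivative x * exp (- x)) (at x)" for x :: real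
        by (auto intro!: derivative_eq_intros simp: algebra_simps)
    qed auto
    finally show ?thesis by simp
  qed
  show i2: "integrable cgauss (\<lambda>x. x * cnj x)"
    by (rule integrableI_bounded) (auto simp: norm_mult power2_eq_square[symmetric] sq)
  have "(\<integral>x. x * cnj x \<partial>cgauss) = (\<integral>x. complex_of_real ((cmod x)\<^sup>2) \<partial>cgauss)"
    by (simp only: complex_norm_square)
  also have "\<dots> = complex_of_real (\<integral>x. (cmod x)\<^sup>2 \<partial>cgauss)"
    by (rule integral_complex_of_real)
  also have "(\<integral>x. (cmod x)\<^sup>2 \<partial>cgauss) = 1"
    by (subst integral_eq_nn_integral) (auto simp: sq)
  finally show "(\<integral>x. x * cnj x \<partial>cgauss) = 1" by simp
  have bd: "cmod x \<le> 1 + (cmod x)\<^sup>2" for x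
    using zero_le_power2[of "cmod x - 1 / 2"] by (simp add: power2_eq_square algebra_simps)
  show i1: "integrable cgauss (\<lambda>x. x)"
  proof (rule Bochner_Integration.integrable_bound)
    show "integrable cgauss (\<lambda>x. 1 + x * cnj x)" using i2 by auto
    have "cmod x \<le> cmod (1 + x * cnj x)" for x
    proof -
      have "1 + x * cnj x = complex_of_real (1 + (cmod x)\<^sup>2)" by (simp add: complex_norm_square[symmetric])
      then have "cmod (1 + x * cnj x) = 1 + (cmod x)\<^sup>2" by (simp only: norm_of_real) simp
      then show ?thesis using bd by simp
    qed
    then show "AE x in cgauss. cmod x \<le> cmod (1 + x * cnj x)" by simp
  qed simp
  show i0: "(\<integral>x. x \<partial>cgauss) = 0"
    by (subst integral_cgauss(1), simp, rule integral_rotation_antisymmetric[where a="-1"]) auto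
  show "integrable cgauss (\<lambda>x. cnj x)"
    using i1 by (rule Bochner_Integration.integrable_bound) auto
  show "(\<integral>x. cnj x \<partial>cgauss) = 0" 
    by (subst integral_cgauss(1), simp, rule integral_rotation_antisymmetric[where a="-1"]) auto
qed

lemma cgauss_tilt_integral:
  fixes s :: real and z :: complex and f :: "complex \<Rightarrow> complex"
  assumes s: "s \<ge> 0" and f[measurable]: "f \<in> borel_measurable borel"
  defines "T \<equiv> \<lambda>x. of_real (s / (1 + s)) * z + of_real (1 / sqrt (1 + s)) * x"
  defines "C \<equiv> 1 / (1 + s) * exp (- (s * (cmod z)\<^sup>2 / (1 + s)))"
  assumes i: "integrable cgauss (\<lambda>x. f (T x))"
  shows "integrable cgauss (\<lambda>d. of_real (exp (- s * (cmod (z - d))\<^sup>2)) * f d)"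
    and "(\<integral>d. of_real (exp (- s * (cmod (z - d))\<^sup>2)) * f d \<partial>cgauss) = of_real C * (\<integral>x. f (T x) \<partial>cgauss)"
proof -
  have [measurable]: "T \<in> borel_measurable borel" unfolding T_def by measurable
  have C: "C \<ge> 0" using s by (simp add: C_def)
  let ?D = "density cgauss (\<lambda>d. ennreal (exp (- s * (cmod (z - d))\<^sup>2)))"
  have D: "?D = density (distr cgauss borel T) (\<lambda>_. ennreal C)"
    unfolding T_def C_def by (rule cgauss_tilt[OF s])
  have fT: "integrable (distr cgauss borel T) f"
    using i by (subst integrable_distr_eq) auto
  have "integrable ?D f"
    unfolding D using fT C by (subst integrable_density) (auto intro!: AE_I2)
  then show "integrable cgauss (\<lambda>d. of_real (exp (- s * (cmod (z - d))\<^sup>2)) * f d)"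
    by (subst (asm) integrable_density) (auto simp: scaleR_conv_of_real)
  have "(\<integral>d. of_real (exp (- s * (cmod (z - d))\<^sup>2)) * f d \<partial>cgauss) = (\<integral>d. f d \<partial>?D)"
    by (subst integral_density) (auto simp: scaleR_conv_of_real)
  also have "\<dots> = of_real C * (\<integral>x. f x \<partial>distr cgauss borel T)"
    unfolding D using C by (subst integral_density) (auto simp: scaleR_conv_of_real)
  also have "(\<integral>x. f x \<partial>distr cgauss borel T) = (\<integral>x. f (T x) \<partial>cgauss)"
    by (subst integral_distr) auto
  finally show "(\<integral>d. of_real (exp (- s * (cmod (z - d))\<^sup>2)) * f d \<partial>cgauss) = of_real C * (\<integral>x. f (T x) \<partial>cgauss)" .
qed

lemma cgauss_tilt_moments:
  fixes s :: real and z :: complex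
  assumes s: "s \<ge> 0"
  defines "w \<equiv> \<lambda>d. complex_of_real (exp (- s * (cmod (z - d))\<^sup>2))"
  defines "C \<equiv> 1 / (1 + s) * exp (- (s * (cmod z)\<^sup>2 / (1 + s)))"
  shows "integrable cgauss w" "(\<integral>d. w d \<partial>cgauss) = of_real C"
    and "integrable cgauss (\<lambda>d. w d * (z - d))" "(\<integral>d. w d * (z - d) \<partial>cgauss) = of_real (C / (1 + s)) * z"
    and "integrable cgauss (\<lambda>d. w d * cnj (z - d))" "(\<integral>d. w d * cnj (z - d) \<partial>cgauss) = of_real (C / (1 + s)) * cnj z"
    and "integrable cgauss (\<lambda>d. w d * (z - d) * cnj (z - d))"
      "(\<integral>d. w d * (z - d) * cnj (z - d) \<partial>cgauss) = of_real (C / (1 + s) * (1 + (cmod z)\<^sup>2 / (1 + s)))"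
proof -
  define u v where "u = complex_of_real (1 / (1 + s)) * z" and "v = complex_of_real (1 / sqrt (1 + s))"
  have T: "z - (of_real (s / (1 + s)) * z + of_real (1 / sqrt (1 + s)) * x) = u - v * x" for x
  proof -
    have "s / (1 + s) + 1 / (1 + s) = 1" using s by (simp add: field_simps)
    then have "of_real (s / (1 + s)) * z + u = of_real 1 * z"
      unfolding u_def distrib_right[symmetric] of_real_add[symmetric] by (simp only:)
    then show ?thesis unfolding v_def by (simp add: algebra_simps)
  qed
  note M = cgauss_moments
  have w_eq: "complex_of_real (exp (- s * (cmod (z - d))\<^sup>2)) = w d" for d by (simp add: w_def)
  have P: "measure cgauss UNIV = 1" using cgauss.prob_space by simp
  have i1: "integrable cgauss (\<lambda>x. u - v * x)" using M(1) by auto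
  have i2: "integrable cgauss (\<lambda>x. cnj u - cnj v * cnj x)" using M(3) by auto
  have sq: "(u - v * x) * cnj (u - v * x) = u * cnj u - cnj u * v * x - u * cnj v * cnj x + v * cnj v * (x * cnj x)" for x
    by (simp add: algebra_simps)
  have i3: "integrable cgauss (\<lambda>x. (u - v * x) * cnj (u - v * x))"
    unfolding sq using M(1,3,5) by (intro Bochner_Integration.integrable_add Bochner_Integration.integrable_diff integrable_mult_right) auto
  have vv: "v * cnj v = of_real (1 / (1 + s))"
    unfolding v_def using s by (simp add: of_real_mult[symmetric] del: of_real_mult)
  have uu: "u * cnj u = of_real ((cmod z)\<^sup>2 / (1 + s)\<^sup>2)"
  proof -
    define r where "r = 1 / (1 + s)"
    have "u * cnj u = of_real r * of_real r * (z * cnj z)"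
      by (simp only: u_def r_def complex_cnj_mult complex_cnj_complex_of_real mult_ac)
    also have "\<dots> = of_real (r * r * (cmod z)\<^sup>2)" by (simp only: of_real_mult complex_norm_square)
    also have "r * r * (cmod z)\<^sup>2 = (cmod z)\<^sup>2 / (1 + s)\<^sup>2" by (simp add: r_def power2_eq_square)
    finally show ?thesis .
  qed
  have "integrable cgauss (\<lambda>d. w d * 1)" "(\<integral>d. w d * 1 \<partial>cgauss) = of_real C * (\<integral>x. 1 \<partial>cgauss)"
    using cgauss_tilt_integral[OF s, of "\<lambda>_. 1" z] unfolding w_eq C_def by (simp_all add: P)
  then show "integrable cgauss w" "(\<integral>d. w d \<partial>cgauss) = of_real C" by (simp_all add: P)
  have "integrable cgauss (\<lambda>d. w d * (z - d))" "(\<integral>d. w d * (z - d) \<partial>cgauss) = of_real C * (\<integral>x. u - v * x \<partial>cgauss)"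
    using cgauss_tilt_integral[OF s, of "\<lambda>d. z - d" z] i1 unfolding w_eq C_def T by simp_all
  moreover have "(\<integral>x. u - v * x \<partial>cgauss) = u"
    using M(1,2) by (subst Bochner_Integration.integral_diff) (auto simp: P)
  ultimately show "integrable cgauss (\<lambda>d. w d * (z - d))" "(\<integral>d. w d * (z - d) \<partial>cgauss) = of_real (C / (1 + s)) * z"
    by (simp_all add: u_def)
  have "integrable cgauss (\<lambda>d. w d * cnj (z - d))" "(\<integral>d. w d * cnj (z - d) \<partial>cgauss) = of_real C * (\<integral>x. cnj u - cnj v * cnj x \<partial>cgauss)"
    using cgauss_tilt_integral[OF s, of "\<lambda>d. cnj (z - d)" z] i2 unfolding w_eq C_def T by simp_all
  moreover have "(\<integral>x. cnj u - cnj v * cnj x \<partial>cgauss) = cnj u"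
    using M(3,4) by (subst Bochner_Integration.integral_diff) (auto simp: P)
  ultimately show "integrable cgauss (\<lambda>d. w d * cnj (z - d))" "(\<integral>d. w d * cnj (z - d) \<partial>cgauss) = of_real (C / (1 + s)) * cnj z"
    by (simp_all add: u_def)
  have "integrable cgauss (\<lambda>d. w d * ((z - d) * cnj (z - d)))" "(\<integral>d. w d * ((z - d) * cnj (z - d)) \<partial>cgauss) = of_real C * (\<integral>x. (u - v * x) * cnj (u - v * x) \<partial>cgauss)"
    using cgauss_tilt_integral[OF s, of "\<lambda>d. (z - d) * cnj (z - d)" z] i3 unfolding w_eq C_def T by simp_all
  moreover have "(\<integral>x. (u - v * x) * cnj (u - v * x) \<partial>cgauss) = u * cnj u + v * cnj v"
  proof -
    have "(\<integral>x. (u - v * x) * cnj (u - v * x) \<partial>cgauss) =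
      (\<integral>x. u * cnj u \<partial>cgauss) - (\<integral>x. cnj u * v * x \<partial>cgauss) - (\<integral>x. u * cnj v * cnj x \<partial>cgauss) + (\<integral>x. v * cnj v * (x * cnj x) \<partial>cgauss)"
      unfolding sq using M(1,3,5)
      by (subst Bochner_Integration.integral_add, intro Bochner_Integration.integrable_diff integrable_mult_right, auto)
    then show ?thesis using M(2,4,6) by (simp add: P)
  qed
  moreover have "of_real C * (u * cnj u + v * cnj v) = of_real (C / (1 + s) * (1 + (cmod z)\<^sup>2 / (1 + s)))"
  proof -
    have "C * ((cmod z)\<^sup>2 / (1 + s)\<^sup>2 + 1 / (1 + s)) = C / (1 + s) * (1 + (cmod z)\<^sup>2 / (1 + s))"
      using s by (simp add: power2_eq_square distrib_left)
    then show ?thesis unfolding uu vv of_real_add[symmetric] of_real_mult[symmetric] by (simp only:)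
  qed
  ultimately show "integrable cgauss (\<lambda>d. w d * (z - d) * cnj (z - d))"
      "(\<integral>d. w d * (z - d) * cnj (z - d) \<partial>cgauss) = of_real (C / (1 + s) * (1 + (cmod z)\<^sup>2 / (1 + s)))"
    by (simp_all only: mult.assoc)
qed

section \<open>Permutations weighted by their fixed points\<close>

text \<open>
  Expand the product over the sets \<open>J\<close> of fixed points that contribute \<open>a i\<close>; the permutations
  fixing \<open>J\<close> pointwise are those of the complement.
\<close>

lemma sum_over_fixed_points:
  fixes a :: "nat \<Rightarrow> real"
  shows "(\<Sum>\<sigma> | \<sigma> permutes {..<m}. \<Prod>i<m. if \<sigma> i = i then 1 + a i else 1) =
         (\<Sum>J\<in>Pow {..<m}. (\<Prod>i\<in>J. a i) * fact (m - card J))"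
proof -
  let ?P = "{\<sigma>. \<sigma> permutes {..<m}}"
  have fin: "finite ?P" by (rule finite_permutations) simp
  have "(\<Sum>\<sigma>\<in>?P. \<Prod>i<m. if \<sigma> i = i then 1 + a i else 1) = (\<Sum>\<sigma>\<in>?P. \<Sum>J\<in>Pow {..<m}. \<Prod>i\<in>J. if \<sigma> i = i then a i else 0)"
  proof (intro sum.cong refl)
    fix \<sigma>
    have "(\<Prod>i<m. if \<sigma> i = i then 1 + a i else 1) = (\<Prod>i<m. (if \<sigma> i = i then a i else 0) + 1)"
      by (intro prod.cong) auto
    also have "\<dots> = (\<Sum>J\<in>Pow {..<m}. (\<Prod>i\<in>J. if \<sigma> i = i then a i else 0) * (\<Prod>i\<in>{..<m} - J. 1))"
      by (rule prod_add) simp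
    finally show "(\<Prod>i<m. if \<sigma> i = i then 1 + a i else 1) = (\<Sum>J\<in>Pow {..<m}. \<Prod>i\<in>J. if \<sigma> i = i then a i else 0)"
      by simp
  qed
  also have "\<dots> = (\<Sum>J\<in>Pow {..<m}. \<Sum>\<sigma>\<in>?P. \<Prod>i\<in>J. if \<sigma> i = i then a i else 0)"
    by (rule sum.swap)
  also have "\<dots> = (\<Sum>J\<in>Pow {..<m}. (\<Prod>i\<in>J. a i) * fact (m - card J))"
  proof (intro sum.cong refl)
    fix J assume "J \<in> Pow {..<m}"
    then have J: "J \<subseteq> {..<m}" "finite J" by (auto intro: finite_subset)
    have "(\<Sum>\<sigma>\<in>?P. \<Prod>i\<in>J. if \<sigma> i = i then a i else 0) = (\<Sum>\<sigma>\<in>?P. if \<sigma> permutes ({..<m} - J) then \<Prod>i\<in>J. a i else 0)"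
    proof (intro sum.cong refl)
      fix \<sigma> assume s: "\<sigma> \<in> ?P"
      show "(\<Prod>i\<in>J. if \<sigma> i = i then a i else 0) = (if \<sigma> permutes ({..<m} - J) then \<Prod>i\<in>J. a i else 0)"
      proof (cases "\<forall>i\<in>J. \<sigma> i = i")
        case True
        then have "\<sigma> permutes ({..<m} - J)" using s unfolding permutes_def by auto
        moreover have "(\<Prod>i\<in>J. if \<sigma> i = i then a i else 0) = (\<Prod>i\<in>J. a i)"
          using True by (intro prod.cong) auto
        ultimately show ?thesis by simp
      next
        case False
        then have "\<not> \<sigma> permutes ({..<m} - J)" unfolding permutes_def by auto
        moreover have "(\<Prod>i\<in>J. if \<sigma> i = i then a i else 0) = 0"
          using False J by (intro prod_zero) auto
        ultimately show ?thesis by simp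
      qed
    qed
    also have "\<dots> = (\<Sum>\<sigma>\<in>{\<sigma>\<in>?P. \<sigma> permutes ({..<m} - J)}. \<Prod>i\<in>J. a i)"
      using fin by (subst sum.inter_filter) auto
    also have "{\<sigma>\<in>?P. \<sigma> permutes ({..<m} - J)} = {\<sigma>. \<sigma> permutes ({..<m} - J)}"
      by (auto intro: permutes_subset)
    also have "(\<Sum>\<sigma> | \<sigma> permutes ({..<m} - J). \<Prod>i\<in>J. a i) = (\<Prod>i\<in>J. a i) * fact (m - card J)"
      using J by (simp add: card_permutations[OF card_Diff_subset[OF J(2) J(1)]])
    finally show "(\<Sum>\<sigma>\<in>?P. \<Prod>i\<in>J. if \<sigma> i = i then a i else 0) = (\<Prod>i\<in>J. a i) * fact (m - card J)" .
  qed
  finally show ?thesis .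
qed

lemma sum_Pow_card:
  fixes f :: "nat \<Rightarrow> real"
  assumes A: "finite A"
  shows "(\<Sum>J\<in>Pow A. f (card J)) = (\<Sum>k\<le>card A. real (card A choose k) * f k)"
proof -
  have "(\<Sum>J\<in>Pow A. f (card J)) = (\<Sum>k\<le>card A. \<Sum>J\<in>{J\<in>Pow A. card J = k}. f (card J))"
    using A by (intro sum.group[symmetric]) (auto intro: card_mono)
  also have "\<dots> = (\<Sum>k\<le>card A. real (card A choose k) * f k)"
  proof (intro sum.cong refl)
    fix k
    have "{J\<in>Pow A. card J = k} = {J. J \<subseteq> A \<and> card J = k}" by auto
    then show "(\<Sum>J\<in>{J\<in>Pow A. card J = k}. f (card J)) = real (card A choose k) * f k"
      using n_subsets[OF A, of k] by simp
  qed
  finally show ?thesis .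
qed

text \<open>
  The weights of the determinant moment below: the index \<open>0\<close> is marked with \<open>y\<close> and all others
  with \<open>x\<close>. Sets of fixed points are split according to whether they contain \<open>0\<close>.
\<close>

lemma sum_over_fixed_points_one_marked:
  fixes x y :: real
  assumes m: "m > 0"
  shows "(\<Sum>\<sigma> | \<sigma> permutes {..<m}. \<Prod>i<m. if \<sigma> i = i then 1 + (if i = 0 then y else x) else 1) =
     fact (m - 1) * ((\<Sum>k<m. real (m - k) * x ^ k / fact k) + y * (\<Sum>k<m. x ^ k / fact k))"
proof -
  define A where "A = {1..<m}"
  have A: "finite A" "0 \<notin> A" "card A = m - 1" "{..<m} = insert 0 A" using m by (auto simp: A_def)
  let ?a = "\<lambda>i. if i = 0 then y else x"
  have disj: "Pow A \<inter> insert 0 ` Pow A = {}" using A by auto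
  have inj: "inj_on (insert 0) (Pow A)" using A(2) by (intro inj_onI) (metis PowD insert_ident subsetD)
  have pa: "(\<Prod>i\<in>J. ?a i) = x ^ card J" if "J \<in> Pow A" for J
  proof -
    have "(\<Prod>i\<in>J. ?a i) = (\<Prod>i\<in>J. x)" using that A by (intro prod.cong) auto
    then show ?thesis by simp
  qed
  have pb: "(\<Prod>i\<in>insert 0 J. ?a i) = y * x ^ card J" "card (insert 0 J) = Suc (card J)" if "J \<in> Pow A" for J
  proof -
    have "finite J" "0 \<notin> J" using that A finite_subset by auto
    then show "(\<Prod>i\<in>insert 0 J. ?a i) = y * x ^ card J" "card (insert 0 J) = Suc (card J)"
      using pa[OF that] by simp_all
  qed
  have fc: "real (m - 1 choose k) * fact (m - 1 - k) = fact (m - 1) / fact k" if "k < m" for k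
    using that binomial_fact[of k "m - 1", where 'a=real] by simp
  have fc': "fact (m - k) = real (m - k) * fact (m - 1 - k)" if "k < m" for k
    using that by (subst fact_reduce) (auto simp: diff_commute)
  have rng: "{..m - 1} = {..<m}" using m by auto
  have "(\<Sum>\<sigma> | \<sigma> permutes {..<m}. \<Prod>i<m. if \<sigma> i = i then 1 + ?a i else 1) = (\<Sum>J\<in>Pow {..<m}. (\<Prod>i\<in>J. ?a i) * fact (m - card J))"
    by (rule sum_over_fixed_points)
  also have "\<dots> = (\<Sum>J\<in>Pow A. (\<Prod>i\<in>J. ?a i) * fact (m - card J)) + (\<Sum>J\<in>Pow A. (\<Prod>i\<in>insert 0 J. ?a i) * fact (m - card (insert 0 J)))"
    unfolding A(4) Pow_insert using A disj inj by (subst sum.union_disjoint) (auto simp: sum.reindex)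
  also have "(\<Sum>J\<in>Pow A. (\<Prod>i\<in>J. ?a i) * fact (m - card J)) = (\<Sum>J\<in>Pow A. x ^ card J * fact (m - card J))"
    by (intro sum.cong refl) (simp only: pa)
  also have "\<dots> = (\<Sum>k\<le>m - 1. real (m - 1 choose k) * (x ^ k * fact (m - k)))"
    using sum_Pow_card[OF A(1), of "\<lambda>k. x ^ k * fact (m - k)"] A(3) by simp
  also have "\<dots> = fact (m - 1) * (\<Sum>k<m. real (m - k) * x ^ k / fact k)"
    unfolding rng sum_distrib_left
  proof (intro sum.cong refl)
    fix k assume "k \<in> {..<m}"
    then have k: "k < m" by simp
    have "real (m - 1 choose k) * (x ^ k * fact (m - k)) = (real (m - 1 choose k) * fact (m - 1 - k)) * (real (m - k) * x ^ k)"
      unfolding fc'[OF k] by (simp only: mult_ac)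
    then show "real (m - 1 choose k) * (x ^ k * fact (m - k)) = fact (m - 1) * (real (m - k) * x ^ k / fact k)"
      unfolding fc[OF k] by simp
  qed
  also have "(\<Sum>J\<in>Pow A. (\<Prod>i\<in>insert 0 J. ?a i) * fact (m - card (insert 0 J))) = (\<Sum>J\<in>Pow A. y * (x ^ card J * fact (m - 1 - card J)))"
    by (intro sum.cong refl) (simp only: pb, simp)
  also have "\<dots> = y * (\<Sum>k\<le>m - 1. real (m - 1 choose k) * (x ^ k * fact (m - 1 - k)))"
    using sum_Pow_card[OF A(1), of "\<lambda>k. x ^ k * fact (m - 1 - k)"] A(3)
    unfolding sum_distrib_left[symmetric] by simp
  also have "(\<Sum>k\<le>m - 1. real (m - 1 choose k) * (x ^ k * fact (m - 1 - k))) = fact (m - 1) * (\<Sum>k<m. x ^ k / fact k)"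
    unfolding rng sum_distrib_left
  proof (intro sum.cong refl)
    fix k assume "k \<in> {..<m}"
    then have k: "k < m" by simp
    have "real (m - 1 choose k) * (x ^ k * fact (m - 1 - k)) = (real (m - 1 choose k) * fact (m - 1 - k)) * x ^ k"
      by (simp only: mult_ac)
    then show "real (m - 1 choose k) * (x ^ k * fact (m - 1 - k)) = fact (m - 1) * (x ^ k / fact k)"
      unfolding fc[OF k] by simp
  qed
  finally show ?thesis by (simp add: algebra_simps)
qed

section \<open>A second moment of the characteristic polynomial\<close>

text \<open>
  The matrix \<open>z - D\<close>, built from an index function so that it can be integrated over the
  product measure \<^term>\<open>gauss_mat m\<close>.
\<close>

definition shifted :: "nat \<Rightarrow> complex \<Rightarrow> (nat \<times> nat \<Rightarrow> complex) \<Rightarrow> complex mat" where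
  "shifted m z D = mat m m (\<lambda>p. (if fst p = snd p then z else 0) - D p)"

lemma shifted_carrier [simp]: "shifted m z D \<in> carrier_mat m m"
  by (simp add: shifted_def)

lemma shifted_dim [simp]: "dim_row (shifted m z D) = m" "dim_col (shifted m z D) = m"
  by (simp_all add: shifted_def)

lemma det_measurable:
  fixes f :: "'a \<Rightarrow> nat \<Rightarrow> nat \<Rightarrow> complex"
  assumes "\<And>i j. i < m \<Longrightarrow> j < m \<Longrightarrow> (\<lambda>x. f x i j) \<in> borel_measurable N"
  shows "(\<lambda>x. det (mat m m (\<lambda>(i, j). f x i j))) \<in> borel_measurable N"
proof -
  have "det (mat m m (\<lambda>(i, j). f x i j)) = (\<Sum>\<sigma> | \<sigma> permutes {0..<m}. signof \<sigma> * (\<Prod>i = 0..<m. f x i (\<sigma> i)))" for x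
    by (subst det_def'[of _ m]) (auto intro!: sum.cong prod.cong dest: permutes_in_image)
  then show ?thesis
    by (simp only:) (intro borel_measurable_sum borel_measurable_times borel_measurable_const borel_measurable_prod assms,
      auto dest: permutes_in_image)
qed

lemma det_shifted_measurable: "(\<lambda>D. det (shifted m z D)) \<in> borel_measurable (gauss_mat m)"
proof -
  have "(\<lambda>D. det (mat m m (\<lambda>(i, j). (if i = j then z else 0) - D (i, j)))) \<in> borel_measurable (gauss_mat m)"
    by (intro det_measurable borel_measurable_diff borel_measurable_const gauss_component_measurable) auto
  moreover have "shifted m z D = mat m m (\<lambda>(i, j). (if i = j then z else 0) - D (i, j))" for D
    unfolding shifted_def by (intro eq_matI) auto
  ultimately show ?thesis by (simp only:)
qed

text \<open>
  The value of \<open>E (exp (- \<parallel>(z - D) u\<parallel>\<^sup>2) * \<bar>det (z - D)\<bar>\<^sup>2)\<close> as a function of \<open>x = \<bar>z\<bar>\<^sup>2\<close> and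
  \<open>s = \<parallel>u\<parallel>\<^sup>2\<close>.
\<close>

definition ginibre_moment :: "nat \<Rightarrow> real \<Rightarrow> real \<Rightarrow> real" where
  "ginibre_moment m x s = (1 / (1 + s)) ^ Suc m * exp (- (s * x / (1 + s))) *
     (fact (m - 1) * ((\<Sum>k<m. real (m - k) * x ^ k / fact k) + x / (1 + s) * (\<Sum>k<m. x ^ k / fact k)))"

text \<open>
  For \<open>u\<close> a multiple of the zeroth unit vector only the entries of column \<open>0\<close> are tilted, and they
  stay independent. Their weighted means off the diagonal still vanish, so the determinant
  formula above reduces the moment to a sum over permutations. Each of these meets column \<open>0\<close>
  exactly once, whence the common factor \<open>1 / (1 + s)\<close>; apart from it, only fixed points
  matter.
\<close>

lemma gauss_det_moment_column:
  fixes z :: complex and s :: real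
  assumes m: "m > 0" and s: "s \<ge> 0"
  shows "(\<integral>\<^sup>+D. ennreal ((\<Prod>p\<in>sqr m. exp (- (if snd p = 0 then s else 0) * (cmod ((if fst p = snd p then z else 0) - D p))\<^sup>2)) *
     (cmod (det (shifted m z D)))\<^sup>2) \<partial>gauss_mat m) = ennreal (ginibre_moment m ((cmod z)\<^sup>2) s)"
proof -
  \<comment> \<open>\<open>A p\<close> is the mean weight of entry \<open>p\<close>, and \<open>A p * R p\<close> the weighted second moment of \<open>z - D\<close> there\<close>
  define zp where "zp p = (if fst p = snd p then z else 0)" for p :: "nat \<times> nat"
  define sp where "sp p = (if snd p = 0 then s else 0)" for p :: "nat \<times> nat"
  define w where "w p d = complex_of_real (exp (- sp p * (cmod (zp p - d))\<^sup>2))" for p d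
  define h where "h p d = zp p - d" for p d
  define A where "A p = 1 / (1 + sp p) * exp (- (sp p * (cmod (zp p))\<^sup>2 / (1 + sp p)))" for p
  define R where "R p = 1 / (1 + sp p) * (1 + (cmod (zp p))\<^sup>2 / (1 + sp p))" for p
  define x where "x = (cmod z)\<^sup>2"
  have sp: "sp p \<ge> 0" for p using s by (simp add: sp_def)
  {
    fix p
    note cgauss_tilt_moments[OF sp[of p], of "zp p", folded w_def h_def A_def]
  } note M = this
  define f where "f D = (\<Prod>p\<in>sqr m. exp (- sp p * (cmod (zp p - D p))\<^sup>2)) * (cmod (det (shifted m z D)))\<^sup>2" for D
  let ?F = "\<lambda>D. (\<Prod>p\<in>sqr m. w p (D p)) * (det (mat m m (\<lambda>p. h p (D p))) * cnj (det (mat m m (\<lambda>p. h p (D p)))))"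
  have Ff: "?F D = complex_of_real (f D)" for D
    by (simp only: f_def w_def h_def zp_def shifted_def of_real_mult of_real_prod complex_norm_square)
  have zero: "(\<integral>d. w p d * h p d \<partial>cgauss) = 0" "(\<integral>d. w p d * cnj (h p d) \<partial>cgauss) = 0" if "fst p \<noteq> snd p" for p
    using M(4)[of p] M(6)[of p] that by (simp_all add: zp_def)
  note I = integral_det_squared[of m w h, OF M(1) M(3) M(5) M(7) zero]
  have AR: "A p / (1 + sp p) * (1 + (cmod (zp p))\<^sup>2 / (1 + sp p)) = A p * R p" for p
    by (simp add: R_def)
  have int: "integrable (gauss_mat m) (\<lambda>D. complex_of_real (f D))"
    using I(1) unfolding Ff by blast
  have "complex_of_real (\<integral>D. f D \<partial>gauss_mat m) = (\<integral>D. complex_of_real (f D) \<partial>gauss_mat m)"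
    by (rule integral_complex_of_real[symmetric])
  also have "\<dots> = (\<Sum>\<sigma> | \<sigma> permutes {..<m}. \<Prod>p\<in>sqr m. if \<sigma> (fst p) = snd p then of_real (A p * R p) else of_real (A p))"
    using I(2) unfolding Ff M(2) M(8) AR .
  also have "\<dots> = complex_of_real (\<Sum>\<sigma> | \<sigma> permutes {..<m}. \<Prod>p\<in>sqr m. if \<sigma> (fst p) = snd p then A p * R p else A p)"
    unfolding of_real_sum of_real_prod by (intro sum.cong prod.cong refl) simp
  also have "(\<Sum>\<sigma> | \<sigma> permutes {..<m}. \<Prod>p\<in>sqr m. if \<sigma> (fst p) = snd p then A p * R p else A p) =
    (\<Sum>\<sigma> | \<sigma> permutes {..<m}. (\<Prod>p\<in>sqr m. A p) * (1 / (1 + s) * (\<Prod>i<m. if \<sigma> i = i then 1 + (if i = 0 then x / (1 + s) else x) else 1)))"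
  proof (intro sum.cong refl)
    fix \<sigma> assume "\<sigma> \<in> {\<sigma>. \<sigma> permutes {..<m}}"
    then have \<sigma>: "\<sigma> permutes {..<m}" by simp
    have "(\<Prod>p\<in>sqr m. if \<sigma> (fst p) = snd p then A p * R p else A p) = (\<Prod>p\<in>sqr m. A p) * (\<Prod>p\<in>sqr m. if \<sigma> (fst p) = snd p then R p else 1)"
      unfolding prod.distrib[symmetric] by (intro prod.cong) auto
    also have "(\<Prod>p\<in>sqr m. if \<sigma> (fst p) = snd p then R p else 1) = (\<Prod>i<m. R (i, \<sigma> i))"
      using prod_permutation_entries[OF \<sigma>, of "\<lambda>i j. R (i, j)"] by (simp only: prod.collapse)
    also have "\<dots> = (\<Prod>i<m. if \<sigma> i = 0 then 1 / (1 + s) else 1) * (\<Prod>i<m. if \<sigma> i = i then 1 + (if i = 0 then x / (1 + s) else x) else 1)"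
      unfolding prod.distrib[symmetric] by (intro prod.cong refl) (auto simp: R_def sp_def zp_def x_def)
    also have "(\<Prod>i<m. if \<sigma> i = 0 then 1 / (1 + s) else 1) = (\<Prod>i<m. if i = 0 then 1 / (1 + s) else 1)"
      using prod.permute[OF \<sigma>, of "\<lambda>i. if i = 0 then 1 / (1 + s) else 1"] by (simp add: comp_def)
    also have "\<dots> = 1 / (1 + s)" using m by simp
    finally show "(\<Prod>p\<in>sqr m. if \<sigma> (fst p) = snd p then A p * R p else A p) =
      (\<Prod>p\<in>sqr m. A p) * (1 / (1 + s) * (\<Prod>i<m. if \<sigma> i = i then 1 + (if i = 0 then x / (1 + s) else x) else 1))" .
  qed
  also have "\<dots> = (\<Prod>p\<in>sqr m. A p) * (1 / (1 + s) * (fact (m - 1) * ((\<Sum>k<m. real (m - k) * x ^ k / fact k) + x / (1 + s) * (\<Sum>k<m. x ^ k / fact k))))"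
    unfolding sum_distrib_left[symmetric] sum_over_fixed_points_one_marked[OF m] ..
  also have "(\<Prod>p\<in>sqr m. A p) = (1 / (1 + s)) ^ m * exp (- (s * x / (1 + s)))"
  proof -
    have "(\<Prod>p\<in>sqr m. A p) = (\<Prod>i<m. \<Prod>j<m. A (i, j))"
      unfolding prod.cartesian_product by (intro prod.cong) auto
    also have "\<dots> = (\<Prod>i<m. \<Prod>j<m. if j = 0 then 1 / (1 + s) * (if i = 0 then exp (- (s * x / (1 + s))) else 1) else 1)"
      by (intro prod.cong refl) (auto simp: A_def sp_def zp_def x_def)
    also have "\<dots> = (\<Prod>i<m. 1 / (1 + s) * (if i = 0 then exp (- (s * x / (1 + s))) else 1))"
      using m by (intro prod.cong refl) (subst prod.delta, auto)
    also have "\<dots> = (1 / (1 + s)) ^ m * exp (- (s * x / (1 + s)))"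
      unfolding prod.distrib using m by simp
    finally show ?thesis .
  qed
  also have "(1 / (1 + s)) ^ m * exp (- (s * x / (1 + s))) * (1 / (1 + s) * (fact (m - 1) * ((\<Sum>k<m. real (m - k) * x ^ k / fact k) + x / (1 + s) * (\<Sum>k<m. x ^ k / fact k))))
    = ginibre_moment m x s"
    unfolding ginibre_moment_def power_Suc2 by (simp only: mult_ac)
  finally have val: "(\<integral>D. f D \<partial>gauss_mat m) = ginibre_moment m x s" by (simp only: of_real_eq_iff)
  have fint: "integrable (gauss_mat m) f"
    using integrable_Re[OF int] by simp
  have "(\<integral>\<^sup>+D. ennreal (f D) \<partial>gauss_mat m) = ennreal (\<integral>D. f D \<partial>gauss_mat m)"
    by (rule nn_integral_eq_integral[OF fint]) (auto simp: f_def intro!: AE_I2 mult_nonneg_nonneg prod_nonneg)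
  then show ?thesis unfolding val unfolding x_def f_def sp_def zp_def .
qed

text \<open>
  Conjugation by a unitary matrix leaves \<open>det (z - D)\<close> and the law of \<open>D\<close> unchanged, so \<open>u\<close> may be
  rotated onto the zeroth unit vector.
\<close>

lemma gauss_det_moment:
  fixes z :: complex and u :: "nat \<Rightarrow> complex"
  assumes m: "m > 0"
  shows "(\<integral>\<^sup>+D. ennreal (exp (- sq_norm m (\<lambda>i. \<Sum>j<m. shifted m z D $$ (i, j) * u j)) * (cmod (det (shifted m z D)))\<^sup>2) \<partial>gauss_mat m)
    = ennreal (ginibre_moment m ((cmod z)\<^sup>2) (sq_norm m u))"
proof -
  obtain q where q: "is_unitary m q" and q0: "\<And>i. 0 < i \<Longrightarrow> i < m \<Longrightarrow> (\<Sum>j<m. q i j * u j) = 0"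
    using householder[OF m, of u] by blast
  define k where "k = (\<Sum>j<m. q 0 j * u j)"
  define e where "e i = (if i = 0 then k else 0)" for i :: nat
  have e: "e i = (\<Sum>j<m. q i j * u j)" if "i < m" for i
    using q0[of i] that by (auto simp: e_def k_def)
  define s where "s = sq_norm m u"
  have "sq_norm m e = s" unfolding s_def by (rule unitary_sq_norm[OF q e])
  moreover have "sq_norm m e = (cmod k)\<^sup>2"
    using m by (simp add: sq_norm_def e_def if_distrib[of "\<lambda>a. (cmod a)\<^sup>2"] cong: if_cong)
  ultimately have ks: "(cmod k)\<^sup>2 = s" by simp
  let ?\<Phi> = "\<lambda>D. ennreal ((\<Prod>p\<in>sqr m. exp (- (if snd p = 0 then s else 0) * (cmod ((if fst p = snd p then z else 0) - D p))\<^sup>2)) *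
     (cmod (det (shifted m z D)))\<^sup>2)"
  have \<Phi>m: "?\<Phi> \<in> borel_measurable (gauss_mat m)"
  proof -
    have "(\<lambda>D. exp (- (if snd p = 0 then s else 0) * (cmod ((if fst p = snd p then z else 0) - D p))\<^sup>2)) \<in> borel_measurable (gauss_mat m)"
      if "p \<in> sqr m" for p
    proof -
      have "(\<lambda>y. exp (- (if snd p = 0 then s else 0) * (cmod ((if fst p = snd p then z else 0) - y))\<^sup>2)) \<in> borel_measurable borel"
        by measurable
      from measurable_compose[OF gauss_component_measurable[OF that] this] show ?thesis .
    qed
    moreover have "(\<lambda>D. (cmod (det (shifted m z D)))\<^sup>2) \<in> borel_measurable (gauss_mat m)"
    proof -
      have "(\<lambda>y::complex. (cmod y)\<^sup>2) \<in> borel_measurable borel" by measurable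
      from measurable_compose[OF det_shifted_measurable this] show ?thesis .
    qed
    ultimately have "(\<lambda>D. (\<Prod>p\<in>sqr m. exp (- (if snd p = 0 then s else 0) * (cmod ((if fst p = snd p then z else 0) - D p))\<^sup>2)) *
     (cmod (det (shifted m z D)))\<^sup>2) \<in> borel_measurable (gauss_mat m)"
      by (intro borel_measurable_times borel_measurable_prod)
    then show ?thesis by (rule measurable_compose[OF _ measurable_ennreal])
  qed
  have col: "(\<Prod>p\<in>sqr m. exp (- (if snd p = 0 then s else 0) * (cmod ((if fst p = snd p then z else 0) - D p))\<^sup>2)) =
     exp (- sq_norm m (\<lambda>i. \<Sum>j<m. shifted m z D $$ (i, j) * e j))" for D
  proof -
    have sumc: "(\<Sum>j<m. shifted m z D $$ (i, j) * e j) = shifted m z D $$ (i, 0) * k" for i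
      using m by (simp add: e_def if_distrib[of "\<lambda>a. _ * a"] cong: if_cong)
    have "sq_norm m (\<lambda>i. \<Sum>j<m. shifted m z D $$ (i, j) * e j) = (\<Sum>i<m. s * (cmod ((if i = 0 then z else 0) - D (i, 0)))\<^sup>2)"
      unfolding sq_norm_def sumc norm_mult power_mult_distrib ks using m
      by (intro sum.cong refl) (simp add: shifted_def mult.commute)
    also have "exp (- \<dots>) = (\<Prod>i<m. exp (- s * (cmod ((if i = 0 then z else 0) - D (i, 0)))\<^sup>2))"
      by (simp add: exp_sum sum_negf[symmetric])
    also have "\<dots> = (\<Prod>i<m. \<Prod>j<m. if j = 0 then exp (- s * (cmod ((if i = 0 then z else 0) - D (i, 0)))\<^sup>2) else 1)"
      using m by (intro prod.cong refl) (subst prod.delta, auto)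
    also have "\<dots> = (\<Prod>i<m. \<Prod>j<m. exp (- (if j = 0 then s else 0) * (cmod ((if i = j then z else 0) - D (i, j)))\<^sup>2))"
      by (intro prod.cong refl) auto
    also have "\<dots> = (\<Prod>p\<in>sqr m. exp (- (if snd p = 0 then s else 0) * (cmod ((if fst p = snd p then z else 0) - D p))\<^sup>2))"
      unfolding prod.cartesian_product by (intro prod.cong) auto
    finally show ?thesis by simp
  qed
  define Q where "Q = mat m m (\<lambda>(i, j). q i j)"
  define Qs where "Qs = mat m m (\<lambda>(i, j). cnj (q j i))"
  have QQ: "Q * Qs = 1\<^sub>m m" "Qs * Q = 1\<^sub>m m" and Qc: "Q \<in> carrier_mat m m" "Qs \<in> carrier_mat m m"
    using unitary_mat_mult[OF q] by (auto simp: Q_def Qs_def)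
  have entry: "shifted m z (conj_act m q D) $$ (i, j) = (\<Sum>l<m. (\<Sum>k<m. q i k * shifted m z D $$ (k, l)) * cnj (q j l))" if ij: "i < m" "j < m" for D i j
  proof -
    have "(\<Sum>l<m. (\<Sum>k<m. q i k * shifted m z D $$ (k, l)) * cnj (q j l)) =
       (\<Sum>l<m. q i l * z * cnj (q j l)) - (\<Sum>l<m. (\<Sum>k<m. q i k * D (k, l)) * cnj (q j l))"
    proof -
      have "(\<Sum>k<m. q i k * shifted m z D $$ (k, l)) = q i l * z - (\<Sum>k<m. q i k * D (k, l))" if "l < m" for l
      proof -
        have "(\<Sum>k<m. q i k * shifted m z D $$ (k, l)) = (\<Sum>k<m. (if k = l then q i k * z else 0) - q i k * D (k, l))"
          using that by (intro sum.cong refl) (auto simp: shifted_def algebra_simps)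
        then show ?thesis using that by (simp add: sum_subtractf)
      qed
      then show ?thesis by (simp add: sum_subtractf[symmetric] left_diff_distrib)
    qed
    also have "(\<Sum>l<m. q i l * z * cnj (q j l)) = z * (\<Sum>l<m. q i l * cnj (q j l))"
      by (simp add: sum_distrib_left mult_ac)
    also have "(\<Sum>l<m. q i l * cnj (q j l)) = (if i = j then 1 else 0)"
      using q ij by (auto simp: is_unitary_def)
    also have "(\<Sum>l<m. (\<Sum>k<m. q i k * D (k, l)) * cnj (q j l)) = conj_act m q D (i, j)"
      using ij by (simp add: conj_act_apply)
    finally show ?thesis using ij by (simp add: shifted_def)
  qed
  have conj: "shifted m z (conj_act m q D) = Q * shifted m z D * Qs" for D
    by (intro eq_matI) (auto simp: entry Q_def Qs_def scalar_prod_def atLeast0LessThan shifted_def[of m z D] intro!: sum.cong)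
  have det: "det (shifted m z (conj_act m q D)) = det (shifted m z D)" for D
  proof -
    have "det (shifted m z (conj_act m q D)) = det Q * det (shifted m z D) * det Qs"
      unfolding conj using Qc by (subst det_mult[of _ m]; simp add: det_mult[of _ m])
    also have "\<dots> = det (shifted m z D) * (det Q * det Qs)" by (simp only: mult_ac)
    also have "det Q * det Qs = 1" using QQ Qc by (simp add: det_mult[of _ m, symmetric])
    finally show ?thesis by simp
  qed
  have vec: "sq_norm m (\<lambda>i. \<Sum>j<m. shifted m z (conj_act m q D) $$ (i, j) * e j) = sq_norm m (\<lambda>i. \<Sum>j<m. shifted m z D $$ (i, j) * u j)" for D
  proof (rule unitary_sq_norm[OF q])
    fix i assume i: "i < m"
    have "(\<Sum>j<m. shifted m z (conj_act m q D) $$ (i, j) * e j) = (\<Sum>j<m. \<Sum>l<m. (\<Sum>k<m. q i k * shifted m z D $$ (k, l)) * cnj (q j l) * e j)"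
      using i by (simp add: entry sum_distrib_right)
    also have "\<dots> = (\<Sum>l<m. (\<Sum>k<m. q i k * shifted m z D $$ (k, l)) * (\<Sum>j<m. cnj (q j l) * e j))"
      by (subst sum.swap) (simp add: sum_distrib_left mult.assoc)
    also have "\<dots> = (\<Sum>l<m. (\<Sum>k<m. q i k * shifted m z D $$ (k, l)) * u l)"
      using unitary_inverse[OF q e] by simp
    also have "\<dots> = (\<Sum>k<m. q i k * (\<Sum>j<m. shifted m z D $$ (k, j) * u j))"
      unfolding sum_distrib_left sum_distrib_right by (subst sum.swap) (simp only: mult.assoc)
    finally show "(\<Sum>j<m. shifted m z (conj_act m q D) $$ (i, j) * e j) = (\<Sum>j<m. q i j * (\<Sum>ja<m. shifted m z D $$ (j, ja) * u ja))" .
  qed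
  have "ennreal (ginibre_moment m ((cmod z)\<^sup>2) s) = (\<integral>\<^sup>+D. ?\<Phi> D \<partial>gauss_mat m)"
    by (rule gauss_det_moment_column[symmetric, OF m]) (simp add: s_def)
  also have "\<dots> = (\<integral>\<^sup>+D. ?\<Phi> D \<partial>distr (gauss_mat m) (gauss_mat m) (conj_act m q))"
    by (simp only: distr_conj_act[OF q])
  also have "\<dots> = (\<integral>\<^sup>+D. ?\<Phi> (conj_act m q D) \<partial>gauss_mat m)"
    using \<Phi>m by (rule nn_integral_distr[OF conj_act_measurable, unfolded measurable_distr_eq1])
  also have "\<dots> = (\<integral>\<^sup>+D. ennreal (exp (- sq_norm m (\<lambda>i. \<Sum>j<m. shifted m z D $$ (i, j) * u j)) * (cmod (det (shifted m z D)))\<^sup>2) \<partial>gauss_mat m)"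
    unfolding col vec det ..
  finally show ?thesis by (simp add: s_def)
qed

section \<open>Rational integrals over complex vectors\<close>

lemma nn_integral_inverse_power:
  fixes a :: real
  assumes a: "a > 0"
  shows "(\<integral>\<^sup>+t. ennreal ((1 / (a + (cmod t)\<^sup>2)) ^ Suc (Suc p)) \<partial>lborel) = ennreal (pi / real (Suc p) * (1 / a) ^ Suc p)"
proof -
  have "(\<integral>\<^sup>+t. ennreal ((1 / (a + (cmod t)\<^sup>2)) ^ Suc (Suc p)) \<partial>lborel) = ennreal pi * (\<integral>\<^sup>+t\<in>{0..}. ennreal ((1 / (a + t)) ^ Suc (Suc p)) \<partial>lborel)"
    by (rule nn_integral_complex_radial) simp
  also have "(\<integral>\<^sup>+t\<in>{0..}. ennreal ((1 / (a + t)) ^ Suc (Suc p)) \<partial>lborel) = ennreal (0 - (- (1 / real (Suc p)) * (1 / (a + 0)) ^ Suc p))"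
  proof (rule nn_integral_FTC_atLeast[where F="\<lambda>t. - (1 / real (Suc p)) * (1 / (a + t)) ^ Suc p"])
    show "((\<lambda>t. - (1 / real (Suc p)) * (1 / (a + t)) ^ Suc p) has_real_derivative (1 / (a + t)) ^ Suc (Suc p)) (at t)" if "0 \<le> t" for t
    proof -
      have ne: "a + t \<noteq> 0" using a that by simp
      have "((\<lambda>t. (1 / (a + t))) has_real_derivative - (1 / (a + t))\<^sup>2) (at t)"
        using ne by (auto intro!: derivative_eq_intros simp: power2_eq_square divide_simps)
      from DERIV_cmult[OF DERIV_power[OF this, of "Suc p"], of "- (1 / real (Suc p))"]
      show ?thesis by (simp add: power2_eq_square mult_ac)
    qed
    have "((\<lambda>t. 1 / (a + t)) \<longlongrightarrow> 0) at_top" by real_asymp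
    then have "((\<lambda>t. - (1 / real (Suc p)) * (1 / (a + t)) ^ Suc p) \<longlongrightarrow> - (1 / real (Suc p)) * 0 ^ Suc p) at_top"
      by (intro tendsto_intros)
    then show "((\<lambda>t. - (1 / real (Suc p)) * (1 / (a + t)) ^ Suc p) \<longlongrightarrow> 0) at_top" by simp
  qed (use a in auto)
  finally show ?thesis using a by (simp add: ennreal_mult[symmetric])
qed

text \<open>
  One coordinate is integrated out at a time; each lowers the exponent by one. With the
  exponent written as \<open>Suc m + p\<close> the induction keeps \<open>p\<close> arbitrary but its final value fixed.
\<close>

lemma nn_integral_CL_inverse_power:
  fixes c :: real
  assumes "c > 0"
  shows "(\<integral>\<^sup>+u. ennreal ((1 / (c + sq_norm m u)) ^ (Suc m + p)) \<partial>CL m) = ennreal (pi ^ m * fact p / fact (m + p) * (1 / c) ^ Suc p)"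
  using assms
proof (induction m arbitrary: p)
  case 0
  have "sq_norm 0 u = 0" for u by (simp add: sq_norm_def)
  then show ?case by (simp add: PiM_empty nn_integral_count_space_finite)
next
  case (Suc m)
  have m: "(\<lambda>u. ennreal ((1 / (c + sq_norm (Suc m) u)) ^ (Suc (Suc m) + p))) \<in> borel_measurable (CL (Suc m))"
    by measurable
  have "(\<integral>\<^sup>+u. ennreal ((1 / (c + sq_norm (Suc m) u)) ^ (Suc (Suc m) + p)) \<partial>CL (Suc m)) =
    (\<integral>\<^sup>+u. \<integral>\<^sup>+t. ennreal ((1 / (c + sq_norm (Suc m) (u(m := t)))) ^ (Suc (Suc m) + p)) \<partial>lborel \<partial>CL m)"
    by (rule CL_insert(1)[OF m])
  also have "\<dots> = (\<integral>\<^sup>+u. \<integral>\<^sup>+t. ennreal ((1 / ((c + sq_norm m u) + (cmod t)\<^sup>2)) ^ Suc (Suc (m + p))) \<partial>lborel \<partial>CL m)"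
    by (simp add: sq_norm_def add.assoc)
  also have "\<dots> = (\<integral>\<^sup>+u. ennreal (pi / real (Suc (m + p)) * (1 / (c + sq_norm m u)) ^ Suc (m + p)) \<partial>CL m)"
    using Suc.prems by (intro nn_integral_cong nn_integral_inverse_power add_pos_nonneg) auto
  also have "\<dots> = (\<integral>\<^sup>+u. ennreal (pi / real (Suc (m + p))) * ennreal ((1 / (c + sq_norm m u)) ^ (Suc m + p)) \<partial>CL m)"
    using Suc.prems by (intro nn_integral_cong) (subst ennreal_mult[symmetric], auto intro!: add_nonneg_nonneg)
  also have "\<dots> = ennreal (pi / real (Suc (m + p))) * ennreal (pi ^ m * fact p / fact (m + p) * (1 / c) ^ Suc p)"
    by (subst nn_integral_cmult, measurable) (simp only: Suc.IH[OF Suc.prems])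
  also have "\<dots> = ennreal (pi / real (Suc (m + p)) * (pi ^ m * fact p / fact (m + p) * (1 / c) ^ Suc p))"
    using Suc.prems by (subst ennreal_mult) auto
  also have "pi / real (Suc (m + p)) * (pi ^ m * fact p / fact (m + p) * (1 / c) ^ Suc p) = pi ^ Suc m * fact p / fact (Suc m + p) * (1 / c) ^ Suc p"
    by (simp add: mult_ac)
  finally show ?case .
qed

section \<open>The direction of a random cofactor vector\<close>

text \<open>
  The mean fraction of eigenvalues \<open>\<lambda>\<close> of an unscaled \<open>n\<close> by \<open>n\<close> Ginibre matrix with
  \<open>\<bar>\<lambda>\<bar>\<^sup>2 \<ge> x\<close>.
\<close>

definition ginibre_tail :: "nat \<Rightarrow> real \<Rightarrow> real" where
  "ginibre_tail n x = exp (- x) * (\<Sum>k<n. (1 - real k / real n) * x ^ k / fact k)"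

text \<open>
  The two sums stem from the two parts of \<^const>\<open>ginibre_moment\<close>; after shifting the index in
  the second, their coefficients of \<open>x ^ k\<close> combine to \<open>1 - k / (m + 1)\<close>.
\<close>

lemma ginibre_tail_Suc:
  fixes x :: real
  assumes m: "m > 0"
  defines "P \<equiv> \<Sum>k<m. real (m - k) * x ^ k / fact k" and "Q \<equiv> \<Sum>k<m. x ^ k / fact k"
  shows "exp (- x) * fact (m - 1) * (P / fact m + x * Q / fact (Suc m)) = ginibre_tail (Suc m) x"
proof -
  have gen2: "a * p / f / M + b * p / f / c = (a / M + b / c) * (p / f)" for a b p f M c :: real
    by (simp only: distrib_right times_divide_times_eq divide_divide_eq_left) (simp only: mult.commute)
  have f1: "fact m = real m * fact (m - 1)" using m by (simp add: fact_reduce)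
  have f2: "fact (Suc m) = real (Suc m) * (real m * fact (m - 1))" using f1 by simp
  have Pe: "P = (\<Sum>k<Suc m. (real m - real k) * x ^ k / fact k)"
    unfolding P_def by (simp add: of_nat_diff)
  have Qe: "x * Q = (\<Sum>k<Suc m. real k * x ^ k / fact k)"
  proof -
    have "(\<Sum>k<Suc m. real k * x ^ k / fact k) = (\<Sum>k<m. real (Suc k) * x ^ Suc k / fact (Suc k))"
      by (subst sum.lessThan_Suc_shift) simp
    also have "\<dots> = (\<Sum>k<m. x * (x ^ k / fact k))"
      by (intro sum.cong refl) (simp add: divide_simps)
    finally show ?thesis unfolding Q_def by (simp add: sum_distrib_left)
  qed
  have "fact (m - 1) * (P / fact m + x * Q / fact (Suc m)) = P / real m + x * Q / (real m * real (Suc m))"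
  proof -
    have "F * (P / (M * F) + x * Q / (N * (M * F))) = P / M + x * Q / (M * N)" if "F \<noteq> 0" "M \<noteq> 0" "N \<noteq> 0" for F M N :: real
      using that by (simp add: field_simps)
    then show ?thesis unfolding f1 f2 using m by simp
  qed
  also have "P / real m + x * Q / (real m * real (Suc m)) =
    (\<Sum>k<Suc m. (real m - real k) * x ^ k / fact k) / real m + (\<Sum>k<Suc m. real k * x ^ k / fact k) / (real m * real (Suc m))"
    unfolding Pe Qe ..
  also have "(\<Sum>k<Suc m. (real m - real k) * x ^ k / fact k) / real m + (\<Sum>k<Suc m. real k * x ^ k / fact k) / (real m * real (Suc m)) =
     (\<Sum>k<Suc m. (1 - real k / real (Suc m)) * x ^ k / fact k)"
    unfolding sum_divide_distrib sum.distrib[symmetric]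
  proof (intro sum.cong refl)
    fix k
    have "(real m - real k) / real m + real k / (real m * real (Suc m)) = 1 - real k / real (Suc m)"
    proof -
      have gen: "(M - a) / M + a / (M * N) = 1 - a / N" if "M \<noteq> 0" "N \<noteq> 0" "N = M + 1" for M N a :: real
      proof -
        have "a / M - a / N = (a * N - a * M) / (M * N)" by (rule diff_frac_eq[OF that(1,2)])
        also have "a * N - a * M = a" unfolding that(3) by (simp add: algebra_simps)
        finally show ?thesis using that(1) by (simp add: diff_divide_distrib)
      qed
      show ?thesis using m by (intro gen) auto
    qed
    then have "((real m - real k) / real m + real k / (real m * real (Suc m))) * (x ^ k / fact k) = (1 - real k / real (Suc m)) * (x ^ k / fact k)"
      by (simp only:)
    then show "(real m - real k) * x ^ k / fact k / real m + real k * x ^ k / fact k / (real m * real (Suc m)) = (1 - real k / real (Suc m)) * x ^ k / fact k"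
      unfolding gen2 by (simp only: times_divide_eq_right)
  qed
  finally have "exp (- x) * (fact (m - 1) * (P / fact m + x * Q / fact (Suc m))) = exp (- x) * (\<Sum>k<Suc m. (1 - real k / real (Suc m)) * x ^ k / fact k)"
    by (rule arg_cong)
  then show ?thesis unfolding ginibre_tail_def by (simp only: mult.assoc)
qed

text \<open>
  The exponents \<open>x / (1 + s)\<close> and \<open>s * x / (1 + s)\<close> add up to \<open>x\<close>, so that the exponential leaves
  the integral and two rational integrals remain.
\<close>

lemma nn_integral_ginibre_moment:
  fixes x :: real
  assumes m: "m > 0" and x: "x \<ge> 0"
  shows "(\<integral>\<^sup>+u. ennreal (exp (- (x / (1 + sq_norm m u))) * (1 / pi) ^ m * ginibre_moment m x (sq_norm m u)) \<partial>CL m) = ennreal (ginibre_tail (Suc m) x)"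
proof -
  define P Q where "P = (\<Sum>k<m. real (m - k) * x ^ k / fact k)" and "Q = (\<Sum>k<m. x ^ k / fact k)"
  have PQ: "P \<ge> 0" "Q \<ge> 0" unfolding P_def Q_def using x by (auto intro!: sum_nonneg)
  define a where "a = (1 / pi) ^ m * exp (- x) * fact (m - 1) * P"
  define b where "b = (1 / pi) ^ m * exp (- x) * fact (m - 1) * (x * Q)"
  have c1: "0 < (1 :: real)" by simp
  have ab: "a \<ge> 0" "b \<ge> 0" unfolding a_def b_def using PQ x by (auto intro!: mult_nonneg_nonneg)
  have gen: "ennreal (a * p + b * q) = ennreal a * ennreal p + ennreal b * ennreal q" if "p \<ge> 0" "q \<ge> 0" for p q
    using ab that by (simp add: ennreal_mult)
  have "(\<integral>\<^sup>+u. ennreal (exp (- (x / (1 + sq_norm m u))) * (1 / pi) ^ m * ginibre_moment m x (sq_norm m u)) \<partial>CL m) =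
    (\<integral>\<^sup>+u. ennreal a * ennreal ((1 / (1 + sq_norm m u)) ^ (Suc m + 0)) + ennreal b * ennreal ((1 / (1 + sq_norm m u)) ^ (Suc m + 1)) \<partial>CL m)"
  proof (intro nn_integral_cong)
    fix u
    define s where "s = sq_norm m u"
    have s: "s \<ge> 0" by (simp add: s_def)
    have "x / (1 + s) + s * x / (1 + s) = ((1 + s) * x) / (1 + s)"
      by (simp only: add_divide_distrib distrib_right mult_1_left)
    also have "\<dots> = x" using s by simp
    finally have "x / (1 + s) + s * x / (1 + s) = x" .
    then have e: "exp (- (x / (1 + s))) * exp (- (s * x / (1 + s))) = exp (- x)"
      unfolding exp_add[symmetric] by simp
    have "exp (- (x / (1 + s))) * (1 / pi) ^ m * ginibre_moment m x s =
      (1 / pi) ^ m * (exp (- (x / (1 + s))) * exp (- (s * x / (1 + s)))) * fact (m - 1) * ((1 / (1 + s)) ^ Suc m * (P + x / (1 + s) * Q))"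
      unfolding ginibre_moment_def P_def Q_def by (simp only: mult_ac)
    also have "\<dots> = a * (1 / (1 + s)) ^ (Suc m + 0) + b * (1 / (1 + s)) ^ (Suc m + 1)"
    proof -
      define r where "r = 1 / (1 + s)"
      have "x / (1 + s) = x * r" by (simp add: r_def)
      then show ?thesis
        unfolding e a_def b_def r_def[symmetric] by (simp only:) (simp add: algebra_simps)
    qed
    finally have "ennreal (exp (- (x / (1 + s))) * (1 / pi) ^ m * ginibre_moment m x s) =
       ennreal (a * (1 / (1 + s)) ^ (Suc m + 0) + b * (1 / (1 + s)) ^ (Suc m + 1))" by (simp only:)
    also have "\<dots> = ennreal a * ennreal ((1 / (1 + s)) ^ (Suc m + 0)) + ennreal b * ennreal ((1 / (1 + s)) ^ (Suc m + 1))"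
    proof -
      show ?thesis using s by (intro gen zero_le_power divide_nonneg_nonneg) auto
    qed
    finally show "ennreal (exp (- (x / (1 + sq_norm m u))) * (1 / pi) ^ m * ginibre_moment m x (sq_norm m u)) =
      ennreal a * ennreal ((1 / (1 + sq_norm m u)) ^ (Suc m + 0)) + ennreal b * ennreal ((1 / (1 + sq_norm m u)) ^ (Suc m + 1))"
      unfolding s_def .
  qed
  also have "\<dots> = ennreal a * ennreal (pi ^ m * fact 0 / fact (m + 0) * (1 / 1) ^ Suc 0) + ennreal b * ennreal (pi ^ m * fact 1 / fact (m + 1) * (1 / 1) ^ Suc 1)"
    by (subst nn_integral_add, measurable, subst (1 2) nn_integral_cmult, measurable)
       (simp only: nn_integral_CL_inverse_power[OF c1])
  also have "\<dots> = ennreal (a * (pi ^ m / fact m) + b * (pi ^ m / fact (Suc m)))"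
    by (subst gen) simp_all
  also have "a * (pi ^ m / fact m) + b * (pi ^ m / fact (Suc m)) = ginibre_tail (Suc m) x"
  proof -
    have "(1 / pi) ^ m * pi ^ m = 1" by (simp add: power_mult_distrib[symmetric])
    moreover have "a * (pi ^ m / fact m) = (1 / pi) ^ m * pi ^ m * (exp (- x) * fact (m - 1) * (P / fact m))"
      "b * (pi ^ m / fact (Suc m)) = (1 / pi) ^ m * pi ^ m * (exp (- x) * fact (m - 1) * (x * Q / fact (Suc m)))"
      unfolding a_def b_def by (simp_all only: times_divide_eq_right times_divide_eq_left mult_ac)
    ultimately have "a * (pi ^ m / fact m) + b * (pi ^ m / fact (Suc m)) = exp (- x) * fact (m - 1) * (P / fact m + x * Q / fact (Suc m))"
      by (simp only: mult_1_left distrib_left)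
    also have "\<dots> = ginibre_tail (Suc m) x" unfolding P_def Q_def by (rule ginibre_tail_Suc[OF m])
    finally show ?thesis .
  qed
  finally show ?thesis .
qed

interpretation gauss_sf: sigma_finite_measure "gauss_vec I" for I :: "'i set"
  by (intro prob_space_imp_sigma_finite prob_space_gauss_vec)

text \<open>
  Substituting \<open>b = (z - D) u\<close> turns the Gaussian density of \<open>b\<close> into
  \<open>exp (- \<parallel>(z - D) u\<parallel>\<^sup>2) * \<bar>det (z - D)\<bar>\<^sup>2\<close> times Lebesgue measure in \<open>u\<close>. By Fubini the average over \<open>D\<close>
  can then be taken first, and it is \<^const>\<open>ginibre_moment\<close>. The function \<open>f\<close> is kept abstract: in
  the application it is defined through cofactors, and only its values in terms of \<open>u\<close> matter.
  The case \<open>m = 0\<close> is separate because the moment formula has a factor \<open>fact (m - 1)\<close>.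
\<close>

lemma nn_integral_kernel_direction:
  fixes z :: complex and f :: "(nat \<times> nat \<Rightarrow> complex) \<times> (nat \<Rightarrow> complex) \<Rightarrow> ennreal"
  assumes f: "f \<in> borel_measurable (gauss_mat m \<Otimes>\<^sub>M gauss_vec {..<m})"
    and reg: "AE D in gauss_mat m. det (shifted m z D) \<noteq> 0"
    and eq: "\<And>D u. det (shifted m z D) \<noteq> 0 \<Longrightarrow> D \<in> space (gauss_mat m) \<Longrightarrow> u \<in> space (CL m) \<Longrightarrow>
      f (D, affine_map m (\<lambda>i j. shifted m z D $$ (i, j)) (\<lambda>_. 0) u) = ennreal (exp (- ((cmod z)\<^sup>2 / (1 + sq_norm m u))))"
  shows "(\<integral>\<^sup>+D. \<integral>\<^sup>+b. f (D, b) \<partial>gauss_vec {..<m} \<partial>gauss_mat m) = ennreal (ginibre_tail (Suc m) ((cmod z)\<^sup>2))"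
proof (cases "m = 0")
  case True
  have "f (D, b) = ennreal (exp (- (cmod z)\<^sup>2))" if "D \<in> space (gauss_mat m)" "b \<in> space (gauss_vec {..<m})" for D b
  proof -
    have "b \<in> space (CL m)" using that by (simp add: space_PiM)
    moreover have "affine_map m (\<lambda>i j. shifted m z D $$ (i, j)) (\<lambda>_. 0) b = b"
      using that True by (auto simp: affine_map_def space_PiM)
    moreover have "det (shifted m z D) \<noteq> 0" using True by (simp add: shifted_def)
    ultimately show ?thesis using eq[of D b] that True by (simp add: sq_norm_def)
  qed
  then have "(\<integral>\<^sup>+D. \<integral>\<^sup>+b. f (D, b) \<partial>gauss_vec {..<m} \<partial>gauss_mat m) = (\<integral>\<^sup>+D. \<integral>\<^sup>+b. ennreal (exp (- (cmod z)\<^sup>2)) \<partial>gauss_vec {..<m} \<partial>gauss_mat m)"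
    by (intro nn_integral_cong)
  then show ?thesis
    using True prob_space.emeasure_space_1[OF prob_space_gauss_vec[of "{} :: nat set"]]
      prob_space.emeasure_space_1[OF prob_space_gauss_vec[of "{} :: (nat \<times> nat) set"]] by (simp add: ginibre_tail_def)
next
  case False
  then have m: "m > 0" by simp
  let ?X = "\<lambda>D i j. shifted m z D $$ (i, j)"
  let ?x = "(cmod z)\<^sup>2"
  define G where "G D u = ennreal ((cmod (det (shifted m z D)))\<^sup>2) * (ennreal ((1 / pi) ^ m * exp (- sq_norm m (\<lambda>i. \<Sum>j<m. ?X D i j * u j))) * ennreal (exp (- (?x / (1 + sq_norm m u)))))" for D u
  have shm: "(\<lambda>D. ?X D i j) \<in> borel_measurable (gauss_mat m)" if "i < m" "j < m" for i j
  proof -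
    have "?X D i j = (if i = j then z else 0) - D (i, j)" for D
      using that by (simp add: shifted_def)
    then show ?thesis using that
      by (simp only:) (intro borel_measurable_diff borel_measurable_const gauss_component_measurable, auto)
  qed
  have Gm: "(\<lambda>(D, u). G D u) \<in> borel_measurable (gauss_mat m \<Otimes>\<^sub>M CL m)"
  proof -
    have 1: "(\<lambda>p. det (shifted m z (fst p))) \<in> borel_measurable (gauss_mat m \<Otimes>\<^sub>M CL m)"
      by (rule measurable_compose[OF measurable_fst det_shifted_measurable])
    have 2: "(\<lambda>p. sq_norm m (\<lambda>i. \<Sum>j<m. ?X (fst p) i j * (snd p) j)) \<in> borel_measurable (gauss_mat m \<Otimes>\<^sub>M CL m)"
      unfolding sq_norm_def
    proof (rule borel_measurable_sum, rule borel_measurable_power, rule measurable_compose[OF _ borel_measurable_norm], rule borel_measurable_sum, rule borel_measurable_times)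
      fix i j assume "i \<in> {..<m}" "j \<in> {..<m}"
      then show "(\<lambda>p. ?X (fst p) i j) \<in> borel_measurable (gauss_mat m \<Otimes>\<^sub>M CL m)"
        "(\<lambda>p. (snd p) j) \<in> borel_measurable (gauss_mat m \<Otimes>\<^sub>M CL m)"
        using measurable_compose[OF measurable_fst shm[of i j]] measurable_compose[OF measurable_snd CL_component_measurable[of j]] by auto
    qed
    have 3: "(\<lambda>p. sq_norm m (snd p)) \<in> borel_measurable (gauss_mat m \<Otimes>\<^sub>M CL m)"
      by (rule measurable_compose[OF measurable_snd sq_norm_measurable])
    note [measurable] = 1 2 3
    show ?thesis unfolding G_def split_beta by measurable
  qed
  have inner: "(\<integral>\<^sup>+b. f (D, b) \<partial>gauss_vec {..<m}) = (\<integral>\<^sup>+u. G D u \<partial>CL m)"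
    if D: "D \<in> space (gauss_mat m)" and d: "det (shifted m z D) \<noteq> 0" for D
  proof -
    have "(\<lambda>b. f (D, b)) \<in> borel_measurable (gauss_vec {..<m})" by (rule measurable_Pair2[OF f D])
    then have [measurable]: "(\<lambda>b. f (D, b)) \<in> borel_measurable (CL m)" by (simp only: measurable_cong_sets[OF sets_gauss_vec_CL refl])
    have sh: "mat m m (\<lambda>(i, j). ?X D i j) = shifted m z D" by (intro eq_matI) auto
    let ?g = "\<lambda>b. ennreal ((1 / pi) ^ m * exp (- sq_norm m b)) * f (D, b)"
    have "(\<integral>\<^sup>+b. f (D, b) \<partial>gauss_vec {..<m}) = (\<integral>\<^sup>+b. ?g b \<partial>CL m)"
      by (rule nn_integral_gauss_vec) measurable
    also have "\<dots> = ennreal ((cmod (det (shifted m z D)))\<^sup>2) * (\<integral>\<^sup>+u. ?g (affine_map m (?X D) (\<lambda>_. 0) u) \<partial>CL m)"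
      using nn_integral_affine_map[of ?g m "?X D" "\<lambda>_. 0"] d unfolding sh by simp
    also have "\<dots> = (\<integral>\<^sup>+u. ennreal ((cmod (det (shifted m z D)))\<^sup>2) * ?g (affine_map m (?X D) (\<lambda>_. 0) u) \<partial>CL m)"
      by (rule nn_integral_cmult[symmetric]) measurable
    also have "\<dots> = (\<integral>\<^sup>+u. G D u \<partial>CL m)"
    proof (intro nn_integral_cong)
      fix u assume u: "u \<in> space (CL m)"
      have "sq_norm m (affine_map m (?X D) (\<lambda>_. 0) u) = sq_norm m (\<lambda>i. \<Sum>j<m. ?X D i j * u j)"
        unfolding sq_norm_def by (intro sum.cong refl) (simp add: affine_map_def)
      then show "ennreal ((cmod (det (shifted m z D)))\<^sup>2) * ?g (affine_map m (?X D) (\<lambda>_. 0) u) = G D u"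
        unfolding G_def by (simp only: eq[OF d D u])
    qed
    finally show ?thesis .
  qed
  have "(\<integral>\<^sup>+D. \<integral>\<^sup>+b. f (D, b) \<partial>gauss_vec {..<m} \<partial>gauss_mat m) = (\<integral>\<^sup>+D. \<integral>\<^sup>+u. G D u \<partial>CL m \<partial>gauss_mat m)"
    using reg AE_space by (intro nn_integral_cong_AE, eventually_elim) (rule inner)
  also have "\<dots> = (\<integral>\<^sup>+u. \<integral>\<^sup>+D. G D u \<partial>gauss_mat m \<partial>CL m)"
    by (rule pair_sigma_finite.Fubini'[OF _ Gm, symmetric]) (simp add: pair_sigma_finite_def CL_sf.sigma_finite_measure_axioms gauss_sf.sigma_finite_measure_axioms)
  also have "\<dots> = (\<integral>\<^sup>+u. ennreal (exp (- (?x / (1 + sq_norm m u))) * (1 / pi) ^ m * ginibre_moment m ?x (sq_norm m u)) \<partial>CL m)"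
  proof (intro nn_integral_cong)
    fix u
    let ?h = "\<lambda>D. ennreal (exp (- sq_norm m (\<lambda>i. \<Sum>j<m. ?X D i j * u j)) * (cmod (det (shifted m z D)))\<^sup>2)"
    have hm: "?h \<in> borel_measurable (gauss_mat m)"
    proof -
      have "(\<lambda>D. sq_norm m (\<lambda>i. \<Sum>j<m. ?X D i j * u j)) \<in> borel_measurable (gauss_mat m)"
        unfolding sq_norm_def
        by (rule borel_measurable_sum, rule borel_measurable_power, rule measurable_compose[OF _ borel_measurable_norm], rule borel_measurable_sum, rule borel_measurable_times)
           (auto intro: shm)
      note [measurable] = this det_shifted_measurable[of m z]
      show ?thesis by measurable
    qed
    have c: "0 \<le> exp (- (?x / (1 + sq_norm m u))) * (1 / pi) ^ m" by simp
    have "(\<integral>\<^sup>+D. G D u \<partial>gauss_mat m) = (\<integral>\<^sup>+D. ennreal (exp (- (?x / (1 + sq_norm m u))) * (1 / pi) ^ m) * ?h D \<partial>gauss_mat m)"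
      unfolding G_def by (intro nn_integral_cong) (simp add: ennreal_mult[symmetric] mult_ac)
    also have "\<dots> = ennreal (exp (- (?x / (1 + sq_norm m u))) * (1 / pi) ^ m) * ennreal (ginibre_moment m ?x (sq_norm m u))"
      by (subst nn_integral_cmult[OF hm]) (simp only: gauss_det_moment[OF m])
    also have "\<dots> = ennreal (exp (- (?x / (1 + sq_norm m u))) * (1 / pi) ^ m * ginibre_moment m ?x (sq_norm m u))"
      by (rule ennreal_mult'[OF c, symmetric])
    finally show "(\<integral>\<^sup>+D. G D u \<partial>gauss_mat m) = ennreal (exp (- (?x / (1 + sq_norm m u))) * (1 / pi) ^ m * ginibre_moment m ?x (sq_norm m u))" .
  qed
  also have "\<dots> = ennreal (ginibre_tail (Suc m) ?x)"
    by (rule nn_integral_ginibre_moment[OF m]) simp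
  finally show ?thesis .
qed

section \<open>The mean of a diagonal entry of the resolvent\<close>

text \<open>
  A matrix of size \<open>Suc m\<close> put together from its \<open>i\<close>-th row \<open>r\<close>, the remaining part \<open>b\<close> of its
  \<open>i\<close>-th column, and the complementary minor \<open>D\<close>. Conditioning on everything but row \<open>i\<close> thus becomes
  Fubini's theorem for a product of three measures.
\<close>

definition assemble :: "nat \<Rightarrow> nat \<Rightarrow> ((nat \<times> nat \<Rightarrow> complex) \<times> (nat \<Rightarrow> complex)) \<times> (nat \<Rightarrow> complex) \<Rightarrow> nat \<times> nat \<Rightarrow> complex" where
  "assemble m i = (\<lambda>((D, b), r). \<lambda>p\<in>sqr (Suc m). if fst p = i then r (snd p)
      else if snd p = i then b (delete_index i (fst p))
      else D (delete_index i (fst p), delete_index i (snd p)))"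

abbreviation split_law :: "nat \<Rightarrow> (((nat \<times> nat \<Rightarrow> complex) \<times> (nat \<Rightarrow> complex)) \<times> (nat \<Rightarrow> complex)) measure" where
  "split_law m \<equiv> (gauss_mat m \<Otimes>\<^sub>M gauss_vec {..<m}) \<Otimes>\<^sub>M gauss_vec {..<Suc m}"

lemma delete_index_less: "i < Suc m \<Longrightarrow> k < Suc m \<Longrightarrow> k \<noteq> i \<Longrightarrow> delete_index i k < m"
  by (auto simp: delete_index_def)

lemma insert_index_less: "k < m \<Longrightarrow> insert_index i k < Suc m"
  by (auto simp: insert_index_def)

lemma assemble_measurable:
  assumes i: "i < Suc m"
  shows "assemble m i \<in> split_law m \<rightarrow>\<^sub>M gauss_mat (Suc m)"
  unfolding assemble_def split_beta
proof (rule lambda_gauss_measurable)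
  fix p assume p: "p \<in> sqr (Suc m)"
  consider "fst p = i" | "fst p \<noteq> i" "snd p = i" | "fst p \<noteq> i" "snd p \<noteq> i" by blast
  then show "(\<lambda>x. if fst p = i then snd x (snd p) else if snd p = i then snd (fst x) (delete_index i (fst p))
      else fst (fst x) (delete_index i (fst p), delete_index i (snd p))) \<in> borel_measurable (split_law m)"
  proof cases
    case 1
    have "(\<lambda>x. snd x (snd p)) \<in> borel_measurable (split_law m)"
      by (rule measurable_compose[OF measurable_snd gauss_component_measurable]) (use p in auto)
    then show ?thesis using 1 by simp
  next
    case 2
    have "(\<lambda>x. snd (fst x) (delete_index i (fst p))) \<in> borel_measurable (split_law m)"
      by (rule measurable_compose[OF measurable_compose[OF measurable_fst measurable_snd] gauss_component_measurable])
         (use p i 2 in \<open>auto intro: delete_index_less\<close>)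
    then show ?thesis using 2 by simp
  next
    case 3
    have "(\<lambda>x. fst (fst x) (delete_index i (fst p), delete_index i (snd p))) \<in> borel_measurable (split_law m)"
      by (rule measurable_compose[OF measurable_compose[OF measurable_fst measurable_fst] gauss_component_measurable])
         (use p i 3 in \<open>auto intro: delete_index_less\<close>)
    then show ?thesis using 3 by simp
  qed
qed

lemma prod_insert_index:
  fixes g :: "nat \<Rightarrow> 'a :: comm_monoid_mult"
  assumes i: "i < Suc m"
  shows "(\<Prod>j<Suc m. g j) = g i * (\<Prod>k<m. g (insert_index i k))"
proof -
  have "insert_index i ` {..<m} = {..<Suc m} - {i}"
    using insert_index_image[OF i] by (simp add: atLeast0LessThan)
  then have "(\<Prod>k<m. g (insert_index i k)) = (\<Prod>j\<in>{..<Suc m} - {i}. g j)"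
    using prod.reindex[of "insert_index i" "{..<m}" g] insert_index_inj_on by (metis comp_apply prod.cong)
  then show ?thesis using i by (subst prod.remove[of _ i]) (simp_all del: prod.lessThan_Suc)
qed

lemma distr_assemble:
  assumes i: "i < Suc m"
  shows "distr (split_law m) (gauss_mat (Suc m)) (assemble m i) = gauss_mat (Suc m)"
proof (rule gauss_vec.PiM_eqI)
  let ?n = "Suc m"
  let ?ins = "insert_index i"
  fix A assume A: "\<And>p. p \<in> sqr ?n \<Longrightarrow> A p \<in> sets cgauss"
  have AS: "Pi\<^sub>E (sqr ?n) A \<in> sets (gauss_mat ?n)" using A by (intro sets_PiM_I_finite) auto
  let ?R = "Pi\<^sub>E {..<?n} (\<lambda>j. A (i, j))"
  let ?D = "Pi\<^sub>E (sqr m) (\<lambda>p. A (?ins (fst p), ?ins (snd p)))"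
  let ?B = "Pi\<^sub>E {..<m} (\<lambda>k. A (?ins k, i))"
  have sR: "?R \<in> sets (gauss_vec {..<?n})" using A i by (intro sets_PiM_I_finite) auto
  have sD: "?D \<in> sets (gauss_mat m)" by (intro sets_PiM_I_finite) (auto intro!: A insert_index_less simp del: sets_cgauss)
  have sB: "?B \<in> sets (gauss_vec {..<m})" using A i by (intro sets_PiM_I_finite) (auto intro: insert_index_less)
  have pre: "assemble m i -` Pi\<^sub>E (sqr ?n) A \<inter> space (split_law m) = (?D \<times> ?B) \<times> ?R"
  proof (rule Set.set_eqI, rule iffI)
    fix x assume x: "x \<in> assemble m i -` Pi\<^sub>E (sqr ?n) A \<inter> space (split_law m)"
    obtain D b r where xe: "x = ((D, b), r)" by (metis prod.exhaust)
    have mem: "(if k = i then r l else if l = i then b (delete_index i k) else D (delete_index i k, delete_index i l)) \<in> A (k, l)"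
      if "k < ?n" "l < ?n" for k l
      using x that PiE_mem[of "assemble m i x" "sqr ?n" A "(k, l)"] by (auto simp: xe assemble_def)
    have ext: "D \<in> extensional (sqr m)" "b \<in> extensional {..<m}" "r \<in> extensional {..<?n}"
      using x by (auto simp: xe space_pair_measure space_PiM PiE_def)
    have "r l \<in> A (i, l)" if "l < ?n" for l using mem[of i l] that i by simp
    moreover have "b k \<in> A (?ins k, i)" if "k < m" for k
      using mem[of "?ins k" i] that i insert_index_less[of k m i] by simp
    moreover have "D (k, l) \<in> A (?ins k, ?ins l)" if "k < m" "l < m" for k l
      using mem[of "?ins k" "?ins l"] that insert_index_less[of _ m i] by simp
    ultimately show "x \<in> (?D \<times> ?B) \<times> ?R" using ext by (auto simp: xe PiE_def)
  next
    fix x assume x: "x \<in> (?D \<times> ?B) \<times> ?R"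
    then obtain D b r where xe: "x = ((D, b), r)" and D: "D \<in> ?D" and b: "b \<in> ?B" and r: "r \<in> ?R" by auto
    have "assemble m i x p \<in> A p" if p: "p \<in> sqr ?n" for p
    proof -
      consider "fst p = i" | "fst p \<noteq> i" "snd p = i" | "fst p \<noteq> i" "snd p \<noteq> i" by blast
      then show ?thesis
      proof cases
        case 1
        then show ?thesis using p r by (auto simp: xe assemble_def PiE_def Pi_def)
      next
        case 2
        then have "b (delete_index i (fst p)) \<in> A (?ins (delete_index i (fst p)), i)"
          using p i b by (auto simp: PiE_def Pi_def delete_index_less)
        then show ?thesis using 2 p by (auto simp: xe assemble_def insert_delete_index)
      next
        case 3
        then have "D (delete_index i (fst p), delete_index i (snd p)) \<in> A (?ins (delete_index i (fst p)), ?ins (delete_index i (snd p)))"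
          using p i D by (auto simp: PiE_def Pi_def delete_index_less)
        then show ?thesis using 3 p by (auto simp: xe assemble_def insert_delete_index)
      qed
    qed
    moreover have "assemble m i x \<in> extensional (sqr ?n)" by (simp add: xe assemble_def)
    moreover have "x \<in> space (split_law m)" using D b r by (auto simp: xe space_pair_measure space_PiM PiE_def)
    ultimately show "x \<in> assemble m i -` Pi\<^sub>E (sqr ?n) A \<inter> space (split_law m)" by (auto simp: PiE_def)
  qed
  have "emeasure (distr (split_law m) (gauss_mat ?n) (assemble m i)) (Pi\<^sub>E (sqr ?n) A) = emeasure (split_law m) ((?D \<times> ?B) \<times> ?R)"
    by (subst emeasure_distr[OF assemble_measurable[OF i] AS]) (simp only: pre)
  also have "\<dots> = emeasure (gauss_mat m) ?D * emeasure (gauss_vec {..<m}) ?B * emeasure (gauss_vec {..<?n}) ?R"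
    using sD sB sR by (simp add: gauss_sf.emeasure_pair_measure_Times)
  also have "emeasure (gauss_mat m) ?D = (\<Prod>p\<in>sqr m. emeasure cgauss (A (?ins (fst p), ?ins (snd p))))"
    by (intro gauss_vec.emeasure_PiM) (auto intro!: A insert_index_less simp del: sets_cgauss)
  also have "\<dots> = (\<Prod>k<m. \<Prod>l<m. emeasure cgauss (A (?ins k, ?ins l)))"
    unfolding prod.cartesian_product by (intro prod.cong) auto
  also have "emeasure (gauss_vec {..<m}) ?B = (\<Prod>k<m. emeasure cgauss (A (?ins k, i)))"
    using A i by (intro gauss_vec.emeasure_PiM) (auto intro: insert_index_less)
  also have "emeasure (gauss_vec {..<?n}) ?R = (\<Prod>l<?n. emeasure cgauss (A (i, l)))"
    using A i by (intro gauss_vec.emeasure_PiM) auto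
  also have "(\<Prod>k<m. \<Prod>l<m. emeasure cgauss (A (?ins k, ?ins l))) * (\<Prod>k<m. emeasure cgauss (A (?ins k, i))) * (\<Prod>l<?n. emeasure cgauss (A (i, l)))
     = (\<Prod>l<?n. emeasure cgauss (A (i, l))) * (\<Prod>k<m. \<Prod>l<?n. emeasure cgauss (A (?ins k, l)))"
    by (simp only: prod_insert_index[OF i, of "\<lambda>l. emeasure cgauss (A (_, l))"] prod.distrib mult_ac)
  also have "\<dots> = (\<Prod>k<?n. \<Prod>l<?n. emeasure cgauss (A (k, l)))"
    by (rule prod_insert_index[OF i, symmetric])
  also have "\<dots> = (\<Prod>p\<in>sqr ?n. emeasure cgauss (A p))"
    unfolding prod.cartesian_product by (intro prod.cong) auto
  finally show "emeasure (distr (split_law m) (gauss_mat ?n) (assemble m i)) (Pi\<^sub>E (sqr ?n) A) = (\<Prod>p\<in>sqr ?n. emeasure cgauss (A p))" .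
qed auto

lemma assemble_apply:
  "k < Suc m \<Longrightarrow> l < Suc m \<Longrightarrow> assemble m i ((D, b), r) (k, l) =
    (if k = i then r l else if l = i then b (delete_index i k) else D (delete_index i k, delete_index i l))"
  by (simp add: assemble_def)

text \<open>
  A cofactor of \<open>z - G\<close>. It takes all of \<open>G\<close> as its argument, but row \<open>i\<close> does not enter.
\<close>

definition row_cofactor :: "nat \<Rightarrow> nat \<Rightarrow> complex \<Rightarrow> (nat \<times> nat \<Rightarrow> complex) \<Rightarrow> nat \<Rightarrow> complex" where
  "row_cofactor m i z G j = cofactor (shifted (Suc m) z G) i j"

lemma mat_delete_shifted:
  "mat_delete (shifted (Suc m) z G) i j =
     mat m m (\<lambda>(k, l). (if insert_index i k = insert_index j l then z else 0) - G (insert_index i k, insert_index j l))"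
proof (rule eq_matI)
  fix k l assume "k < dim_row (mat m m (\<lambda>(k, l). (if insert_index i k = insert_index j l then z else 0) - G (insert_index i k, insert_index j l)))"
    "l < dim_col (mat m m (\<lambda>(k, l). (if insert_index i k = insert_index j l then z else 0) - G (insert_index i k, insert_index j l)))"
  then have kl: "k < m" "l < m" by auto
  then show "mat_delete (shifted (Suc m) z G) i j $$ (k, l) =
    mat m m (\<lambda>(k, l). (if insert_index i k = insert_index j l then z else 0) - G (insert_index i k, insert_index j l)) $$ (k, l)"
    using insert_index_less[OF kl(1), of i] insert_index_less[OF kl(2), of j]
    by (simp add: mat_delete_def shifted_def insert_index_def)
qed (auto simp: mat_delete_def)

lemma row_cofactor_measurable:
  "j < Suc m \<Longrightarrow> i < Suc m \<Longrightarrow> (\<lambda>G. row_cofactor m i z G j) \<in> borel_measurable (gauss_mat (Suc m))"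
  unfolding row_cofactor_def cofactor_def mat_delete_shifted
  by (intro borel_measurable_times borel_measurable_const det_measurable borel_measurable_diff gauss_component_measurable)
     (auto intro: insert_index_less)

lemma row_cofactor_cong:
  assumes "\<And>k l. k < Suc m \<Longrightarrow> l < Suc m \<Longrightarrow> k \<noteq> i \<Longrightarrow> G (k, l) = G' (k, l)"
  shows "row_cofactor m i z G j = row_cofactor m i z G' j"
proof -
  have "mat_delete (shifted (Suc m) z G) i j = mat_delete (shifted (Suc m) z G') i j"
    unfolding mat_delete_shifted
    by (intro eq_matI) (auto simp: assms insert_index_less)
  then show ?thesis by (simp add: row_cofactor_def cofactor_def)
qed

lemma row_cofactor_diag:
  assumes "i < Suc m"
  shows "row_cofactor m i z (assemble m i ((D, b), r)) i = det (shifted m z D)"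
proof -
  have "mat_delete (shifted (Suc m) z (assemble m i ((D, b), r))) i i = shifted m z D"
    unfolding mat_delete_shifted
    by (intro eq_matI) (auto simp: shifted_def assemble_apply insert_index_less inj_eq[OF insert_index_inj_on[of i UNIV]])
  then show ?thesis by (simp add: row_cofactor_def cofactor_def)
qed

lemma det_shifted_expand:
  assumes "i < Suc m"
  shows "det (shifted (Suc m) z G) = z * row_cofactor m i z G i - (\<Sum>j<Suc m. G (i, j) * row_cofactor m i z G j)"
proof -
  have "det (shifted (Suc m) z G) = (\<Sum>j<Suc m. shifted (Suc m) z G $$ (i, j) * row_cofactor m i z G j)"
    unfolding row_cofactor_def by (rule laplace_expansion_row[OF shifted_carrier assms])
  also have "\<dots> = (\<Sum>j<Suc m. (if j = i then z * row_cofactor m i z G i else 0) - G (i, j) * row_cofactor m i z G j)"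
    using assms by (intro sum.cong refl) (auto simp: shifted_def algebra_simps)
  also have "\<dots> = z * row_cofactor m i z G i - (\<Sum>j<Suc m. G (i, j) * row_cofactor m i z G j)"
    using assms by (simp only: sum_subtractf) simp
  finally show ?thesis .
qed

text \<open>
  An off-diagonal entry of the product of a matrix with its adjugate.
\<close>

lemma row_cofactor_orthogonal:
  assumes "i < Suc m" "k < Suc m" "k \<noteq> i"
  shows "(\<Sum>j<Suc m. shifted (Suc m) z G $$ (k, j) * row_cofactor m i z G j) = 0"
proof -
  let ?A = "shifted (Suc m) z G"
  have "(?A * adj_mat ?A) $$ (k, i) = (det ?A \<cdot>\<^sub>m 1\<^sub>m (Suc m)) $$ (k, i)"
    by (simp only: adj_mat(2)[OF shifted_carrier])
  moreover have "(?A * adj_mat ?A) $$ (k, i) = (\<Sum>j<Suc m. ?A $$ (k, j) * row_cofactor m i z G j)"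
    using assms by (simp add: adj_mat_def scalar_prod_def atLeast0LessThan row_cofactor_def del: sum.lessThan_Suc)
  ultimately show ?thesis using assms by simp
qed

text \<open>
  The cofactor vector of row \<open>i\<close> is orthogonal to all other rows. With its \<open>i\<close>-th coordinate
  scaled to \<open>1\<close>, its remaining coordinates \<open>u\<close> solve \<open>(z - D) u = b\<close>, hence the shape of the
  substitution for \<open>b\<close>.
\<close>

lemma sq_norm_row_cofactor:
  fixes u :: "nat \<Rightarrow> complex"
  assumes i: "i < Suc m" and d: "det (shifted m z D) \<noteq> 0"
  defines "b \<equiv> affine_map m (\<lambda>k l. shifted m z D $$ (k, l)) (\<lambda>_. 0) u"
  shows "sq_norm (Suc m) (row_cofactor m i z (assemble m i ((D, b), r))) = (cmod (det (shifted m z D)))\<^sup>2 * (1 + sq_norm m u)"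
proof -
  let ?G = "assemble m i ((D, b), r)"
  let ?c = "row_cofactor m i z ?G"
  let ?X = "shifted m z D"
  let ?ins = "insert_index i"
  have ci: "?c i = det ?X" by (rule row_cofactor_diag[OF i])
  have sum_ins: "(\<Sum>j<Suc m. g j) = g i + (\<Sum>k<m. g (?ins k))" for g :: "nat \<Rightarrow> 'x :: comm_monoid_add"
  proof -
    have "?ins ` {..<m} = {..<Suc m} - {i}"
      using insert_index_image[OF i] by (simp add: atLeast0LessThan)
    then have "(\<Sum>k<m. g (?ins k)) = (\<Sum>j\<in>{..<Suc m} - {i}. g j)"
      using sum.reindex[of ?ins "{..<m}" g] insert_index_inj_on by (metis comp_apply sum.cong)
    then show ?thesis using i by (subst sum.remove[of _ i]) (simp_all del: sum.lessThan_Suc)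
  qed
  \<comment> \<open>the deviation from the claimed solution lies in the kernel of the regular matrix \<open>?X\<close>\<close>
  define w where "w l = ?c (?ins l) - u l * det ?X" for l
  have Xw: "(\<Sum>l<m. ?X $$ (k, l) * w l) = 0" if k: "k < m" for k
  proof -
    have "0 = (\<Sum>j<Suc m. shifted (Suc m) z ?G $$ (?ins k, j) * ?c j)"
      by (rule row_cofactor_orthogonal[OF i, symmetric]) (use k in \<open>auto intro: insert_index_less\<close>)
    also have "\<dots> = shifted (Suc m) z ?G $$ (?ins k, i) * ?c i + (\<Sum>l<m. shifted (Suc m) z ?G $$ (?ins k, ?ins l) * ?c (?ins l))"
      by (rule sum_ins)
    also have "shifted (Suc m) z ?G $$ (?ins k, i) = - b k"
      using k i insert_index_less[OF k, of i] by (simp add: shifted_def assemble_apply)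
    also have "b k = (\<Sum>l<m. ?X $$ (k, l) * u l)"
      using k by (simp add: b_def affine_map_def)
    also have "(\<Sum>l<m. shifted (Suc m) z ?G $$ (?ins k, ?ins l) * ?c (?ins l)) = (\<Sum>l<m. ?X $$ (k, l) * ?c (?ins l))"
      using k insert_index_less[of _ m i]
      by (intro sum.cong refl) (simp add: shifted_def assemble_apply inj_eq[OF insert_index_inj_on[of i UNIV]])
    finally show ?thesis
      by (simp add: w_def right_diff_distrib sum_subtractf ci sum_distrib_right mult.assoc)
  qed
  have w0: "w l = 0" if l: "l < m" for l
  proof (rule ccontr)
    assume "w l \<noteq> 0"
    define v where "v = vec m w"
    have "v \<noteq> 0\<^sub>v m" using \<open>w l \<noteq> 0\<close> l by (metis index_vec index_zero_vec(1) v_def)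
    moreover have "?X *\<^sub>v v = 0\<^sub>v m"
      using Xw by (intro eq_vecI) (simp_all add: v_def scalar_prod_def atLeast0LessThan)
    moreover have "v \<in> carrier_vec m" by (simp add: v_def)
    ultimately have "det ?X = 0" using det_0_iff_vec_prod_zero_field[OF shifted_carrier] by blast
    then show False using d by simp
  qed
  have "sq_norm (Suc m) ?c = (cmod (?c i))\<^sup>2 + (\<Sum>l<m. (cmod (?c (?ins l)))\<^sup>2)"
    unfolding sq_norm_def by (rule sum_ins)
  also have "(\<Sum>l<m. (cmod (?c (?ins l)))\<^sup>2) = (\<Sum>l<m. (cmod (u l))\<^sup>2 * (cmod (det ?X))\<^sup>2)"
    using w0 by (intro sum.cong refl) (simp add: w_def norm_mult power_mult_distrib)
  finally show ?thesis
    by (simp add: ci sq_norm_def sum_distrib_right[symmetric] algebra_simps)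
qed

text \<open>
  Expand \<open>det (z - G)\<close> along row \<open>i\<close>. Given the other rows, the entry is
  \<open>z c\<^sub>i / (z c\<^sub>i - \<Sum>j. g\<^sub>j c\<^sub>j)\<close> with a Gaussian row \<open>g\<close> and a fixed cofactor vector \<open>c\<close>, whose mean is
  \<open>1 - exp (- \<bar>z\<bar>\<^sup>2 \<bar>c\<^sub>i\<bar>\<^sup>2 / \<parallel>c\<parallel>\<^sup>2)\<close>. This exponential depends on the direction of \<open>c\<close> only, and its mean was
  computed above.
\<close>

proposition resolvent_diagonal_mean:
  fixes z :: complex
  assumes i: "i < Suc m" and reg: "AE D in gauss_mat m. det (shifted m z D) \<noteq> 0"
  defines "F \<equiv> \<lambda>G. z * det (mat_delete (shifted (Suc m) z G) i i) / det (shifted (Suc m) z G)"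
  shows "integrable (gauss_mat (Suc m)) F"
    and "(\<integral>G. F G \<partial>gauss_mat (Suc m)) = of_real (1 - ginibre_tail (Suc m) ((cmod z)\<^sup>2))"
    and "(\<integral>\<^sup>+G. cmod (F G) \<partial>gauss_mat (Suc m)) \<le> ennreal (3 * cmod z)"
proof -
  let ?n = "Suc m"
  let ?M1 = "gauss_mat m \<Otimes>\<^sub>M gauss_vec {..<m}"
  interpret P1: pair_prob_space "gauss_mat m" "gauss_vec {..<m}"
    by (simp add: pair_prob_space_def pair_sigma_finite_def prob_space_gauss_vec gauss_sf.sigma_finite_measure_axioms)
  interpret P2: pair_prob_space ?M1 "gauss_vec {..<?n}"
    by (simp add: pair_prob_space_def pair_sigma_finite_def prob_space_gauss_vec gauss_sf.sigma_finite_measure_axioms P1.prob_space_axioms P1.sigma_finite_measure_axioms)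
  \<comment> \<open>row \<open>i\<close> is filled with zeros, which do not affect the cofactors\<close>
  define c where "c Db = row_cofactor m i z (assemble m i (Db, \<lambda>_\<in>{..<?n}. 0))" for Db
  have c: "row_cofactor m i z (assemble m i (Db, r)) j = c Db j" for Db r j
    unfolding c_def by (rule row_cofactor_cong) (cases Db, simp add: assemble_apply)
  have Fm: "F \<in> borel_measurable (gauss_mat ?n)"
    unfolding F_def mat_delete_shifted
    by (intro borel_measurable_divide borel_measurable_times borel_measurable_const det_measurable borel_measurable_diff
      gauss_component_measurable det_shifted_measurable) (use i in \<open>auto intro: insert_index_less\<close>)
  have FA: "F (assemble m i (Db, r)) = z * c Db i / (z * c Db i - (\<Sum>j<?n. r j * c Db j))" for Db r
  proof -
    have "det (mat_delete (shifted ?n z (assemble m i (Db, r))) i i) = row_cofactor m i z (assemble m i (Db, r)) i"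
      by (simp add: row_cofactor_def cofactor_def)
    moreover have "(\<Sum>j<?n. assemble m i (Db, r) (i, j) * c Db j) = (\<Sum>j<?n. r j * c Db j)"
      using i by (intro sum.cong refl) (cases Db, simp add: assemble_apply)
    ultimately show ?thesis unfolding F_def det_shifted_expand[OF i] c by (simp only:)
  qed
  let ?H = "\<lambda>(Db, r). F (assemble m i (Db, r))"
  have Heq: "?H = (\<lambda>x. F (assemble m i x))" by (auto simp: fun_eq_iff)
  have Hm: "?H \<in> borel_measurable (split_law m)"
    using measurable_compose[OF assemble_measurable[OF i] Fm] by (simp add: split_beta)
  have cm: "(\<lambda>Db. c Db j) \<in> borel_measurable ?M1" if "j < ?n" for j
  proof -
    have "(\<lambda>Db. (Db, \<lambda>_\<in>{..<?n}. 0)) \<in> ?M1 \<rightarrow>\<^sub>M split_law m"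
      by (intro measurable_Pair measurable_ident_sets[OF refl] measurable_const) (auto simp: space_PiM)
    from measurable_compose[OF measurable_compose[OF this assemble_measurable[OF i]] row_cofactor_measurable[OF that i]]
    show ?thesis by (simp add: c_def)
  qed
  have bound: "(\<integral>\<^sup>+x. cmod (?H x) \<partial>split_law m) \<le> ennreal (3 * cmod z)"
  proof -
    have m: "(\<lambda>x. ennreal (cmod (?H x))) \<in> borel_measurable (split_law m)"
      by (rule measurable_compose[OF measurable_compose[OF Hm borel_measurable_norm] measurable_ennreal])
    have "(\<integral>\<^sup>+x. cmod (?H x) \<partial>split_law m) = (\<integral>\<^sup>+Db. \<integral>\<^sup>+r. cmod (?H (Db, r)) \<partial>gauss_vec {..<?n} \<partial>?M1)"
      by (rule gauss_sf.nn_integral_fst[OF m, symmetric])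
    also have "\<dots> \<le> (\<integral>\<^sup>+Db. ennreal (3 * cmod z) \<partial>?M1)"
      unfolding split_conv FA by (intro nn_integral_mono gauss_row_integral(3) i)
    also have "\<dots> = ennreal (3 * cmod z)" using P1.emeasure_space_1 by simp
    finally show ?thesis .
  qed
  have Hint: "integrable (split_law m) ?H"
    using bound by (intro integrableI_bounded Hm) (auto intro: le_less_trans)
  have law: "distr (split_law m) (gauss_mat ?n) (assemble m i) = gauss_mat ?n" by (rule distr_assemble[OF i])
  have "integrable (distr (split_law m) (gauss_mat ?n) (assemble m i)) F"
    using Hint by (subst integrable_distr_eq[OF assemble_measurable[OF i] Fm]) (simp only: Heq)
  then show "integrable (gauss_mat ?n) F" by (simp only: law)
  have "(\<integral>\<^sup>+G. cmod (F G) \<partial>distr (split_law m) (gauss_mat ?n) (assemble m i)) = (\<integral>\<^sup>+x. cmod (?H x) \<partial>split_law m)"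
    using Fm by (subst nn_integral_distr[OF assemble_measurable[OF i]]) (auto simp: fun_cong[OF Heq])
  then show "(\<integral>\<^sup>+G. cmod (F G) \<partial>gauss_mat ?n) \<le> ennreal (3 * cmod z)" using bound by (simp only: law)
  define e where "e Db = exp (- ((cmod z)\<^sup>2 * (cmod (c Db i))\<^sup>2 / sq_norm ?n (c Db)))" for Db
  have em: "e \<in> borel_measurable ?M1"
  proof -
    have "(\<lambda>Db. sq_norm ?n (c Db)) \<in> borel_measurable ?M1"
      unfolding sq_norm_def
      by (rule borel_measurable_sum, rule borel_measurable_power, rule measurable_compose[OF _ borel_measurable_norm], rule cm) simp
    note [measurable] = this cm[OF i]
    show ?thesis unfolding e_def[abs_def] by measurable
  qed
  have e01: "0 \<le> e Db" "e Db \<le> 1" for Db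
    unfolding e_def by (auto intro!: divide_nonneg_nonneg)
  have eint: "integrable ?M1 e"
    by (rule P1.integrable_const_bound[of _ 1]) (use em e01 in auto)
  have "(\<integral>\<^sup>+Db. ennreal (e Db) \<partial>?M1) = (\<integral>\<^sup>+D. \<integral>\<^sup>+b. ennreal (e (D, b)) \<partial>gauss_vec {..<m} \<partial>gauss_mat m)"
    using em by (intro gauss_sf.nn_integral_fst[symmetric]) (rule measurable_compose[OF _ measurable_ennreal])
  also have "\<dots> = ennreal (ginibre_tail ?n ((cmod z)\<^sup>2))"
  proof (rule nn_integral_kernel_direction[OF _ reg, of "\<lambda>Db. ennreal (e Db)"])
    show "(\<lambda>Db. ennreal (e Db)) \<in> borel_measurable ?M1" by (rule measurable_compose[OF em measurable_ennreal])
    fix D u assume d: "det (shifted m z D) \<noteq> 0"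
    let ?b = "affine_map m (\<lambda>k l. shifted m z D $$ (k, l)) (\<lambda>_. 0) u"
    have "c (D, ?b) i = det (shifted m z D)" unfolding c_def by (rule row_cofactor_diag[OF i])
    moreover have "sq_norm ?n (c (D, ?b)) = (cmod (det (shifted m z D)))\<^sup>2 * (1 + sq_norm m u)"
      unfolding c_def by (rule sq_norm_row_cofactor[OF i d])
    ultimately show "ennreal (e (D, ?b)) = ennreal (exp (- ((cmod z)\<^sup>2 / (1 + sq_norm m u))))"
      using d by (simp add: e_def)
  qed
  finally have eval: "(\<integral>\<^sup>+Db. ennreal (e Db) \<partial>?M1) = ennreal (ginibre_tail ?n ((cmod z)\<^sup>2))" .
  have tail0: "ginibre_tail ?n ((cmod z)\<^sup>2) \<ge> 0"
    unfolding ginibre_tail_def by (intro mult_nonneg_nonneg sum_nonneg divide_nonneg_nonneg) auto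
  have eL: "(\<integral>Db. e Db \<partial>?M1) = ginibre_tail ?n ((cmod z)\<^sup>2)"
    using eval tail0 em e01 by (subst integral_eq_nn_integral) auto
  have "(\<integral>G. F G \<partial>gauss_mat ?n) = (\<integral>G. F G \<partial>distr (split_law m) (gauss_mat ?n) (assemble m i))"
    by (simp only: law)
  also have "\<dots> = (\<integral>x. ?H x \<partial>split_law m)"
    by (subst integral_distr[OF assemble_measurable[OF i] Fm]) (simp only: Heq)
  also have "\<dots> = (\<integral>Db. \<integral>r. ?H (Db, r) \<partial>gauss_vec {..<?n} \<partial>?M1)"
    by (rule P2.integral_fst'[OF Hint, symmetric])
  also have "\<dots> = (\<integral>Db. complex_of_real (1 - e Db) \<partial>?M1)"
    unfolding split_conv FA e_def by (intro Bochner_Integration.integral_cong refl gauss_row_integral(2) i)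
  also have "\<dots> = complex_of_real (\<integral>Db. 1 - e Db \<partial>?M1)"
    by (rule integral_complex_of_real)
  also have "(\<integral>Db. 1 - e Db \<partial>?M1) = 1 - ginibre_tail ?n ((cmod z)\<^sup>2)"
    using eint P1.prob_space by (subst Bochner_Integration.integral_diff) (auto simp: eL)
  finally show "(\<integral>G. F G \<partial>gauss_mat ?n) = of_real (1 - ginibre_tail ?n ((cmod z)\<^sup>2))" .
qed

section \<open>Recovering a measure from its Cauchy transform\<close>

text \<open>
  The area of the annulus \<open>cmod l \<le> cmod z < \<epsilon>\<close>, which is what Newton's theorem yields for the
  uniform weight on a disc. Being nonnegative, positive near \<open>0\<close> and supported in the disc of radius
  \<open>\<epsilon>\<close>, it is an approximate identity once divided by its mass.
\<close>

definition bump :: "real \<Rightarrow> complex \<Rightarrow> real" where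
  "bump \<epsilon> l = max 0 (pi * (\<epsilon>\<^sup>2 - (cmod l)\<^sup>2))"

lemma bump_measurable [measurable]: "bump \<epsilon> \<in> borel_measurable borel"
  unfolding bump_def[abs_def] by measurable

lemma bump_nonneg [simp]: "0 \<le> bump \<epsilon> l"
  by (simp add: bump_def)

lemma bump_eq_0: "\<epsilon> \<ge> 0 \<Longrightarrow> \<epsilon> \<le> cmod l \<Longrightarrow> bump \<epsilon> l = 0"
  using power_mono[of \<epsilon> "cmod l" 2] by (simp add: bump_def max_absorb1 mult_nonneg_nonpos)

definition bump_mass :: "real \<Rightarrow> ennreal" where
  "bump_mass \<epsilon> = (\<integral>\<^sup>+z. ennreal (bump \<epsilon> z) \<partial>lborel)"

lemma bump_mass_shift: "(\<integral>\<^sup>+c. ennreal (bump \<epsilon> (l - c)) \<partial>lborel) = bump_mass \<epsilon>"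
  using nn_integral_complex_affine[of "\<lambda>z. ennreal (bump \<epsilon> z)" "-1" l] by (simp add: bump_mass_def)

lemma bump_mass_pos_finite:
  assumes e: "\<epsilon> > 0"
  shows "bump_mass \<epsilon> \<noteq> 0" "bump_mass \<epsilon> \<noteq> \<infinity>"
proof -
  have "bump_mass \<epsilon> \<le> (\<integral>\<^sup>+z. ennreal (pi * \<epsilon>\<^sup>2) * indicator (ball (0::complex) \<epsilon>) z \<partial>lborel)"
    unfolding bump_mass_def
  proof (intro nn_integral_mono)
    fix z :: complex
    show "ennreal (bump \<epsilon> z) \<le> ennreal (pi * \<epsilon>\<^sup>2) * indicator (ball 0 \<epsilon>) z"
    proof (cases "z \<in> ball 0 \<epsilon>")
      case True
      then show ?thesis by (auto simp: bump_def intro!: ennreal_leI)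
    next
      case False
      then show ?thesis using e bump_eq_0[of \<epsilon> z] by simp
    qed
  qed
  also have "\<dots> = ennreal (pi * \<epsilon>\<^sup>2) * emeasure lborel (ball 0 \<epsilon> :: complex set)"
    by (rule nn_integral_cmult_indicator) simp
  also have "\<dots> < \<infinity>"
    using emeasure_bounded_finite[of "ball 0 \<epsilon> :: complex set"] by (simp add: ennreal_mult_less_top)
  finally show "bump_mass \<epsilon> \<noteq> \<infinity>" by simp
  have "bump_mass \<epsilon> = 0 \<longleftrightarrow> (AE z in lborel. ennreal (bump \<epsilon> z) = 0)"
    unfolding bump_mass_def by (rule nn_integral_0_iff_AE) measurable
  moreover have "\<not> (AE z in lborel. ennreal (bump \<epsilon> z) = 0)"
  proof
    assume "AE z in lborel. ennreal (bump \<epsilon> z) = 0"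
    then have "AE z in lborel. z \<notin> ball (0::complex) \<epsilon>"
    proof eventually_elim
      case (elim z)
      show ?case
      proof
        assume "z \<in> ball 0 \<epsilon>"
        then have "(cmod z)\<^sup>2 < \<epsilon>\<^sup>2" using e by (simp add: power_strict_mono)
        then show False using elim pi_gt_zero by (simp add: bump_def max_def ennreal_eq_0_iff mult_le_0_iff split: if_splits)
      qed
    qed
    then have "emeasure lborel (ball (0::complex) \<epsilon>) = 0"
      by (subst (asm) AE_iff_null_sets[symmetric]) auto
    then show False using e by (simp add: emeasure_ball unit_ball_vol_2)
  qed
  ultimately show "bump_mass \<epsilon> \<noteq> 0" by blast
qed

text \<open>
  Centres whose bump of radius \<open>\<epsilon>\<close> lives inside \<open>U\<close>.
\<close>

definition inner_part :: "complex set \<Rightarrow> real \<Rightarrow> complex set" where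
  "inner_part U \<epsilon> = {c. ball c \<epsilon> \<subseteq> U}"

lemma inner_part_borel [measurable]: "inner_part U \<epsilon> \<in> sets borel"
proof -
  have "- inner_part U \<epsilon> = (\<Union>x\<in>- U. ball x \<epsilon>)"
    by (auto simp: inner_part_def subset_iff dist_commute)
  then have "open (- inner_part U \<epsilon>)" by (simp only:) (intro open_UN ballI open_ball)
  then show ?thesis by (metis borel_open borel_comp double_complement)
qed

text \<open>
  Averaging over \<^const>\<open>inner_part\<close> only keeps the function zero outside \<open>U\<close>, and it converges
  to the indicator of \<open>U\<close> at every point; so the boundary of \<open>U\<close> may have positive measure.
\<close>

definition smoothed :: "complex set \<Rightarrow> real \<Rightarrow> complex \<Rightarrow> ennreal" where
  "smoothed U \<epsilon> l = (\<integral>\<^sup>+c. indicator (inner_part U \<epsilon>) c * ennreal (bump \<epsilon> (l - c)) \<partial>lborel) / bump_mass \<epsilon>"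

lemma smoothed_le_1: "\<epsilon> > 0 \<Longrightarrow> smoothed U \<epsilon> l \<le> 1"
proof -
  assume e: "\<epsilon> > 0"
  have "smoothed U \<epsilon> l \<le> bump_mass \<epsilon> / bump_mass \<epsilon>"
    unfolding smoothed_def bump_mass_shift[of \<epsilon> l, symmetric]
    by (intro divide_right_mono_ennreal nn_integral_mono) (auto simp: indicator_def)
  also have "\<dots> = 1" using bump_mass_pos_finite[OF e] by (simp add: ennreal_divide_self less_top[symmetric])
  finally show ?thesis .
qed

lemma smoothed_tendsto:
  assumes U: "open U"
  shows "(\<lambda>k. smoothed U (inverse (real (Suc k))) l) \<longlonglongrightarrow> indicator U l"
proof (cases "l \<in> U")
  case True
  then obtain d where d: "d > 0" "ball l d \<subseteq> U" using U by (meson open_contains_ball)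
  obtain k0 where k0: "inverse (real (Suc k0)) < d / 2" using d reals_Archimedean[of "d / 2"] by auto
  have "smoothed U (inverse (real (Suc k))) l = 1" if "k \<ge> k0" for k
  proof -
    let ?e = "inverse (real (Suc k))"
    have e: "?e > 0" "?e < d / 2"
      using that k0 by (auto elim!: order.strict_trans1[rotated] intro!: le_imp_inverse_le)
    have "(\<integral>\<^sup>+c. indicator (inner_part U ?e) c * ennreal (bump ?e (l - c)) \<partial>lborel) = (\<integral>\<^sup>+c. ennreal (bump ?e (l - c)) \<partial>lborel)"
    proof (intro nn_integral_cong)
      fix c
      show "indicator (inner_part U ?e) c * ennreal (bump ?e (l - c)) = ennreal (bump ?e (l - c))"
      proof (cases "cmod (l - c) < ?e")
        case True
        have "ball c ?e \<subseteq> ball l d"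
        proof
          fix x assume "x \<in> ball c ?e"
          then have "dist l x < ?e + ?e"
            using True dist_triangle[of l x c] by (simp add: dist_norm[of l c])
          then show "x \<in> ball l d" using e by simp
        qed
        then have "c \<in> inner_part U ?e" using d by (auto simp: inner_part_def)
        then show ?thesis by simp
      next
        case False
        then show ?thesis using e bump_eq_0[of ?e "l - c"] by simp
      qed
    qed
    then show ?thesis unfolding smoothed_def
      using bump_mass_pos_finite[OF e(1)] by (simp add: bump_mass_shift ennreal_divide_self less_top[symmetric])
  qed
  then have "eventually (\<lambda>k. smoothed U (inverse (real (Suc k))) l = indicator U l) sequentially"
    using True by (auto simp: eventually_sequentially)
  then show ?thesis by (rule tendsto_eventually)
next
  case False
  have "smoothed U (inverse (real (Suc k))) l = 0" for k
  proof -
    let ?e = "inverse (real (Suc k))"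
    have "(\<integral>\<^sup>+c. indicator (inner_part U ?e) c * ennreal (bump ?e (l - c)) \<partial>lborel) = (\<integral>\<^sup>+c. 0 \<partial>(lborel :: complex measure))"
    proof (intro nn_integral_cong)
      fix c
      show "indicator (inner_part U ?e) c * ennreal (bump ?e (l - c)) = 0"
      proof (cases "c \<in> inner_part U ?e")
        case True
        then have "l \<notin> ball c ?e" using False by (auto simp: inner_part_def)
        then have "?e \<le> cmod (l - c)" by (simp add: dist_norm norm_minus_commute)
        then show ?thesis by (simp add: bump_eq_0)
      qed simp
    qed
    then show ?thesis by (simp add: smoothed_def)
  qed
  then show ?thesis using False by simp
qed

text \<open>
  The measure of an open set is an explicit limit of bump integrals. Besides uniqueness,
  this formula provides the measurability of a random measure from that of its bump integrals.
\<close>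

proposition bump_integrals_tendsto:
  assumes "finite_measure \<mu>" and sets: "sets \<mu> = sets borel" and U: "open U"
  shows "(\<lambda>k. (\<integral>\<^sup>+c. indicator (inner_part U (inverse (real (Suc k)))) c *
      (\<integral>\<^sup>+l. ennreal (bump (inverse (real (Suc k))) (l - c)) \<partial>\<mu>) \<partial>lborel) / bump_mass (inverse (real (Suc k))))
    \<longlonglongrightarrow> emeasure \<mu> U"
proof -
  interpret finite_measure \<mu> by fact
  note [measurable_cong] = sets
  have fin: "emeasure \<mu> (space \<mu>) < \<infinity>"
    by (metis emeasure_finite infinity_ennreal_def less_top)
  interpret PS: pair_sigma_finite "lborel :: complex measure" \<mu> ..
  let ?e = "\<lambda>k. inverse (real (Suc k))"
  have [measurable]: "U \<in> sets borel" using U by simp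
  have sm[measurable]: "smoothed U \<epsilon> \<in> borel_measurable borel" for \<epsilon>
    unfolding smoothed_def[abs_def] by measurable
  have eq: "(\<integral>\<^sup>+c. indicator (inner_part U \<epsilon>) c * (\<integral>\<^sup>+l. ennreal (bump \<epsilon> (l - c)) \<partial>\<mu>) \<partial>lborel) / bump_mass \<epsilon> = (\<integral>\<^sup>+l. smoothed U \<epsilon> l \<partial>\<mu>)" for \<epsilon>
  proof -
    have "(\<integral>\<^sup>+c. indicator (inner_part U \<epsilon>) c * (\<integral>\<^sup>+l. ennreal (bump \<epsilon> (l - c)) \<partial>\<mu>) \<partial>lborel) =
      (\<integral>\<^sup>+c. \<integral>\<^sup>+l. indicator (inner_part U \<epsilon>) c * ennreal (bump \<epsilon> (l - c)) \<partial>\<mu> \<partial>lborel)"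
      by (intro nn_integral_cong nn_integral_cmult[symmetric]) measurable
    also have "\<dots> = (\<integral>\<^sup>+l. \<integral>\<^sup>+c. indicator (inner_part U \<epsilon>) c * ennreal (bump \<epsilon> (l - c)) \<partial>lborel \<partial>\<mu>)"
      by (rule PS.Fubini'[symmetric]) measurable
    finally show ?thesis
      unfolding smoothed_def divide_ennreal_def by (subst nn_integral_multc) (auto simp: mult.commute)
  qed
  have "(\<lambda>k. \<integral>\<^sup>+l. smoothed U (?e k) l \<partial>\<mu>) \<longlonglongrightarrow> (\<integral>\<^sup>+l. indicator U l \<partial>\<mu>)"
  proof (rule nn_integral_dominated_convergence[where w="\<lambda>_. 1"])
    show "(\<integral>\<^sup>+l. 1 \<partial>\<mu>) < \<infinity>" using fin by simp
    show "AE l in \<mu>. smoothed U (?e k) l \<le> 1" for k by (intro AE_I2 smoothed_le_1) simp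
    show "AE l in \<mu>. (\<lambda>k. smoothed U (?e k) l) \<longlonglongrightarrow> indicator U l" by (intro AE_I2 smoothed_tendsto U)
  qed measurable
  then show ?thesis unfolding eq using U sets by simp
qed

lemma measure_eqI_bump:
  assumes "finite_measure \<mu>" "sets \<mu> = sets borel" "finite_measure \<nu>" "sets \<nu> = sets borel"
    and eq: "\<And>\<epsilon> c. \<epsilon> > 0 \<Longrightarrow> (\<integral>\<^sup>+l. ennreal (bump \<epsilon> (l - c)) \<partial>\<mu>) = (\<integral>\<^sup>+l. ennreal (bump \<epsilon> (l - c)) \<partial>\<nu>)"
  shows "\<mu> = \<nu>"
proof -
  have op: "emeasure \<mu> U = emeasure \<nu> U" if U: "open U" for U
    using bump_integrals_tendsto[OF assms(1,2) U] bump_integrals_tendsto[OF assms(3,4) U]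
    by (simp add: eq LIMSEQ_unique)
  show ?thesis
  proof (rule measure_eqI_generator_eq[where E="{U. open U}" and \<Omega>=UNIV and A="\<lambda>_. UNIV"])
    show "emeasure \<mu> UNIV \<noteq> \<infinity>" using finite_measure.emeasure_finite[OF assms(1)] by simp
    show "sets \<mu> = sigma_sets UNIV {U. open U}" "sets \<nu> = sigma_sets UNIV {U. open U}"
      using assms by (simp_all add: borel_def)
  qed (auto simp: Int_stable_def op)
qed

text \<open>
  Newton's theorem for the indicator of a disc around \<open>c\<close>.
\<close>

lemma bump_eq_newton:
  assumes e: "\<epsilon> > 0"
  shows "integrable lborel (\<lambda>z. indicator (ball c \<epsilon>) z * (z - c) / (z - l))"
    and "(\<integral>z. indicator (ball c \<epsilon>) z * (z - c) / (z - l) \<partial>lborel) = complex_of_real (bump \<epsilon> (l - c))"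
proof -
  let ?w = "indicator {..<\<epsilon>} :: real \<Rightarrow> real"
  have ball: "?w (cmod z) = indicator (ball 0 \<epsilon>) z" for z :: complex by (auto simp: indicator_def)
  have fin: "emeasure lborel (ball 0 \<epsilon> :: complex set) < \<infinity>" by (rule emeasure_bounded_finite) simp
  have int: "integrable lborel (\<lambda>z::complex. ?w (cmod z))"
    unfolding ball using fin by (intro integrable_real_indicator) auto
  note N = newton_bounded[of ?w 1 "l - c", OF _ _ _ int]
  have sh: "indicator (ball c \<epsilon>) (c + z) * (c + z - c) / (c + z - l) = complex_of_real (?w (cmod z)) * (z / (z - (l - c)))" for z
    by (auto simp: indicator_def dist_norm algebra_simps)
  have tr: "distr lborel borel ((+) c) = lborel" by (rule lborel_distr_plus)
  have bb[measurable]: "ball c \<epsilon> \<in> sets borel" by simp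
  have fm: "(\<lambda>z. indicator (ball c \<epsilon>) z * (z - c) / (z - l)) \<in> borel_measurable borel" by measurable
  have "integrable (distr lborel borel ((+) c)) (\<lambda>z. indicator (ball c \<epsilon>) z * (z - c) / (z - l))"
    by (subst integrable_distr_eq) (use fm N(1) in \<open>auto simp only: sh, auto\<close>)
  then show "integrable lborel (\<lambda>z. indicator (ball c \<epsilon>) z * (z - c) / (z - l))" by (simp only: tr)
  have "(\<integral>z. indicator (ball c \<epsilon>) z * (z - c) / (z - l) \<partial>lborel) = (\<integral>z. indicator (ball c \<epsilon>) z * (z - c) / (z - l) \<partial>distr lborel borel ((+) c))"
    by (simp only: tr)
  also have "\<dots> = (\<integral>z. complex_of_real (?w (cmod z)) * (z / (z - (l - c))) \<partial>lborel)"
    by (subst integral_distr) (use fm in \<open>auto simp only: sh, auto\<close>)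
  also have "\<dots> = complex_of_real (\<integral>z. ?w (cmod z) * indicator {z. cmod (l - c) < cmod z} z \<partial>lborel)"
    by (rule N(3)) auto
  also have "(\<integral>z. ?w (cmod z) * indicator {z. cmod (l - c) < cmod z} z \<partial>lborel) = (\<integral>z. indicator (ball 0 \<epsilon> - cball 0 (cmod (l - c))) (z::complex) \<partial>lborel)"
    by (intro Bochner_Integration.integral_cong) (auto simp: indicator_def)
  also have "\<dots> = measure lborel (ball 0 \<epsilon> - cball 0 (cmod (l - c)) :: complex set)"
    by simp
  also have "\<dots> = bump \<epsilon> (l - c)"
  proof (cases "cmod (l - c) < \<epsilon>")
    case True
    have "measure lborel (ball 0 \<epsilon> - cball 0 (cmod (l - c)) :: complex set) = measure lborel (ball 0 \<epsilon> :: complex set) - measure lborel (cball 0 (cmod (l - c)) :: complex set)"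
      using True fin by (intro measure_Diff) (auto simp: less_top)
    then show ?thesis using True e power_strict_mono[OF True, of 2]
      by (simp add: content_ball content_cball unit_ball_vol_2 bump_def algebra_simps max_def)
  next
    case False
    then have D: "ball 0 \<epsilon> - cball 0 (cmod (l - c)) = ({} :: complex set)" by auto
    show ?thesis unfolding D using False e by (simp add: bump_eq_0)
  qed
  finally show "(\<integral>z. indicator (ball c \<epsilon>) z * (z - c) / (z - l) \<partial>lborel) = complex_of_real (bump \<epsilon> (l - c))" .
qed

lemma bump_kernel_bound:
  assumes e: "\<epsilon> > 0"
  shows "(\<integral>\<^sup>+z. ennreal (cmod (indicator (ball c \<epsilon>) z * (z - c) / (z - l))) \<partial>lborel) \<le> ennreal (2 * pi * \<epsilon>) + ennreal \<epsilon> * emeasure lborel (ball c \<epsilon>)"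
proof -
  have [measurable]: "ball c \<epsilon> \<in> sets borel" by simp
  let ?h = "\<lambda>z. indicator (ball c \<epsilon>) z * cmod (z - c)"
  have h: "?h z \<le> \<epsilon>" for z using e by (auto simp: indicator_def dist_norm norm_minus_commute)
  have "(\<integral>\<^sup>+z. ennreal (cmod (indicator (ball c \<epsilon>) z * (z - c) / (z - l))) \<partial>lborel) = (\<integral>\<^sup>+z. ennreal (?h z * inverse (cmod (z - l))) \<partial>lborel)"
    by (intro nn_integral_cong) (simp add: norm_divide norm_mult norm_inverse divide_inverse indicator_def)
  also have "\<dots> \<le> ennreal (2 * pi * \<epsilon>) + (\<integral>\<^sup>+z. ennreal (?h z) \<partial>lborel)"
    by (rule nn_integral_cauchy_kernel_le) (use h in auto)
  also have "(\<integral>\<^sup>+z. ennreal (?h z) \<partial>lborel) \<le> (\<integral>\<^sup>+z. ennreal \<epsilon> * indicator (ball c \<epsilon>) z \<partial>lborel)"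
    using h by (intro nn_integral_mono) (auto simp: indicator_def dist_norm norm_minus_commute intro!: ennreal_leI)
  also have "\<dots> = ennreal \<epsilon> * emeasure lborel (ball c \<epsilon>)"
    by (rule nn_integral_cmult_indicator) simp
  finally show ?thesis by (simp add: add_left_mono)
qed

text \<open>
  The average of \<open>(z - c) * C z\<close> over a disc. Taking the real part gives a real-valued function
  even for a \<open>C\<close> that is not a Cauchy transform.
\<close>

definition cauchy_average :: "(complex \<Rightarrow> complex) \<Rightarrow> real \<Rightarrow> complex \<Rightarrow> real" where
  "cauchy_average C \<epsilon> c = Re (\<integral>z. indicator (ball c \<epsilon>) z * (z - c) * C z \<partial>lborel)"

text \<open>
  Integrate the representation of the bump by the Cauchy kernel against the measure and exchange
  the integrals. A finite measure is therefore determined by its Cauchy transform, even if this is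
  known only almost everywhere.
\<close>

proposition bump_integral_cauchy:
  assumes "finite_measure \<mu>" and sets: "sets \<mu> = sets borel" and e: "\<epsilon> > 0"
    and C: "AE z in lborel. C z = (\<integral>l. 1 / (z - l) \<partial>\<mu>)"
    and Cm[measurable]: "C \<in> borel_measurable borel"
  shows "(\<integral>\<^sup>+l. ennreal (bump \<epsilon> (l - c)) \<partial>\<mu>) = ennreal (cauchy_average C \<epsilon> c)"
    and "0 \<le> cauchy_average C \<epsilon> c"
proof -
  interpret finite_measure \<mu> by fact
  note [measurable_cong] = sets
  have fin: "emeasure \<mu> (space \<mu>) < \<infinity>"
    by (metis emeasure_finite infinity_ennreal_def less_top)
  interpret PS: pair_sigma_finite \<mu> "lborel :: complex measure" ..
  have [measurable]: "ball c \<epsilon> \<in> sets borel" by simp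
  let ?k = "\<lambda>l z. indicator (ball c \<epsilon>) z * (z - c) / (z - l) :: complex"
  have km: "case_prod ?k \<in> borel_measurable (\<mu> \<Otimes>\<^sub>M lborel)" by measurable
  have kint: "integrable (\<mu> \<Otimes>\<^sub>M lborel) (case_prod ?k)"
  proof (rule integrableI_bounded[OF km])
    have "(\<integral>\<^sup>+x. ennreal (cmod (case_prod ?k x)) \<partial>(\<mu> \<Otimes>\<^sub>M lborel)) = (\<integral>\<^sup>+l. \<integral>\<^sup>+z. ennreal (cmod (?k l z)) \<partial>lborel \<partial>\<mu>)"
      using km by (subst lborel.nn_integral_fst[symmetric]) auto
    also have "\<dots> \<le> (\<integral>\<^sup>+l. ennreal (2 * pi * \<epsilon>) + ennreal \<epsilon> * emeasure lborel (ball c \<epsilon>) \<partial>\<mu>)"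
      by (intro nn_integral_mono bump_kernel_bound e)
    also have "\<dots> < \<infinity>"
      using fin emeasure_bounded_finite[of "ball c \<epsilon>"]
      by (simp add: ennreal_mult_less_top top.not_eq_extremum)
    finally show "(\<integral>\<^sup>+x. ennreal (cmod (case_prod ?k x)) \<partial>(\<mu> \<Otimes>\<^sub>M lborel)) < \<infinity>" .
  qed
  have bint: "integrable \<mu> (\<lambda>l. bump \<epsilon> (l - c))"
    using PS.integrable_fst[OF kint] unfolding bump_eq_newton(2)[OF e] by (auto dest: integrable_Re)
  have "complex_of_real (\<integral>l. bump \<epsilon> (l - c) \<partial>\<mu>) = (\<integral>l. \<integral>z. ?k l z \<partial>lborel \<partial>\<mu>)"
    unfolding bump_eq_newton(2)[OF e] by (rule integral_complex_of_real[symmetric])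
  also have "\<dots> = (\<integral>z. \<integral>l. ?k l z \<partial>\<mu> \<partial>lborel)"
    by (rule PS.Fubini_integral[OF kint, symmetric])
  also have "\<dots> = (\<integral>z. indicator (ball c \<epsilon>) z * (z - c) * C z \<partial>lborel)"
  proof (rule integral_cong_AE)
    show "AE z in lborel. (\<integral>l. ?k l z \<partial>\<mu>) = indicator (ball c \<epsilon>) z * (z - c) * C z"
      using C
    proof eventually_elim
      case (elim z)
      have "(\<integral>l. ?k l z \<partial>\<mu>) = (\<integral>l. (indicator (ball c \<epsilon>) z * (z - c)) * (1 / (z - l)) \<partial>\<mu>)" by simp
      also have "\<dots> = indicator (ball c \<epsilon>) z * (z - c) * (\<integral>l. 1 / (z - l) \<partial>\<mu>)" by (rule integral_mult_right_zero)
      finally show ?case by (simp only: elim)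
    qed
  qed measurable
  finally have eq: "(\<integral>l. bump \<epsilon> (l - c) \<partial>\<mu>) = cauchy_average C \<epsilon> c"
    unfolding cauchy_average_def by (metis Re_complex_of_real)
  then show "(\<integral>\<^sup>+l. ennreal (bump \<epsilon> (l - c)) \<partial>\<mu>) = ennreal (cauchy_average C \<epsilon> c)"
    using nn_integral_eq_integral[OF bint] by simp
  show "0 \<le> cauchy_average C \<epsilon> c"
    unfolding eq[symmetric] by (intro integral_nonneg_AE) simp
qed

section \<open>The mean eigenvalue distribution\<close>

text \<open>
  The density of the scaled mean eigenvalue distribution relative to the uniform density
  \<open>1 / pi\<close>, as a function of \<open>t = \<bar>z\<bar>\<^sup>2\<close>.
\<close>

definition ginibre_profile :: "nat \<Rightarrow> real \<Rightarrow> real" where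
  "ginibre_profile n t = exp (- (real n * t)) * (\<Sum>k<n. (real n * t) ^ k / fact k)"

definition ginibre_law :: "nat \<Rightarrow> complex measure" where
  "ginibre_law n = density lborel (\<lambda>z. ennreal (1 / pi * ginibre_profile n ((cmod z)\<^sup>2)))"

lemma sets_ginibre_law [simp, measurable_cong]: "sets (ginibre_law n) = sets borel"
  by (simp add: ginibre_law_def)

lemma space_ginibre_law [simp]: "space (ginibre_law n) = UNIV"
  by (simp add: ginibre_law_def)

lemma ginibre_profile_measurable [measurable]: "ginibre_profile n \<in> borel_measurable borel"
  unfolding ginibre_profile_def[abs_def] by measurable

lemma ginibre_profile_nonneg: "t \<ge> 0 \<Longrightarrow> 0 \<le> ginibre_profile n t"
  unfolding ginibre_profile_def by (intro mult_nonneg_nonneg sum_nonneg divide_nonneg_nonneg) auto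

text \<open>
  A partial sum of the exponential series is at most the full series. So the law never exceeds
  the density \<open>1 / pi\<close> of the uniform distribution, which is what locates the supremum in the total
  variation distance.
\<close>

lemma ginibre_profile_le_1:
  assumes "t \<ge> 0"
  shows "ginibre_profile n t \<le> 1"
proof -
  let ?x = "real n * t"
  have "(\<lambda>k. ?x ^ k / fact k) sums exp ?x"
    using exp_converges[of ?x] by (simp add: divide_inverse mult.commute)
  then have "(\<Sum>k<n. ?x ^ k / fact k) \<le> exp ?x"
    using assms by (intro sum_le_suminf[of "\<lambda>k. ?x ^ k / fact k", THEN order_trans])
      (auto simp: sums_iff)
  then have "ginibre_profile n t \<le> exp (- ?x) * exp ?x"
    unfolding ginibre_profile_def by (rule mult_left_mono) simp
  then show ?thesis by (simp add: exp_add[symmetric])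
qed

lemma ginibre_tail_deriv:
  assumes n: "n > 0"
  shows "((\<lambda>t. - ginibre_tail n (real n * t)) has_real_derivative ginibre_profile n t) (at t)"
proof -
  obtain m where m: "n = Suc m" using n by (cases n) auto
  define a where "a k = (1 - real k / real n) / fact k" for k
  have tail: "ginibre_tail n x = exp (- x) * (\<Sum>k<n. a k * x ^ k)" for x
    unfolding ginibre_tail_def a_def by (simp add: mult.commute)
  have d: "((\<lambda>x. - (exp (- x) * (\<Sum>k<n. a k * x ^ k))) has_real_derivative
    exp (- x) * ((\<Sum>k<n. a k * x ^ k) - (\<Sum>k<n. a k * (real k * x ^ (k - 1))))) (at x)" for x :: real
    by (auto intro!: derivative_eq_intros simp: algebra_simps sum_distrib_left sum_subtractf)
  have s: "(\<Sum>k<n. a k * x ^ k) - (\<Sum>k<n. a k * (real k * x ^ (k - 1))) = (1 / real n) * (\<Sum>k<n. x ^ k / fact k)" for x :: real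
  proof -
    have "(\<Sum>k<n. a k * (real k * x ^ (k - 1))) = (\<Sum>k<m. a (Suc k) * (real (Suc k) * x ^ k))"
      unfolding m by (subst sum.lessThan_Suc_shift) simp
    also have "\<dots> = (\<Sum>k<n. a (Suc k) * (real (Suc k) * x ^ k))"
      unfolding m by (simp add: a_def m)
    finally have "(\<Sum>k<n. a k * x ^ k) - (\<Sum>k<n. a k * (real k * x ^ (k - 1))) = (\<Sum>k<n. a k * x ^ k - a (Suc k) * (real (Suc k) * x ^ k))"
      by (simp only: sum_subtractf)
    also have "\<dots> = (\<Sum>k<n. (1 / real n) * (x ^ k / fact k))"
    proof (intro sum.cong refl)
      fix k
      have "a (Suc k) * real (Suc k) = (1 - real (Suc k) / real n) / fact k"
        by (simp add: a_def)
      then have "a k - a (Suc k) * real (Suc k) = (1 / real n) / fact k"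
        by (simp add: a_def diff_divide_distrib[symmetric] add_divide_distrib)
      then have "(a k - a (Suc k) * real (Suc k)) * x ^ k = (1 / real n) / fact k * x ^ k" by (simp only:)
      then show "a k * x ^ k - a (Suc k) * (real (Suc k) * x ^ k) = (1 / real n) * (x ^ k / fact k)"
        by (simp add: left_diff_distrib mult.assoc)
    qed
    finally show ?thesis by (simp only: sum_distrib_left)
  qed
  have "((\<lambda>x. - ginibre_tail n x) has_real_derivative exp (- (real n * t)) * ((1 / real n) * (\<Sum>k<n. (real n * t) ^ k / fact k))) (at (real n * t))"
    unfolding tail using d[of "real n * t"] unfolding s .
  moreover have "((\<lambda>t. real n * t) has_real_derivative real n) (at t)"
    by (auto intro!: derivative_eq_intros)
  ultimately have "((\<lambda>t. - ginibre_tail n (real n * t)) has_real_derivative exp (- (real n * t)) * ((1 / real n) * (\<Sum>k<n. (real n * t) ^ k / fact k)) * real n) (at t)"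
    by (rule DERIV_chain2[where f="\<lambda>x. - ginibre_tail n x" and g="\<lambda>t. real n * t"])
  then show ?thesis using n by (simp add: ginibre_profile_def)
qed

lemma ginibre_tail_tendsto_0: "(ginibre_tail n \<longlongrightarrow> 0) at_top"
proof -
  have "((\<lambda>x. \<Sum>k<n. (1 - real k / real n) / fact k * (x ^ k / exp x)) \<longlongrightarrow> (\<Sum>k<n. (1 - real k / real n) / fact k * 0)) at_top"
    by (intro tendsto_intros tendsto_power_div_exp_0)
  moreover have "ginibre_tail n = (\<lambda>x. \<Sum>k<n. (1 - real k / real n) / fact k * (x ^ k / exp x))"
    unfolding ginibre_tail_def sum_distrib_left by (intro ext sum.cong refl) (simp add: exp_minus divide_inverse mult_ac)
  ultimately show ?thesis by (simp only: mult_zero_right sum.neutral_const)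
qed

lemma ginibre_tail_0: "n > 0 \<Longrightarrow> ginibre_tail n 0 = 1"
  by (cases n) (simp_all add: ginibre_tail_def sum.lessThan_Suc_shift del: sum.lessThan_Suc)

lemma ginibre_tail_nonneg: "x \<ge> 0 \<Longrightarrow> 0 \<le> ginibre_tail n x"
  unfolding ginibre_tail_def by (intro mult_nonneg_nonneg sum_nonneg divide_nonneg_nonneg) (auto simp: divide_simps)

lemma ginibre_tail_measurable [measurable]: "ginibre_tail n \<in> borel_measurable borel"
  unfolding ginibre_tail_def[abs_def] by measurable

lemma emeasure_ginibre_law_outside:
  assumes n: "n > 0" and r: "r \<ge> 0"
  shows "emeasure (ginibre_law n) {z. r \<le> cmod z} = ennreal (ginibre_tail n (real n * r\<^sup>2))"
proof -
  have "emeasure (ginibre_law n) {z. r \<le> cmod z} =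
    (\<integral>\<^sup>+z. (\<lambda>t. ennreal (1 / pi * ginibre_profile n t) * indicator {r\<^sup>2..} t) ((cmod z)\<^sup>2) \<partial>lborel)"
    unfolding ginibre_law_def using r
    by (subst emeasure_density) (auto intro!: nn_integral_cong simp: indicator_def abs_le_square_iff[symmetric])
  also have "\<dots> = ennreal pi * (\<integral>\<^sup>+t\<in>{0..}. ennreal (1 / pi * ginibre_profile n t) * indicator {r\<^sup>2..} t \<partial>lborel)"
    by (rule nn_integral_complex_radial) simp
  also have "\<dots> = (\<integral>\<^sup>+t. ennreal (ginibre_profile n t) * indicator {r\<^sup>2..} t \<partial>lborel)"
  proof (subst nn_integral_cmult[symmetric], simp, intro nn_integral_cong)
    fix t
    have "t \<ge> 0" if "t \<ge> r\<^sup>2" using that zero_le_power2[of r] by linarith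
    then show "ennreal pi * (ennreal (1 / pi * ginibre_profile n t) * indicator {r\<^sup>2..} t * indicator {0..} t) =
      ennreal (ginibre_profile n t) * indicator {r\<^sup>2..} t"
      using ginibre_profile_nonneg[of t n] by (auto simp: indicator_def ennreal_mult[symmetric])
  qed
  also have "\<dots> = ennreal (0 - (- ginibre_tail n (real n * r\<^sup>2)))"
  proof (rule nn_integral_FTC_atLeast[where F="\<lambda>t. - ginibre_tail n (real n * t)"])
    have "filterlim (\<lambda>t. real n * t) at_top at_top"
      using n by (intro filterlim_tendsto_pos_mult_at_top[OF tendsto_const _ filterlim_ident]) auto
    from tendsto_minus[OF filterlim_compose[OF ginibre_tail_tendsto_0 this]]
    show "((\<lambda>t. - ginibre_tail n (real n * t)) \<longlongrightarrow> 0) at_top" by simp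
    show "0 \<le> ginibre_profile n t" if "r\<^sup>2 \<le> t" for t
      using that zero_le_power2[of r] by (intro ginibre_profile_nonneg) linarith
  qed (auto intro: ginibre_tail_deriv n)
  finally show ?thesis by simp
qed

lemma prob_space_ginibre_law: "n > 0 \<Longrightarrow> prob_space (ginibre_law n)"
  using emeasure_ginibre_law_outside[of n 0] by (intro prob_spaceI) (auto simp: ginibre_tail_0)

text \<open>
  Newton's theorem once more: the Cauchy transform of a rotation-invariant law at \<open>z\<close> is the
  mass inside the circle through \<open>z\<close>, divided by \<open>z\<close>.
\<close>

lemma ginibre_law_cauchy:
  assumes n: "n > 0" and z: "z \<noteq> 0"
  shows "(\<integral>l. 1 / (z - l) \<partial>ginibre_law n) = of_real (1 - ginibre_tail n (real n * (cmod z)\<^sup>2)) / z"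
proof -
  interpret prob_space "ginibre_law n" by (rule prob_space_ginibre_law[OF n])
  define g where "g r = 1 / pi * ginibre_profile n (r\<^sup>2)" for r :: real
  have gp: "0 \<le> g r" "g r \<le> 1 / pi" for r
    unfolding g_def using ginibre_profile_nonneg[of "r\<^sup>2" n] ginibre_profile_le_1[of "r\<^sup>2" n]
    by (auto simp: divide_simps)
  have [measurable]: "g \<in> borel_measurable borel" unfolding g_def by measurable
  have law: "ginibre_law n = density lborel (\<lambda>l. ennreal (g (cmod l)))"
    by (simp add: ginibre_law_def g_def)
  have "(\<integral>\<^sup>+l. ennreal (g (cmod l)) \<partial>(lborel :: complex measure)) = emeasure (ginibre_law n) UNIV"
    unfolding law by (subst emeasure_density) auto
  also have "\<dots> < \<infinity>" by (metis emeasure_finite infinity_ennreal_def less_top)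
  finally have gint: "integrable lborel (\<lambda>l::complex. g (cmod l))"
    using gp by (intro integrableI_bounded) auto
  note N = newton_bounded[of g "1/pi" z, OF _ gp gint]
  have i1: "integrable (ginibre_law n) (\<lambda>l. l / (l - z))"
    unfolding law using N(1) gp by (subst integrable_density) (auto simp: scaleR_conv_of_real)
  have tail: "(\<integral>l. g (cmod l) * indicator {l. cmod z < cmod l} l \<partial>(lborel :: complex measure)) = ginibre_tail n (real n * (cmod z)\<^sup>2)"
  proof -
    have "(\<integral>\<^sup>+l. ennreal (g (cmod l) * indicator {l. cmod z < cmod l} l) \<partial>lborel) = (\<integral>\<^sup>+l. ennreal (g (cmod l)) * indicator {l. cmod z \<le> cmod l} l \<partial>lborel)"
      using AE_cmod_neq[of "cmod z"]
      by (intro nn_integral_cong_AE) (auto elim!: eventually_mono simp: indicator_def)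
    also have "\<dots> = emeasure (ginibre_law n) {l. cmod z \<le> cmod l}"
      unfolding law by (subst emeasure_density) auto
    also have "\<dots> = ennreal (ginibre_tail n (real n * (cmod z)\<^sup>2))"
      by (rule emeasure_ginibre_law_outside[OF n]) simp
    finally show ?thesis
      using gp ginibre_tail_nonneg[of "real n * (cmod z)\<^sup>2" n] by (subst integral_eq_nn_integral) auto
  qed
  have AEz: "AE l in ginibre_law n. l \<noteq> z"
    unfolding law by (subst AE_density) (use AE_lborel_singleton[of z] in auto)
  have ae: "AE l in ginibre_law n. 1 / (z - l) = (1 - l / (l - z)) / z"
    using AEz
  proof eventually_elim
    case (elim l)
    have "1 / (z - l) = - (1 / (l - z))" by (metis minus_diff_eq divide_minus_right)
    also have "\<dots> = (1 - l / (l - z)) / z" using elim z by (simp add: cauchy_kernel_eq)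
    finally show ?case .
  qed
  have "(\<integral>l. 1 / (z - l) \<partial>ginibre_law n) = (\<integral>l. (1 - l / (l - z)) / z \<partial>ginibre_law n)"
    by (rule integral_cong_AE[OF _ _ ae]) measurable
  also have "\<dots> = (\<integral>l. 1 - l / (l - z) \<partial>ginibre_law n) / z" by (rule integral_divide_zero)
  also have "(\<integral>l. 1 - l / (l - z) \<partial>ginibre_law n) = 1 - (\<integral>l. l / (l - z) \<partial>ginibre_law n)"
    using i1 prob_space by (subst Bochner_Integration.integral_diff) auto
  also have "(\<integral>l. l / (l - z) \<partial>ginibre_law n) = of_real (ginibre_tail n (real n * (cmod z)\<^sup>2))"
  proof -
    have "(\<integral>l. l / (l - z) \<partial>ginibre_law n) = (\<integral>l. complex_of_real (g (cmod l)) * (l / (l - z)) \<partial>lborel)"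
      unfolding law using gp by (subst integral_density) (auto simp: scaleR_conv_of_real)
    then show ?thesis using N(3) tail by simp
  qed
  finally show ?thesis by simp
qed

section \<open>Empirical measures and the trace of the resolvent\<close>

lemma proots_linear_factors: "proots (\<Prod>a\<leftarrow>as. [:- a, 1:]) = (mset as :: complex multiset)"
proof (induction as)
  case (Cons a as)
  have "(\<Prod>a\<leftarrow>as. [:- a, 1:]) \<noteq> (0 :: complex poly)" by (auto simp: prod_list_zero_iff)
  then have "proots ([:- a, 1:] * (\<Prod>a\<leftarrow>as. [:- a, 1:])) = proots [:- a, 1:] + proots (\<Prod>a\<leftarrow>as. [:- a, 1:])"
    by (intro proots_mult) auto
  then show ?case using Cons by (simp del: mult_pCons_left)
qed simp

lemma eigenvalues_list:
  fixes A :: "complex mat"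
  assumes A: "A \<in> carrier_mat n n"
  obtains as where "char_poly A = (\<Prod>a\<leftarrow>as. [:- a, 1:])" "length as = n" "eigenvalues_mset A = mset as"
  using char_poly_factorized[OF A] proots_linear_factors unfolding eigenvalues_mset_def by metis

text \<open>
  The empirical measure as an image of the uniform measure on indices, so that integrals against
  it become finite sums.
\<close>

lemma empirical_eq_distr:
  fixes A :: "complex mat"
  assumes A: "A \<in> carrier_mat n n" and n: "n > 0" and as: "length as = n" "eigenvalues_mset A = mset as"
  shows "empirical_spectral_measure A = distr (point_measure {..<n} (\<lambda>_. ennreal (1 / real n))) borel (\<lambda>i. as ! i)"
proof (rule measure_eqI)
  fix B assume "B \<in> sets (empirical_spectral_measure A)"
  then have B: "B \<in> sets borel" by simp
  have m: "(\<lambda>i. as ! i) \<in> point_measure {..<n} (\<lambda>_. ennreal (1 / real n)) \<rightarrow>\<^sub>M borel"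
    by (simp add: point_measure_def)
  have inv: "x / of_nat n = ennreal (1 / real n) * x" for x :: ennreal
    using n by (simp add: divide_ennreal_def mult.commute inverse_ennreal ennreal_of_nat_eq_real_of_nat inverse_eq_divide)
  have "emeasure (empirical_spectral_measure A) B = (\<Sum>z\<in>#mset as. emeasure (return borel z) B) / of_nat n"
    using A by (simp add: emeasure_empirical_spectral_measure[OF B] as)
  also have "(\<Sum>z\<in>#mset as. emeasure (return borel z) B) = (\<Sum>i<n. indicator B (as ! i))"
  proof -
    have "(\<Sum>z\<in>#mset as. emeasure (return borel z) B) = (\<Sum>z\<in>#mset as. indicator B z)"
      using B by simp
    also have "\<dots> = (\<Sum>z\<leftarrow>as. indicator B z)" by (simp only: mset_map[symmetric] sum_mset_sum_list)
    also have "\<dots> = (\<Sum>i<n. indicator B (as ! i))" using as(1) by (simp add: sum_list_sum_nth atLeast0LessThan)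
    finally show ?thesis .
  qed
  also have "\<dots> / of_nat n = (\<Sum>i<n. ennreal (1 / real n) * indicator B (as ! i))"
    unfolding inv by (simp only: sum_distrib_left)
  also have "\<dots> = (\<integral>\<^sup>+i. indicator B (as ! i) \<partial>point_measure {..<n} (\<lambda>_. ennreal (1 / real n)))"
    by (rule nn_integral_point_measure_finite[symmetric]) simp
  also have "\<dots> = (\<integral>\<^sup>+z. indicator B z \<partial>distr (point_measure {..<n} (\<lambda>_. ennreal (1 / real n))) borel (\<lambda>i. as ! i))"
    using B by (subst nn_integral_distr[OF m]) auto
  also have "\<dots> = emeasure (distr (point_measure {..<n} (\<lambda>_. ennreal (1 / real n))) borel (\<lambda>i. as ! i)) B"
    using B by simp
  finally show "emeasure (empirical_spectral_measure A) B = emeasure (distr (point_measure {..<n} (\<lambda>_. ennreal (1 / real n))) borel (\<lambda>i. as ! i)) B" .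
qed simp

lemma log_derivative_linear_factors:
  fixes z :: complex
  assumes "z \<notin> set as"
  shows "poly (pderiv (\<Prod>a\<leftarrow>as. [:- a, 1:])) z / poly (\<Prod>a\<leftarrow>as. [:- a, 1:]) z = (\<Sum>a\<leftarrow>as. 1 / (z - a))"
  using assms
proof (induction as)
  case (Cons a as)
  let ?p = "\<Prod>a\<leftarrow>as. [:- a, 1:]"
  have "poly ?p z = (\<Prod>a\<leftarrow>as. z - a)" by (induction as) (auto simp: algebra_simps)
  then have nz: "poly ?p z \<noteq> 0" using Cons.prems by (auto simp: prod_list_zero_iff)
  have "poly (pderiv (\<Prod>a\<leftarrow>a # as. [:- a, 1:])) z = (z - a) * poly (pderiv ?p) z + poly ?p z"
    by (simp add: pderiv_mult pderiv_pCons algebra_simps del: mult_pCons_left)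
  moreover have "poly (\<Prod>a\<leftarrow>a # as. [:- a, 1:]) z = (z - a) * poly ?p z" by (simp add: algebra_simps)
  moreover have "((z - a) * poly (pderiv ?p) z + poly ?p z) / ((z - a) * poly ?p z) = poly (pderiv ?p) z / poly ?p z + 1 / (z - a)"
    using nz Cons.prems by (simp add: add_divide_distrib)
  ultimately show ?case using Cons by simp
qed simp

text \<open>
  Partial fractions: the logarithmic derivative of the characteristic polynomial is the sum of
  \<open>1 / (z - \<lambda>)\<close> over its roots.
\<close>

lemma empirical_cauchy:
  fixes A :: "complex mat"
  assumes A: "A \<in> carrier_mat n n" and n: "n > 0" and z: "poly (char_poly A) z \<noteq> 0"
  shows "(\<integral>l. 1 / (z - l) \<partial>empirical_spectral_measure A) = poly (pderiv (char_poly A)) z / poly (char_poly A) z / of_nat n"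
proof -
  obtain as where as: "char_poly A = (\<Prod>a\<leftarrow>as. [:- a, 1:])" "length as = n" "eigenvalues_mset A = mset as"
    using eigenvalues_list[OF A] by blast
  have "z \<notin> set as"
  proof
    assume "z \<in> set as"
    then have "poly (char_poly A) z = 0"
      unfolding as(1) by (induction as) auto
    then show False using z by simp
  qed
  note ld = log_derivative_linear_factors[OF this]
  have m: "(\<lambda>i. as ! i) \<in> point_measure {..<n} (\<lambda>_. ennreal (1 / real n)) \<rightarrow>\<^sub>M borel"
    by (simp add: point_measure_def)
  have "(\<integral>l. 1 / (z - l) \<partial>empirical_spectral_measure A) = (\<integral>i. 1 / (z - as ! i) \<partial>point_measure {..<n} (\<lambda>_. ennreal (1 / real n)))"
    unfolding empirical_eq_distr[OF A n as(2,3)] by (subst integral_distr[OF m]) auto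
  also have "\<dots> = (\<Sum>i<n. (1 / real n) *\<^sub>R (1 / (z - as ! i)))"
    by (rule lebesgue_integral_point_measure_finite) auto
  also have "\<dots> = (\<Sum>i<n. 1 / (z - as ! i)) / of_nat n"
    unfolding sum_divide_distrib by (intro sum.cong refl) (simp add: scaleR_conv_of_real)
  also have "(\<Sum>i<n. 1 / (z - as ! i)) = (\<Sum>a\<leftarrow>as. 1 / (z - a))"
    using as(2) by (simp add: sum_list_sum_nth atLeast0LessThan)
  finally show ?thesis unfolding ld[symmetric] as(1) .
qed

text \<open>
  The normalized trace \<open>tr ((z - D / sqrt n)\<^sup>-\<^sup>1) / n\<close>, written with determinants of the
  unscaled matrix \<open>sqrt n * z - D\<close>.
\<close>

definition stieltjes :: "nat \<Rightarrow> (nat \<times> nat \<Rightarrow> complex) \<Rightarrow> complex \<Rightarrow> complex" where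
  "stieltjes n D z = (\<Sum>i<n. det (mat_delete (shifted n (of_real (sqrt (real n)) * z) D) i i)) /
     det (shifted n (of_real (sqrt (real n)) * z) D) / of_real (sqrt (real n))"

abbreviation scaled :: "nat \<Rightarrow> (nat \<times> nat \<Rightarrow> complex) \<Rightarrow> complex mat" where
  "scaled n D \<equiv> complex_of_real (1 / sqrt (real n)) \<cdot>\<^sub>m mat n n D"

lemma poly_char_poly_smult:
  fixes B :: "complex mat"
  assumes B: "B \<in> carrier_mat k k" and c: "c \<noteq> 0"
  shows "poly (char_poly (c \<cdot>\<^sub>m B)) z = c ^ k * det (mat k k (\<lambda>(i, j). (if i = j then z / c else 0) - B $$ (i, j)))"
proof -
  let ?S = "mat k k (\<lambda>(i, j). (if i = j then z / c else 0) - B $$ (i, j))"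
  have cB: "c \<cdot>\<^sub>m B \<in> carrier_mat k k" using B by simp
  have "poly (char_poly (c \<cdot>\<^sub>m B)) z = det (c \<cdot>\<^sub>m ?S)"
    unfolding char_poly_def
  proof (rule poly_det_cong[of _ k])
    show "char_poly_matrix (c \<cdot>\<^sub>m B) \<in> carrier_mat k k" using cB by simp
    fix i j assume "i < k" "j < k"
    then show "poly (char_poly_matrix (c \<cdot>\<^sub>m B) $$ (i, j)) z = (c \<cdot>\<^sub>m ?S) $$ (i, j)"
      using B c by (auto simp: char_poly_matrix_def right_diff_distrib)
  qed simp
  then show ?thesis by simp
qed

lemma shifted_eq: "shifted n z D = mat n n (\<lambda>(i, j). (if i = j then z else 0) - mat n n D $$ (i, j))"
  unfolding shifted_def by (intro eq_matI) auto

lemma char_poly_scaled: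
  assumes n: "n > 0"
  shows "poly (char_poly (scaled n D)) z = of_real (1 / sqrt (real n)) ^ n * det (shifted n (of_real (sqrt (real n)) * z) D)"
    and "poly (pderiv (char_poly (scaled n D))) z =
      of_real (1 / sqrt (real n)) ^ (n - 1) * (\<Sum>i<n. det (mat_delete (shifted n (of_real (sqrt (real n)) * z) D) i i))"
proof -
  let ?c = "complex_of_real (1 / sqrt (real n))"
  obtain m where m: "n = Suc m" using n by (cases n) auto
  have c: "?c \<noteq> 0" using n by simp
  have zc: "z / ?c = of_real (sqrt (real n)) * z" by simp
  show "poly (char_poly (scaled n D)) z = ?c ^ n * det (shifted n (of_real (sqrt (real n)) * z) D)"
    unfolding shifted_eq zc[symmetric] by (rule poly_char_poly_smult[OF _ c]) simp
  have "poly (pderiv (char_poly (scaled n D))) z = (\<Sum>i<n. poly (char_poly (mat_delete (scaled n D) i i)) z)"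
    by (subst pderiv_char_poly[of _ n]) (auto simp: poly_sum)
  also have "\<dots> = (\<Sum>i<n. ?c ^ m * det (mat_delete (shifted n (of_real (sqrt (real n)) * z) D) i i))"
  proof (intro sum.cong refl)
    fix i assume "i \<in> {..<n}"
    let ?B = "mat_delete (mat n n D) i i"
    have B: "?B \<in> carrier_mat m m" by (simp add: m mat_delete_def)
    have "mat_delete (scaled n D) i i = ?c \<cdot>\<^sub>m ?B"
      using m by (intro eq_matI) (auto simp: mat_delete_def)
    then have "poly (char_poly (mat_delete (scaled n D) i i)) z = ?c ^ m * det (mat m m (\<lambda>(k, l). (if k = l then z / ?c else 0) - ?B $$ (k, l)))"
      using poly_char_poly_smult[OF B c] by simp
    also have "mat m m (\<lambda>(k, l). (if k = l then z / ?c else 0) - ?B $$ (k, l)) = mat_delete (shifted n (of_real (sqrt (real n)) * z) D) i i"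
      unfolding zc m by (intro eq_matI) (auto simp: mat_delete_def shifted_def)
    finally show "poly (char_poly (mat_delete (scaled n D) i i)) z = ?c ^ m * det (mat_delete (shifted n (of_real (sqrt (real n)) * z) D) i i)" .
  qed
  finally show "poly (pderiv (char_poly (scaled n D))) z = ?c ^ (n - 1) * (\<Sum>i<n. det (mat_delete (shifted n (of_real (sqrt (real n)) * z) D) i i))"
    by (simp only: sum_distrib_left m diff_Suc_1)
qed

lemma AE_char_poly_nonzero:
  fixes A :: "complex mat"
  assumes "A \<in> carrier_mat k k"
  shows "AE z in lborel. poly (char_poly A) z \<noteq> 0"
proof -
  have "char_poly A \<noteq> 0" using degree_monic_char_poly[OF assms] by auto
  then have "finite {z. poly (char_poly A) z = 0}" by (rule poly_roots_finite)
  then have "{z. poly (char_poly A) z = 0} \<in> null_sets lborel" by (rule finite_imp_null_set_lborel)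
  then show ?thesis by (rule AE_I') auto
qed

text \<open>
  The derivative of the characteristic polynomial is the sum of the characteristic polynomials
  of the diagonal minors, so the logarithmic derivative is the trace of the resolvent. The
  exceptional points are the eigenvalues.
\<close>

lemma stieltjes_eq_cauchy:
  assumes n: "n > 0"
  shows "AE z in lborel. stieltjes n D z = (\<integral>l. 1 / (z - l) \<partial>empirical_spectral_measure (scaled n D))"
proof -
  have A: "scaled n D \<in> carrier_mat n n" by simp
  obtain m where m: "n = Suc m" using n by (cases n) auto
  have nm: "n - 1 = m" by (simp add: m)
  show ?thesis
    using AE_char_poly_nonzero[OF A]
  proof eventually_elim
    case (elim z)
    define s where "s = complex_of_real (sqrt (real n))"
    have s: "s \<noteq> 0" "s * s = of_nat n" using n
      by (simp_all add: s_def of_real_mult[symmetric] del: of_real_mult)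
    have c: "complex_of_real (1 / sqrt (real n)) = 1 / s" by (simp add: s_def)
    define d where "d = det (shifted n (s * z) D)"
    define e where "e = (\<Sum>i<n. det (mat_delete (shifted n (s * z) D) i i))"
    have "(\<integral>l. 1 / (z - l) \<partial>empirical_spectral_measure (scaled n D)) = ((1 / s) ^ m * e) / ((1 / s) ^ n * d) / of_nat n"
      unfolding empirical_cauchy[OF A n elim] char_poly_scaled[OF n]
      unfolding c d_def e_def s_def[symmetric] nm ..
    also have "\<dots> = e / d / s"
    proof -
      have "((1 / s) ^ m * e) / ((1 / s) ^ n * d) = s * (e / d)" using s(1) by (simp add: m field_simps)
      then show ?thesis using s by (simp flip: s(2))
    qed
    finally show ?case by (simp add: stieltjes_def d_def e_def s_def)
  qed
qed

lemma det_shifted_joint_measurable: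
  "(\<lambda>p. det (shifted n (a * snd p) (fst p))) \<in> borel_measurable (gauss_mat n \<Otimes>\<^sub>M (lborel :: complex measure))"
proof -
  have "(\<lambda>p. det (mat n n (\<lambda>(i, j). (if i = j then a * snd p else 0) - fst p (i, j)))) \<in> borel_measurable (gauss_mat n \<Otimes>\<^sub>M (lborel :: complex measure))"
  proof (rule det_measurable)
    fix i j assume ij: "i < n" "j < n"
    have f1: "(\<lambda>p. fst p (i, j)) \<in> borel_measurable (gauss_mat n \<Otimes>\<^sub>M (lborel :: complex measure))"
      by (rule measurable_compose[OF measurable_fst gauss_component_measurable]) (use ij in auto)
    have f2: "(\<lambda>p. a * snd p) \<in> borel_measurable (gauss_mat n \<Otimes>\<^sub>M (lborel :: complex measure))"
      by (intro borel_measurable_times borel_measurable_const) simp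
    show "(\<lambda>p. (if i = j then a * snd p else 0) - fst p (i, j)) \<in> borel_measurable (gauss_mat n \<Otimes>\<^sub>M (lborel :: complex measure))"
    proof (cases "i = j")
      case True
      then show ?thesis using borel_measurable_diff[OF f2 f1] by (simp only: if_True simp_thms)
    next
      case False
      then show ?thesis using borel_measurable_diff[OF borel_measurable_const f1] by (simp only: if_False simp_thms)
    qed
  qed
  moreover have "shifted n z D = mat n n (\<lambda>(i, j). (if i = j then z else 0) - D (i, j))" for z D
    unfolding shifted_def by (intro eq_matI) auto
  ultimately show ?thesis by (simp only:)
qed

lemma stieltjes_measurable:
  assumes n: "n > 0"
  shows "(\<lambda>p. stieltjes n (fst p) (snd p)) \<in> borel_measurable (gauss_mat n \<Otimes>\<^sub>M (lborel :: complex measure))"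
proof -
  obtain m where m: "n = Suc m" using n by (cases n) auto
  let ?s = "of_real (sqrt (real n)) :: complex"
  have "(\<lambda>p. det (mat_delete (shifted n (?s * snd p) (fst p)) i i)) \<in> borel_measurable (gauss_mat n \<Otimes>\<^sub>M (lborel :: complex measure))"
    if i: "i < n" for i
    unfolding m mat_delete_shifted
  proof (rule det_measurable)
    fix k l assume kl: "k < m" "l < m"
    have f1: "(\<lambda>p. fst p (insert_index i k, insert_index i l)) \<in> borel_measurable (gauss_mat (Suc m) \<Otimes>\<^sub>M (lborel :: complex measure))"
      by (rule measurable_compose[OF measurable_fst gauss_component_measurable]) (use kl in \<open>auto intro: insert_index_less\<close>)
    have f2: "(\<lambda>p. of_real (sqrt (real (Suc m))) * snd p) \<in> borel_measurable (gauss_mat (Suc m) \<Otimes>\<^sub>M (lborel :: complex measure))"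
      by (intro borel_measurable_times borel_measurable_const) simp
    show "(\<lambda>p. (if insert_index i k = insert_index i l then of_real (sqrt (real (Suc m))) * snd p else 0) - fst p (insert_index i k, insert_index i l))
      \<in> borel_measurable (gauss_mat (Suc m) \<Otimes>\<^sub>M (lborel :: complex measure))"
    proof (cases "insert_index i k = insert_index i l")
      case True
      then show ?thesis using borel_measurable_diff[OF f2 f1] by (simp only: if_True simp_thms)
    next
      case False
      then show ?thesis using borel_measurable_diff[OF borel_measurable_const f1] by (simp only: if_False simp_thms)
    qed
  qed
  then show ?thesis unfolding stieltjes_def
    by (intro borel_measurable_divide borel_measurable_sum borel_measurable_const det_shifted_joint_measurable) auto
qed

text \<open>
  For a fixed matrix only finitely many \<open>z\<close> are singular; Fubini's theorem exchanges the two
  quantifiers.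
\<close>

lemma AE_shifted_regular:
  assumes n: "n > 0"
  shows "AE z in lborel. AE D in gauss_mat m. det (shifted m (of_real (sqrt (real n)) * z) D) \<noteq> 0"
proof -
  let ?s = "of_real (sqrt (real n)) :: complex"
  interpret P: pair_sigma_finite "gauss_mat m" "lborel :: complex measure"
    by (simp add: pair_sigma_finite_def gauss_sf.sigma_finite_measure_axioms lborel.sigma_finite_measure_axioms)
  have "AE z in lborel. det (shifted m (?s * z) D) \<noteq> 0" for D
  proof -
    let ?B = "mat m m D"
    have c: "1 / ?s \<noteq> 0" using n by simp
    have "AE z in lborel. poly (char_poly ((1 / ?s) \<cdot>\<^sub>m ?B)) z \<noteq> 0"
      by (rule AE_char_poly_nonzero[of _ m]) simp
    then show ?thesis
    proof eventually_elim
      case (elim z)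
      have zc: "z / (1 / ?s) = ?s * z" by simp
      then show ?case
        using elim poly_char_poly_smult[OF _ c, of ?B m z] unfolding zc shifted_eq by auto
    qed
  qed
  then have "AE D in gauss_mat m. AE z in lborel. det (shifted m (?s * z) D) \<noteq> 0" by (simp add: AE_I2[where M="gauss_mat m"])
  then show ?thesis
  proof (subst (asm) P.AE_commute)
    have "(\<lambda>p. det (shifted m (?s * snd p) (fst p))) \<in> borel_measurable (gauss_mat m \<Otimes>\<^sub>M lborel)"
      by (rule det_shifted_joint_measurable)
    then have "(\<lambda>p. det (shifted m (?s * snd p) (fst p))) -` (- {0}) \<inter> space (gauss_mat m \<Otimes>\<^sub>M lborel) \<in> sets (gauss_mat m \<Otimes>\<^sub>M lborel)"
      by (rule measurable_sets) simp
    then show "{x \<in> space (gauss_mat m \<Otimes>\<^sub>M lborel). det (shifted m (?s * snd x) (fst x)) \<noteq> 0} \<in> sets (gauss_mat m \<Otimes>\<^sub>M lborel)"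
      by (simp add: vimage_def Int_def conj_commute)
  qed
qed

text \<open>
  The formula for a diagonal entry, at \<open>sqrt n * z\<close>, is the same for all indices and so passes
  to the trace. The uniform bound on the absolute moment is kept for the exchange of integrals
  over \<open>z\<close> and the matrix.
\<close>

lemma stieltjes_mean:
  assumes n: "n > 0"
  shows "AE z in lborel. (\<integral>D. stieltjes n D z \<partial>gauss_mat n) = of_real (1 - ginibre_tail n (real n * (cmod z)\<^sup>2)) / z
    \<and> (\<integral>\<^sup>+D. cmod (stieltjes n D z) \<partial>gauss_mat n) \<le> ennreal (3 * sqrt (real n))"
proof -
  obtain m where m: "n = Suc m" using n by (cases n) auto
  define s where "s = complex_of_real (sqrt (real n))"
  have s: "s \<noteq> 0" "s * s = of_nat n" "cmod s = sqrt (real n)" using n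
    by (simp_all add: s_def of_real_mult[symmetric] del: of_real_mult)
  have s2: "(cmod s)\<^sup>2 = real n" by (simp add: s(3))
  show ?thesis
    using AE_shifted_regular[OF n, of m] AE_lborel_singleton[of 0]
  proof eventually_elim
    case (elim z)
    define F where "F i D = (s * z) * det (mat_delete (shifted (Suc m) (s * z) D) i i) / det (shifted (Suc m) (s * z) D)" for i D
    have z: "z \<noteq> 0" using elim by simp
    note R = resolvent_diagonal_mean[OF _ elim(1)[folded s_def], folded F_def]
    have st: "stieltjes n D z = (\<Sum>i<n. F i D) / (of_nat n * z)" for D
    proof -
      have "(\<Sum>i<n. F i D) = (s * z) * ((\<Sum>i<n. det (mat_delete (shifted n (s * z) D) i i)) / det (shifted n (s * z) D))"
        unfolding F_def m by (simp only: sum_distrib_left sum_divide_distrib times_divide_eq_right)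
      then show ?thesis
        using z s by (simp add: stieltjes_def s_def[symmetric] s(2)[symmetric])
    qed
    have "(\<integral>D. stieltjes n D z \<partial>gauss_mat n) = (\<Sum>i<n. (\<integral>D. F i D \<partial>gauss_mat n)) / (of_nat n * z)"
      unfolding st integral_divide_zero using R(1) by (subst Bochner_Integration.integral_sum) (auto simp: m)
    also have "(\<Sum>i<n. (\<integral>D. F i D \<partial>gauss_mat n)) = (\<Sum>i<n. of_real (1 - ginibre_tail n ((cmod (s * z))\<^sup>2)))"
      using R(2) by (intro sum.cong refl) (simp add: m)
    also have "(cmod (s * z))\<^sup>2 = real n * (cmod z)\<^sup>2" by (simp add: norm_mult power_mult_distrib s2)
    finally have 1: "(\<integral>D. stieltjes n D z \<partial>gauss_mat n) = of_real (1 - ginibre_tail n (real n * (cmod z)\<^sup>2)) / z"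
      using n z by simp
    have Fm: "(\<lambda>D. ennreal (cmod (F i D))) \<in> borel_measurable (gauss_mat n)" if "i < n" for i
    proof -
      have "F i \<in> borel_measurable (gauss_mat n)" using R(1)[of i] that by (auto simp: m)
      then show ?thesis by (intro measurable_compose[OF measurable_compose[OF _ borel_measurable_norm] measurable_ennreal])
    qed
    have "(\<integral>\<^sup>+D. cmod (stieltjes n D z) \<partial>gauss_mat n) \<le> (\<integral>\<^sup>+D. ennreal (1 / (real n * cmod z)) * (\<Sum>i<n. ennreal (cmod (F i D))) \<partial>gauss_mat n)"
    proof (intro nn_integral_mono)
      fix D
      have "cmod (stieltjes n D z) \<le> (1 / (real n * cmod z)) * (\<Sum>i<n. cmod (F i D))"
        unfolding st norm_divide norm_mult using norm_sum[of "\<lambda>i. F i D" "{..<n}"] n z by (simp add: divide_right_mono)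
      then show "ennreal (cmod (stieltjes n D z)) \<le> ennreal (1 / (real n * cmod z)) * (\<Sum>i<n. ennreal (cmod (F i D)))"
        by (subst sum_ennreal, simp, subst ennreal_mult[symmetric]) (auto intro!: ennreal_leI sum_nonneg)
    qed
    also have "\<dots> = ennreal (1 / (real n * cmod z)) * (\<Sum>i<n. \<integral>\<^sup>+D. ennreal (cmod (F i D)) \<partial>gauss_mat n)"
    proof (subst nn_integral_cmult)
      show "(\<lambda>D. \<Sum>i<n. ennreal (cmod (F i D))) \<in> borel_measurable (gauss_mat n)"
        by (rule borel_measurable_sum, rule Fm) simp
      show "ennreal (1 / (real n * cmod z)) * (\<integral>\<^sup>+D. (\<Sum>i<n. ennreal (cmod (F i D))) \<partial>gauss_mat n) =
        ennreal (1 / (real n * cmod z)) * (\<Sum>i<n. \<integral>\<^sup>+D. ennreal (cmod (F i D)) \<partial>gauss_mat n)"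
        by (subst nn_integral_sum, rule Fm) (simp_all only: lessThan_iff)
    qed
    also have "\<dots> \<le> ennreal (1 / (real n * cmod z)) * (\<Sum>i<n. ennreal (3 * cmod (s * z)))"
      using R(3) by (intro mult_left_mono sum_mono) (auto simp: m)
    also have "\<dots> = ennreal (1 / (real n * cmod z) * (real n * (3 * cmod (s * z))))"
      by (subst sum_ennreal, simp, subst ennreal_mult[symmetric]) auto
    also have "1 / (real n * cmod z) * (real n * (3 * cmod (s * z))) = 3 * sqrt (real n)"
      using n z by (simp add: norm_mult s(3))
    finally show ?case using 1 by blast
  qed
qed

section \<open>Averaging the empirical spectral measures\<close>

abbreviation spectral_kernel :: "nat \<Rightarrow> (nat \<times> nat \<Rightarrow> complex) \<Rightarrow> complex measure" where
  "spectral_kernel n D \<equiv> empirical_spectral_measure (scaled n D)"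

lemma prob_space_spectral_kernel: "n > 0 \<Longrightarrow> prob_space (spectral_kernel n D)"
  by (rule prob_space_empirical_spectral_measure[of _ n]) auto

lemma stieltjes_section_measurable:
  assumes n: "n > 0"
  shows "stieltjes n D \<in> borel_measurable borel"
proof -
  have c: "stieltjes n D = (\<lambda>z. stieltjes n (restrict D (sqr n)) z)"
    unfolding stieltjes_def shifted_def
    by (intro ext arg_cong2[where f="(/)"] sum.cong refl arg_cong[where f=det] arg_cong2[where f="\<lambda>A i. mat_delete A i i"] eq_matI) auto
  have "restrict D (sqr n) \<in> space (gauss_mat n)" by (simp add: space_PiM)
  from measurable_Pair2[OF stieltjes_measurable[OF n] this] show ?thesis
    by (subst c) simp
qed

lemma spectral_kernel_bump:
  assumes n: "n > 0" and e: "\<epsilon> > 0"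
  shows "(\<integral>\<^sup>+l. ennreal (bump \<epsilon> (l - c)) \<partial>spectral_kernel n D) = ennreal (cauchy_average (stieltjes n D) \<epsilon> c)"
    and "0 \<le> cauchy_average (stieltjes n D) \<epsilon> c"
proof -
  have fin: "finite_measure (spectral_kernel n D)"
    using prob_space_spectral_kernel[OF n] by (rule prob_space.finite_measure)
  show "(\<integral>\<^sup>+l. ennreal (bump \<epsilon> (l - c)) \<partial>spectral_kernel n D) = ennreal (cauchy_average (stieltjes n D) \<epsilon> c)"
    "0 \<le> cauchy_average (stieltjes n D) \<epsilon> c"
    using bump_integral_cauchy[OF fin sets_empirical_spectral_measure e stieltjes_eq_cauchy[OF n] stieltjes_section_measurable[OF n]] by simp_all
qed

text \<open>
  Eigenvalues are awkward to select measurably, but the Cauchy transform is a rational function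
  of the entries. Its bump averages are measurable, and the measure of an open set is a limit of
  these.
\<close>

lemma spectral_kernel_measurable:
  assumes n: "n > 0"
  shows "spectral_kernel n \<in> gauss_mat n \<rightarrow>\<^sub>M prob_algebra borel"
proof (rule measurable_prob_algebra_generated[where \<Omega>=UNIV and G="{U. open U}"])
  show "sets borel = sigma_sets UNIV {U :: complex set. open U}" by (simp add: borel_def)
  show "Int_stable {U :: complex set. open U}" by (auto simp: Int_stable_def)
  show "prob_space (spectral_kernel n D)" for D by (rule prob_space_spectral_kernel[OF n])
  fix U :: "complex set" assume "U \<in> {U. open U}"
  then have U: "open U" by simp
  let ?e = "\<lambda>k. inverse (real (Suc k))"
  let ?a = "\<lambda>k D. (\<integral>\<^sup>+c. indicator (inner_part U (?e k)) c * ennreal (cauchy_average (stieltjes n D) (?e k) c) \<partial>lborel) / bump_mass (?e k)"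
  have am: "?a k \<in> borel_measurable (gauss_mat n)" for k
  proof -
    have [measurable]: "(\<lambda>p. stieltjes n (fst (fst p)) (snd p)) \<in> borel_measurable ((gauss_mat n \<Otimes>\<^sub>M lborel) \<Otimes>\<^sub>M lborel)"
    proof -
      have "(\<lambda>p. (fst (fst p), snd p)) \<in> (gauss_mat n \<Otimes>\<^sub>M lborel) \<Otimes>\<^sub>M lborel \<rightarrow>\<^sub>M gauss_mat n \<Otimes>\<^sub>M (lborel :: complex measure)"
        by (intro measurable_Pair measurable_compose[OF measurable_fst measurable_fst] measurable_snd)
      from measurable_compose[OF this stieltjes_measurable[OF n]] show ?thesis by simp
    qed
    have "(\<lambda>p. snd (fst p)) \<in> borel_measurable ((gauss_mat n \<Otimes>\<^sub>M lborel) \<Otimes>\<^sub>M (lborel :: complex measure))"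
      using measurable_compose[OF measurable_fst measurable_snd, of "gauss_mat n" "lborel :: complex measure" "lborel :: complex measure"] by simp
    moreover have "(\<lambda>p. snd p) \<in> borel_measurable ((gauss_mat n \<Otimes>\<^sub>M lborel) \<Otimes>\<^sub>M (lborel :: complex measure))"
      using measurable_snd[of "gauss_mat n \<Otimes>\<^sub>M (lborel :: complex measure)" "lborel :: complex measure"] by simp
    ultimately have d: "(\<lambda>p. snd p - snd (fst p)) \<in> borel_measurable ((gauss_mat n \<Otimes>\<^sub>M lborel) \<Otimes>\<^sub>M (lborel :: complex measure))"
      by (intro borel_measurable_diff)
    note [measurable] = d
    have ind: "indicator (ball c \<epsilon>) z = indicator {..<\<epsilon>} (cmod (z - c))" for c z \<epsilon>
      by (auto simp: indicator_def dist_norm norm_minus_commute)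
    have "(\<lambda>p. indicator (ball (snd (fst p)) (?e k)) (snd p) * (snd p - snd (fst p)) * stieltjes n (fst (fst p)) (snd p))
      \<in> borel_measurable ((gauss_mat n \<Otimes>\<^sub>M lborel) \<Otimes>\<^sub>M lborel)"
      unfolding ind by measurable
    then have "(\<lambda>q. \<integral>z. indicator (ball (snd q) (?e k)) z * (z - snd q) * stieltjes n (fst q) z \<partial>lborel) \<in> borel_measurable (gauss_mat n \<Otimes>\<^sub>M lborel)"
      by (intro lborel.borel_measurable_lebesgue_integral) (simp add: split_beta)
    then have ca: "(\<lambda>q. cauchy_average (stieltjes n (fst q)) (?e k) (snd q)) \<in> borel_measurable (gauss_mat n \<Otimes>\<^sub>M lborel)"
      unfolding cauchy_average_def by (rule measurable_compose[OF _ borel_measurable_Re])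
    have "(\<lambda>q. indicator (inner_part U (?e k)) (snd q)) \<in> borel_measurable (gauss_mat n \<Otimes>\<^sub>M (lborel :: complex measure))"
      by (rule measurable_compose[OF measurable_snd]) (simp add: inner_part_borel)
    then have "(\<lambda>q. indicator (inner_part U (?e k)) (snd q) * ennreal (cauchy_average (stieltjes n (fst q)) (?e k) (snd q))) \<in> borel_measurable (gauss_mat n \<Otimes>\<^sub>M lborel)"
      by (intro borel_measurable_times_ennreal measurable_compose[OF ca measurable_ennreal])
    then have "(\<lambda>D. \<integral>\<^sup>+c. indicator (inner_part U (?e k)) c * ennreal (cauchy_average (stieltjes n D) (?e k) c) \<partial>lborel) \<in> borel_measurable (gauss_mat n)"
      by (intro lborel.borel_measurable_nn_integral) (simp add: split_beta)
    then show ?thesis unfolding divide_ennreal_def by (intro borel_measurable_times_ennreal borel_measurable_const)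
  qed
  have lim: "(\<lambda>k. ?a k D) \<longlonglongrightarrow> emeasure (spectral_kernel n D) U" for D
  proof -
    have e: "?e k > 0" for k by simp
    show ?thesis
      using bump_integrals_tendsto[OF prob_space.finite_measure[OF prob_space_spectral_kernel[OF n]] sets_empirical_spectral_measure U, of D]
      unfolding spectral_kernel_bump(1)[OF n e] .
  qed
  show "(\<lambda>D. emeasure (spectral_kernel n D) U) \<in> borel_measurable (gauss_mat n)"
    by (rule borel_measurable_LIMSEQ_order[OF lim am])
qed auto

text \<open>
  Both measures have the same bump integrals: averaging the bump formula over the matrices, the
  Cauchy transform of the mean measure turns out to be that of the claimed law.
\<close>

proposition bind_spectral_kernel:
  assumes n: "n > 0"
  shows "gauss_mat n \<bind> spectral_kernel n = ginibre_law n"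
proof (rule measure_eqI_bump)
  let ?C = "\<lambda>z. of_real (1 - ginibre_tail n (real n * (cmod z)\<^sup>2)) / z :: complex"
  have K: "spectral_kernel n \<in> gauss_mat n \<rightarrow>\<^sub>M subprob_algebra borel"
    using spectral_kernel_measurable[OF n] by (rule measurable_prob_algebraD)
  have sp: "space (gauss_mat n) \<noteq> {}" using prob_space.not_empty[OF prob_space_gauss_vec] .
  show "finite_measure (gauss_mat n \<bind> spectral_kernel n)"
    by (intro prob_space.finite_measure prob_space.prob_space_bind[OF prob_space_gauss_vec _ K] AE_I2 prob_space_spectral_kernel n)
  show "sets (gauss_mat n \<bind> spectral_kernel n) = sets borel"
    by (rule sets_bind[OF _ sp]) simp
  show fl: "finite_measure (ginibre_law n)" by (rule prob_space.finite_measure[OF prob_space_ginibre_law[OF n]])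
  show "sets (ginibre_law n) = sets borel" by simp
  fix \<epsilon> :: real and c :: complex assume e: "\<epsilon> > 0"
  have [measurable]: "ball c \<epsilon> \<in> sets borel" by simp
  let ?k = "\<lambda>D z. indicator (ball c \<epsilon>) z * (z - c) * stieltjes n D z"
  interpret PS: pair_sigma_finite "gauss_mat n" "lborel :: complex measure"
    by (simp add: pair_sigma_finite_def gauss_sf.sigma_finite_measure_axioms lborel.sigma_finite_measure_axioms)
  have km: "case_prod ?k \<in> borel_measurable (gauss_mat n \<Otimes>\<^sub>M lborel)"
  proof -
    have s: "(\<lambda>p. snd p) \<in> borel_measurable (gauss_mat n \<Otimes>\<^sub>M (lborel :: complex measure))"
      using measurable_snd[of "gauss_mat n" "lborel :: complex measure"] by simp
    have "(\<lambda>z. indicator (ball c \<epsilon>) z * (z - c)) \<in> borel_measurable borel" by measurable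
    from measurable_compose[OF s this] show ?thesis
      unfolding split_beta by (rule borel_measurable_times[OF _ stieltjes_measurable[OF n]])
  qed
  have kint: "integrable (gauss_mat n \<Otimes>\<^sub>M lborel) (case_prod ?k)"
  proof (rule integrableI_bounded[OF km])
    have km': "(\<lambda>p. ennreal (cmod (case_prod ?k p))) \<in> borel_measurable (gauss_mat n \<Otimes>\<^sub>M lborel)"
      by (rule measurable_compose[OF measurable_compose[OF km borel_measurable_norm] measurable_ennreal])
    have "(\<integral>\<^sup>+x. ennreal (cmod (case_prod ?k x)) \<partial>(gauss_mat n \<Otimes>\<^sub>M lborel)) = (\<integral>\<^sup>+z. \<integral>\<^sup>+D. ennreal (cmod (?k D z)) \<partial>gauss_mat n \<partial>lborel)"
      using PS.nn_integral_snd[OF km'] by simp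
    also have "\<dots> \<le> (\<integral>\<^sup>+z. ennreal (\<epsilon> * (3 * sqrt (real n))) * indicator (ball c \<epsilon>) z \<partial>lborel)"
    proof (rule nn_integral_mono_AE)
      show "AE z in lborel. (\<integral>\<^sup>+D. ennreal (cmod (?k D z)) \<partial>gauss_mat n) \<le> ennreal (\<epsilon> * (3 * sqrt (real n))) * indicator (ball c \<epsilon>) z"
        using stieltjes_mean[OF n]
      proof eventually_elim
        case (elim z)
        show ?case
        proof (cases "z \<in> ball c \<epsilon>")
          case True
          then have zc: "cmod (z - c) \<le> \<epsilon>" by (simp add: dist_norm norm_minus_commute)
          have "(\<integral>\<^sup>+D. ennreal (cmod (?k D z)) \<partial>gauss_mat n) \<le> (\<integral>\<^sup>+D. ennreal \<epsilon> * ennreal (cmod (stieltjes n D z)) \<partial>gauss_mat n)"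
            using True zc e by (intro nn_integral_mono) (auto simp: norm_mult ennreal_mult[symmetric] intro!: ennreal_leI mult_right_mono)
          also have "\<dots> = ennreal \<epsilon> * (\<integral>\<^sup>+D. ennreal (cmod (stieltjes n D z)) \<partial>gauss_mat n)"
          proof (rule nn_integral_cmult)
            have "(\<lambda>D. stieltjes n D z) \<in> borel_measurable (gauss_mat n)"
              using measurable_Pair1[OF stieltjes_measurable[OF n], of z] by simp
            then show "(\<lambda>D. ennreal (cmod (stieltjes n D z))) \<in> borel_measurable (gauss_mat n)"
              by (intro measurable_compose[OF measurable_compose[OF _ borel_measurable_norm] measurable_ennreal])
          qed
          also have "\<dots> \<le> ennreal \<epsilon> * ennreal (3 * sqrt (real n))" using elim by (intro mult_left_mono) auto
          also have "\<dots> = ennreal (\<epsilon> * (3 * sqrt (real n)))" using e by (simp add: ennreal_mult)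
          finally show ?thesis using True by simp
        qed simp
      qed
    qed
    also have "\<dots> = ennreal (\<epsilon> * (3 * sqrt (real n))) * emeasure lborel (ball c \<epsilon>)"
      by (rule nn_integral_cmult_indicator) simp
    also have "\<dots> < \<infinity>"
      using emeasure_bounded_finite[of "ball c \<epsilon>"] by (simp add: ennreal_mult_less_top)
    finally show "(\<integral>\<^sup>+x. ennreal (cmod (case_prod ?k x)) \<partial>(gauss_mat n \<Otimes>\<^sub>M lborel)) < \<infinity>" .
  qed
  have cint: "integrable (gauss_mat n) (\<lambda>D. cauchy_average (stieltjes n D) \<epsilon> c)"
    unfolding cauchy_average_def by (rule integrable_Re[OF PS.integrable_fst[OF kint]])
  have swap: "(\<integral>D. cauchy_average (stieltjes n D) \<epsilon> c \<partial>gauss_mat n) = cauchy_average ?C \<epsilon> c"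
  proof -
    have "(\<integral>D. cauchy_average (stieltjes n D) \<epsilon> c \<partial>gauss_mat n) = Re (\<integral>D. \<integral>z. ?k D z \<partial>lborel \<partial>gauss_mat n)"
      unfolding cauchy_average_def by (rule integral_Re[OF PS.integrable_fst[OF kint]])
    also have "(\<integral>D. \<integral>z. ?k D z \<partial>lborel \<partial>gauss_mat n) = (\<integral>z. \<integral>D. ?k D z \<partial>gauss_mat n \<partial>lborel)"
      by (rule PS.Fubini_integral[OF kint, symmetric])
    also have "\<dots> = (\<integral>z. indicator (ball c \<epsilon>) z * (z - c) * ?C z \<partial>lborel)"
    proof (rule integral_cong_AE)
      show "(\<lambda>z. \<integral>D. ?k D z \<partial>gauss_mat n) \<in> borel_measurable lborel"
        using PS.integrable_snd[OF kint] by (rule borel_measurable_integrable)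
      show "(\<lambda>z. indicator (ball c \<epsilon>) z * (z - c) * ?C z) \<in> borel_measurable lborel" by measurable
      show "AE z in lborel. (\<integral>D. ?k D z \<partial>gauss_mat n) = indicator (ball c \<epsilon>) z * (z - c) * ?C z"
        using stieltjes_mean[OF n]
      proof eventually_elim
        case (elim z)
        have "(\<integral>D. ?k D z \<partial>gauss_mat n) = indicator (ball c \<epsilon>) z * (z - c) * (\<integral>D. stieltjes n D z \<partial>gauss_mat n)"
          by (rule integral_mult_right_zero)
        then show ?case using elim by (simp only:)
      qed
    qed
    finally show ?thesis by (simp only: cauchy_average_def)
  qed
  have "(\<integral>\<^sup>+l. ennreal (bump \<epsilon> (l - c)) \<partial>(gauss_mat n \<bind> spectral_kernel n)) = (\<integral>\<^sup>+D. \<integral>\<^sup>+l. ennreal (bump \<epsilon> (l - c)) \<partial>spectral_kernel n D \<partial>gauss_mat n)"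
    by (rule nn_integral_bind[OF _ K]) measurable
  also have "\<dots> = (\<integral>\<^sup>+D. ennreal (cauchy_average (stieltjes n D) \<epsilon> c) \<partial>gauss_mat n)"
    unfolding spectral_kernel_bump(1)[OF n e] ..
  also have "\<dots> = ennreal (cauchy_average ?C \<epsilon> c)"
    unfolding swap[symmetric] by (rule nn_integral_eq_integral[OF cint]) (intro AE_I2 spectral_kernel_bump(2)[OF n e])
  also have "\<dots> = (\<integral>\<^sup>+l. ennreal (bump \<epsilon> (l - c)) \<partial>ginibre_law n)"
  proof (rule bump_integral_cauchy(1)[OF fl _ e, symmetric])
    show "AE z in lborel. ?C z = (\<integral>l. 1 / (z - l) \<partial>ginibre_law n)"
      using AE_lborel_singleton[of 0] by eventually_elim (simp add: ginibre_law_cauchy[OF n])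
  qed simp_all
  finally show "(\<integral>\<^sup>+l. ennreal (bump \<epsilon> (l - c)) \<partial>(gauss_mat n \<bind> spectral_kernel n)) = (\<integral>\<^sup>+l. ennreal (bump \<epsilon> (l - c)) \<partial>ginibre_law n)" .
qed

section \<open>The mean spectral measure of a Ginibre matrix\<close>

text \<open>
  Independence together with the marginal densities says that the family of entries is
  distributed as the product of standard complex Gaussians.
\<close>

lemma distr_ginibre_entries:
  fixes G :: "'w \<Rightarrow> complex mat"
  assumes G: "complex_ginibre M n G" and n: "n > 0"
  shows "(\<lambda>\<omega>. \<lambda>p\<in>sqr n. G \<omega> $$ p) \<in> M \<rightarrow>\<^sub>M gauss_mat n"
    and "distr M (gauss_mat n) (\<lambda>\<omega>. \<lambda>p\<in>sqr n. G \<omega> $$ p) = gauss_mat n"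
proof -
  interpret M: prob_space M using G by (simp add: complex_ginibre_def)
  let ?X = "\<lambda>(i, j) \<omega>. G \<omega> $$ (i, j)"
  have X: "?X p = (\<lambda>\<omega>. G \<omega> $$ p)" for p by (simp add: split_beta)
  have dist: "distributed M lborel (\<lambda>\<omega>. G \<omega> $$ p) (\<lambda>z. ennreal (1 / pi * exp (- (cmod z)\<^sup>2)))" if "p \<in> sqr n" for p
    using G that by (cases p) (auto simp: complex_ginibre_def)
  have Xm: "(\<lambda>\<omega>. G \<omega> $$ p) \<in> borel_measurable M" if "p \<in> sqr n" for p
    using distributed_measurable[OF dist[OF that]] by simp
  have Xd: "distr M borel (\<lambda>\<omega>. G \<omega> $$ p) = cgauss" if "p \<in> sqr n" for p
  proof -
    have "distr M borel (\<lambda>\<omega>. G \<omega> $$ p) = distr M lborel (\<lambda>\<omega>. G \<omega> $$ p)" by (intro distr_cong) auto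
    then show ?thesis unfolding distributed_distr_eq_density[OF dist[OF that]] cgauss_def .
  qed
  show E: "(\<lambda>\<omega>. \<lambda>p\<in>sqr n. G \<omega> $$ p) \<in> M \<rightarrow>\<^sub>M gauss_mat n"
    by (intro measurable_restrict) (use Xm in \<open>simp add: measurable_cong_sets[OF refl sets_cgauss]\<close>)
  have "distr M (Pi\<^sub>M (sqr n) (\<lambda>_. borel)) (\<lambda>\<omega>. \<lambda>p\<in>sqr n. ?X p \<omega>) = Pi\<^sub>M (sqr n) (\<lambda>p. distr M borel (?X p))"
    using G n by (subst M.indep_vars_iff_distr_eq_PiM'[symmetric]) (auto simp: complex_ginibre_def X Xm intro: Xm[unfolded mem_Times_iff lessThan_iff])
  also have "Pi\<^sub>M (sqr n) (\<lambda>p. distr M borel (?X p)) = gauss_mat n"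
    by (intro PiM_cong refl) (simp only: X Xd)
  also have "distr M (Pi\<^sub>M (sqr n) (\<lambda>_. borel)) (\<lambda>\<omega>. \<lambda>p\<in>sqr n. ?X p \<omega>) = distr M (gauss_mat n) (\<lambda>\<omega>. \<lambda>p\<in>sqr n. G \<omega> $$ p)"
    unfolding X by (intro distr_cong refl sets_PiM_cong) simp
  finally show "distr M (gauss_mat n) (\<lambda>\<omega>. \<lambda>p\<in>sqr n. G \<omega> $$ p) = gauss_mat n" .
qed

proposition mean_spectral_measure_ginibre:
  fixes G :: "'w \<Rightarrow> complex mat"
  assumes n: "n > 0" and G: "complex_ginibre M n G"
  shows "mean_spectral_measure M n G = ginibre_law n"
proof -
  let ?E = "\<lambda>\<omega>. \<lambda>p\<in>sqr n. G \<omega> $$ p"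
  let ?\<mu> = "\<lambda>\<omega>. empirical_spectral_measure (complex_of_real (1 / sqrt (real n)) \<cdot>\<^sub>m G \<omega>)"
  note E = distr_ginibre_entries[OF G n]
  have K: "spectral_kernel n \<in> gauss_mat n \<rightarrow>\<^sub>M subprob_algebra borel"
    using spectral_kernel_measurable[OF n] by (rule measurable_prob_algebraD)
  have sp: "space (gauss_mat n) \<noteq> {}" using prob_space.not_empty[OF prob_space_gauss_vec] .
  have \<mu>: "?\<mu> \<omega> = spectral_kernel n (?E \<omega>)" if "\<omega> \<in> space M" for \<omega>
  proof -
    have "G \<omega> \<in> carrier_mat n n" using G that by (simp add: complex_ginibre_def)
    then have "G \<omega> = mat n n (?E \<omega>)" by (intro eq_matI) auto
    then show ?thesis by simp
  qed
  have em: "(\<lambda>D. emeasure (spectral_kernel n D) B) \<in> borel_measurable (gauss_mat n)" if "B \<in> sets borel" for B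
    by (rule measurable_emeasure_kernel[OF K that])
  have \<mu>m: "(\<lambda>\<omega>. emeasure (?\<mu> \<omega>) B) \<in> borel_measurable M" if "B \<in> sets borel" for B
    using measurable_compose[OF E(1) em[OF that]] \<mu> by (subst measurable_cong) auto
  show ?thesis
  proof (rule measure_eqI)
    show "sets (mean_spectral_measure M n G) = sets (ginibre_law n)" by (simp add: mean_spectral_measure_def)
    fix B assume "B \<in> sets (mean_spectral_measure M n G)"
    then have B: "B \<in> sets borel" by (simp add: mean_spectral_measure_def)
    have "emeasure (mean_spectral_measure M n G) B = (\<integral>\<^sup>+\<omega>. emeasure (?\<mu> \<omega>) B \<partial>M)"
      unfolding mean_spectral_measure_def by (rule emeasure_mean_measure[OF B _ \<mu>m]) simp_all
    also have "\<dots> = (\<integral>\<^sup>+\<omega>. emeasure (spectral_kernel n (?E \<omega>)) B \<partial>M)"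
      by (rule nn_integral_cong) (simp only: \<mu>)
    also have "\<dots> = (\<integral>\<^sup>+D. emeasure (spectral_kernel n D) B \<partial>distr M (gauss_mat n) ?E)"
      by (rule nn_integral_distr[OF E(1), symmetric]) (simp only: measurable_distr_eq1 em[OF B])
    also have "\<dots> = emeasure (gauss_mat n \<bind> spectral_kernel n) B"
      unfolding E(2) by (rule emeasure_bind[OF sp K B, symmetric])
    also have "\<dots> = emeasure (ginibre_law n) B" unfolding bind_spectral_kernel[OF n] ..
    finally show "emeasure (mean_spectral_measure M n G) B = emeasure (ginibre_law n) B" .
  qed
qed

section \<open>The total variation distance to the uniform law\<close>

lemma emeasure_unit_disc: "emeasure lborel (cball 0 1 :: complex set) = ennreal pi"
  by (simp add: emeasure_cball unit_ball_vol_2)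

lemma prob_space_uniform_disc: "prob_space uniform_disc"
  unfolding uniform_disc_def by (rule prob_space_uniform_measure) (simp_all add: emeasure_unit_disc)

lemma sets_uniform_disc: "sets uniform_disc = sets borel"
  by (simp add: uniform_disc_def)

lemma space_uniform_disc: "space uniform_disc = UNIV"
  by (simp add: uniform_disc_def)

lemma ginibre_law_le_uniform_disc:
  assumes B: "B \<in> sets borel" "B \<subseteq> cball 0 1"
  shows "measure (ginibre_law n) B \<le> measure uniform_disc B"
proof -
  interpret U: prob_space uniform_disc by (rule prob_space_uniform_disc)
  have "emeasure (ginibre_law n) B = (\<integral>\<^sup>+z. ennreal (1 / pi * ginibre_profile n ((cmod z)\<^sup>2)) * indicator B z \<partial>lborel)"
    unfolding ginibre_law_def by (rule emeasure_density) (use B in auto)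
  also have "\<dots> \<le> (\<integral>\<^sup>+z. ennreal (1 / pi) * indicator B z \<partial>lborel)"
    using ginibre_profile_le_1 by (intro nn_integral_mono mult_right_mono ennreal_leI) (auto simp: divide_right_mono)
  also have "\<dots> = ennreal (1 / pi) * emeasure lborel B" by (rule nn_integral_cmult_indicator) (use B in simp)
  also have "\<dots> = emeasure lborel (cball 0 1 \<inter> B) / ennreal pi"
    using B(2) by (simp add: Int_absorb1 divide_ennreal_def mult.commute inverse_ennreal inverse_eq_divide)
  also have "\<dots> = emeasure uniform_disc B"
    unfolding uniform_disc_def emeasure_unit_disc[symmetric] using B(1) by (simp add: emeasure_uniform_measure)
  finally show ?thesis unfolding measure_def by (intro enn2real_mono) (simp_all add: U.emeasure_finite less_top[symmetric])
qed

lemma measure_ginibre_law_disc: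
  assumes n: "n > 0"
  shows "measure (ginibre_law n) (cball 0 1) = 1 - ginibre_tail n (real n)"
proof -
  interpret L: prob_space "ginibre_law n" by (rule prob_space_ginibre_law[OF n])
  have "AE z in ginibre_law n. cmod z \<noteq> 1"
    unfolding ginibre_law_def by (subst AE_density) (use AE_cmod_neq[of 1] in auto)
  then have "emeasure (ginibre_law n) (- cball 0 1) = emeasure (ginibre_law n) {z. 1 \<le> cmod z}"
    by (intro emeasure_eq_AE) (auto simp: dist_norm)
  also have "\<dots> = ennreal (ginibre_tail n (real n))"
    using emeasure_ginibre_law_outside[OF n, of 1] by simp
  finally have "measure (ginibre_law n) (- cball 0 1) = ginibre_tail n (real n)"
    by (simp add: measure_def ginibre_tail_nonneg)
  then show ?thesis using L.prob_compl[of "cball 0 1"] by (simp add: Compl_eq_Diff_UNIV)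
qed

text \<open>
  Inside the disc the uniform law dominates, outside it is zero. So the
  difference of the two measures is largest on the disc itself, where it equals the mass that the
  law has outside the disc.
\<close>

proposition dist_TV_uniform_disc_ginibre_law:
  assumes n: "n > 0"
  shows "dist_TV uniform_disc (ginibre_law n) = ginibre_tail n (real n)"
proof -
  interpret U: prob_space uniform_disc by (rule prob_space_uniform_disc)
  interpret L: prob_space "ginibre_law n" by (rule prob_space_ginibre_law[OF n])
  let ?t = "ginibre_tail n (real n)"
  let ?D = "cball 0 1 :: complex set"
  let ?u = "measure uniform_disc" and ?l = "measure (ginibre_law n)"
  have D: "?D \<in> sets borel" by simp
  have uD: "?u ?D = 1"
    by (simp add: measure_def uniform_disc_def emeasure_unit_disc)
  have lD: "?l ?D = 1 - ?t" by (rule measure_ginibre_law_disc[OF n])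
  have t: "?t \<ge> 0" by (simp add: ginibre_tail_nonneg)
  have bound: "\<bar>?u A - ?l A\<bar> \<le> ?t" if A: "A \<in> sets borel" for A
  proof -
    have split: "measure \<mu> B = measure \<mu> (B \<inter> C) + measure \<mu> (B - C)"
      if "finite_measure \<mu>" "sets \<mu> = sets borel" "B \<in> sets borel" "C \<in> sets borel" for \<mu> and B C :: "complex set"
    proof -
      have "measure \<mu> ((B \<inter> C) \<union> (B - C)) = measure \<mu> (B \<inter> C) + measure \<mu> (B - C)"
        using that by (intro finite_measure.finite_measure_Union) auto
      then show ?thesis by (simp only: Int_Diff_Un)
    qed
    note u = split[OF U.finite_measure_axioms sets_uniform_disc]
    note l = split[OF L.finite_measure_axioms sets_ginibre_law]
    have "?u (A - ?D) \<le> ?u (UNIV - ?D)" using A by (intro U.finite_measure_mono) (auto simp: sets_uniform_disc)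
    also have "\<dots> = 0" using U.prob_compl[of ?D] uD by (simp add: sets_uniform_disc space_uniform_disc)
    finally have uA: "?u A = ?u (?D \<inter> A)" using u[OF A D] by (simp add: Int_commute measure_le_0_iff)
    have lA: "?l A = ?l (?D \<inter> A) + ?l (A - ?D)" using l[OF A D] by (simp add: Int_commute)
    have "?l (A - ?D) \<le> ?l (- ?D)" using A by (intro L.finite_measure_mono) auto
    also have "\<dots> = ?t" using L.prob_compl[of ?D] lD by (simp add: Compl_eq_Diff_UNIV)
    finally have out: "?l (A - ?D) \<le> ?t" .
    have "?l (?D \<inter> A) \<le> ?u (?D \<inter> A)" "?l (?D - A) \<le> ?u (?D - A)"
      using A by (intro ginibre_law_le_uniform_disc; auto)+
    moreover have "1 = ?u (?D \<inter> A) + ?u (?D - A)" "1 - ?t = ?l (?D \<inter> A) + ?l (?D - A)"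
      using u[OF D A] l[OF D A] uD lD by auto
    ultimately show ?thesis using uA lA out measure_nonneg[of "ginibre_law n" "A - ?D"] by linarith
  qed
  show ?thesis unfolding dist_TV_def
  proof (rule antisym)
    show "(SUP A\<in>sets borel. \<bar>?u A - ?l A\<bar>) \<le> ?t" by (rule cSUP_least) (use bound D in auto)
    have "\<bar>?u ?D - ?l ?D\<bar> \<le> (SUP A\<in>sets borel. \<bar>?u A - ?l A\<bar>)"
      by (rule cSUP_upper[OF D]) (use bound in \<open>auto intro!: bdd_aboveI2\<close>)
    then show "?t \<le> (SUP A\<in>sets borel. \<bar>?u A - ?l A\<bar>)" using uD lD t by simp
  qed
qed

section \<open>Stirling bounds\<close>

text \<open>
  For \<open>x = n\<close> the sum telescopes.
\<close>

lemma ginibre_tail_diagonal: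
  assumes n: "n > 0"
  shows "ginibre_tail n (real n) = exp (- real n) * real n ^ n / fact n"
proof -
  have "(\<Sum>k<m. (1 - real k / real n) * real n ^ k / fact k) = real m / real n * real n ^ m / fact m" for m
  proof (induction m)
    case (Suc m)
    have "(\<Sum>k<Suc m. (1 - real k / real n) * real n ^ k / fact k) = real m / real n * (real n ^ m / fact m) + (1 - real m / real n) * (real n ^ m / fact m)"
      using Suc by simp
    also have "\<dots> = real n ^ m / fact m" by (simp only: distrib_right[symmetric] add_diff_cancel_left' add_diff_eq mult_1_left add_diff_cancel_left')
    also have "\<dots> = real (Suc m) / real n * real n ^ Suc m / fact (Suc m)"
      using n by (simp add: fact_Suc del: of_nat_Suc)
    finally show ?case .
  qed simp
  then show ?thesis using n by (simp add: ginibre_tail_def)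
qed

text \<open>
  The logarithm of \<open>n! * exp n / n powr (n + 1/2)\<close>, which tends to \<open>ln (sqrt (2 * pi))\<close> by
  Stirling's formula.
\<close>

definition stirling_log :: "nat \<Rightarrow> real" where
  "stirling_log n = ln (fact n) + real n - (real n + 1 / 2) * ln (real n)"

text \<open>
  The increment is \<open>1 - (n + 1/2) * ln (1 + 1/n)\<close>. The logarithm is an integral of \<open>1 / t\<close>, which
  by convexity lies between the midpoint and the trapezoidal rule; the excess of the latter is
  \<open>1 / (4 n (n + 1))\<close>, the difference of \<open>1 / (4 n)\<close> at consecutive arguments.
\<close>

lemma stirling_log_step:
  assumes n: "n > 0"
  shows "stirling_log (Suc n) \<le> stirling_log n"
    and "stirling_log n - 1 / (4 * real n) \<le> stirling_log (Suc n) - 1 / (4 * real (Suc n))"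
proof -
  let ?n = "real n"
  let ?d = "ln (?n + 1) - ln ?n"
  have S: "real (Suc n) = ?n + 1" by simp
  have f: "ln (fact (Suc n) :: real) = ln (?n + 1) + ln (fact n)"
    by (simp add: ln_mult add.commute)
  have eq: "stirling_log (Suc n) - stirling_log n = 1 - (?n + 1 / 2) * ?d"
    unfolding stirling_log_def f S by (simp add: algebra_simps)
  have "2 / (2 * ?n + 1) \<le> ?d" using ln_inverse_approx_ge[of ?n "?n + 1"] n by simp
  then have "(?n + 1 / 2) * (2 / (2 * ?n + 1)) \<le> (?n + 1 / 2) * ?d" by (intro mult_left_mono) auto
  moreover have "(?n + 1 / 2) * (2 / (2 * ?n + 1)) = 1" by (simp add: field_simps)
  ultimately show "stirling_log (Suc n) \<le> stirling_log n" using eq by linarith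
  have "?d \<le> (1 / ?n + 1 / (?n + 1)) / 2" using ln_inverse_approx_le[of ?n 1] n by (simp add: inverse_eq_divide)
  then have "(?n + 1 / 2) * ?d \<le> (?n + 1 / 2) * ((1 / ?n + 1 / (?n + 1)) / 2)" by (intro mult_left_mono) auto
  also have "\<dots> = 1 + 1 / (4 * ?n) - 1 / (4 * real (Suc n))"
  proof -
    have nz: "?n \<noteq> 0" "?n + 1 \<noteq> 0" using n by linarith+
    show ?thesis unfolding S using nz by (simp add: divide_simps) (simp add: algebra_simps)
  qed
  finally show "stirling_log n - 1 / (4 * ?n) \<le> stirling_log (Suc n) - 1 / (4 * real (Suc n))" using eq by linarith
qed

text \<open>
  A decreasing and an increasing sequence, compared with their values \<open>1\<close> and \<open>3/4\<close> at
  \<open>n = 1\<close>.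
\<close>

lemma stirling_log_bounds:
  assumes n: "n > 0"
  shows "stirling_log n \<le> 1" and "3 / 4 \<le> stirling_log n"
proof -
  obtain m where m: "n = Suc m" using n by (cases n) auto
  have one: "stirling_log (Suc 0) = 1" by (simp add: stirling_log_def)
  have "stirling_log (Suc m) \<le> 1"
  proof (induction m)
    case (Suc m)
    then show ?case using stirling_log_step(1)[of "Suc m"] by linarith
  qed (simp add: one)
  then show "stirling_log n \<le> 1" by (simp only: m)
  have "3 / 4 \<le> stirling_log (Suc m) - 1 / (4 * real (Suc m))"
  proof (induction m)
    case (Suc m)
    then show ?case using stirling_log_step(2)[of "Suc m"] by linarith
  qed (simp add: one)
  also have "\<dots> \<le> stirling_log (Suc m)" by simp
  finally show "3 / 4 \<le> stirling_log n" by (simp only: m)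
qed

lemma ginibre_tail_diagonal_stirling:
  assumes n: "n > 0"
  shows "ginibre_tail n (real n) = exp (- stirling_log n) / sqrt (real n)"
proof -
  have "exp (- stirling_log n) = exp (real n * ln (real n)) * exp (ln (real n) / 2) / exp (ln (fact n)) * exp (- real n)"
    unfolding stirling_log_def exp_add[symmetric] exp_diff[symmetric] by (rule arg_cong[where f=exp]) (simp add: field_simps)
  also have "exp (real n * ln (real n)) = real n ^ n" using n by (simp add: exp_of_nat_mult)
  also have "exp (ln (real n) / 2) = sqrt (real n)" using n by (simp add: ln_sqrt[symmetric])
  finally show ?thesis using n by (simp add: ginibre_tail_diagonal[OF n])
qed

theorem proposition14:
  fixes M :: "'w measure" and G :: "'w \<Rightarrow> complex mat" and n :: nat
  assumes "n > 0" and "complex_ginibre M n G"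
  shows "1 / (exp 1 * sqrt (real n)) \<le> dist_TV uniform_disc (mean_spectral_measure M n G) \<and>
         dist_TV uniform_disc (mean_spectral_measure M n G) \<le> exp 1 / sqrt (real n)"
proof -
  have d: "dist_TV uniform_disc (mean_spectral_measure M n G) = exp (- stirling_log n) / sqrt (real n)"
    using assms by (simp add: mean_spectral_measure_ginibre dist_TV_uniform_disc_ginibre_law ginibre_tail_diagonal_stirling)
  have "exp (- 1) \<le> exp (- stirling_log n)" "exp (- stirling_log n) \<le> exp 1"
    using stirling_log_bounds[OF assms(1)] by auto
  then have "exp (- 1) / sqrt (real n) \<le> exp (- stirling_log n) / sqrt (real n)"
    "exp (- stirling_log n) / sqrt (real n) \<le> exp 1 / sqrt (real n)"
    by (intro divide_right_mono; simp)+
  then show ?thesis unfolding d by (simp add: exp_minus inverse_eq_divide)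
qed

end
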